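(* Let $n\ge2$. The eigenvalues $\lambda_{\ell,k}$ ($\ell\ge0$, $k\ge1$) of the linearized problem at the annular self-shrinker $\phi_A$ satisfy: - $\lambda_{0,1}>1$, $\ \lambda_{0,2}=1$; - $\lambda_{1,1}=1$, $\ \lambda_{1,2}=\frac12$; - $\lambda_{2,1}>0$, $\ \lambda_{2,2}<0$; - $\lambda_{3,1}>0$, $\ \lambda_{3,2}<0$; - $\lambda_{\ell,k}<0$ for every $\ell\ge4$ and every $k\ge1$; - $\lambda_{\ell,k}<0$ for every $\ell\ge0$ and every $k\ge3$.
   Context: Annular profile. For each $n\ge2$ there exist unique $0<r_-<r_+<\infty$ and a unique function $\phi=\phi_A\in C^2((r_-,r_+))\cap C^1([r_-,r_+])$ such that $\phi>0$ on $(r_-,r_+)$, $\phi(r_\pm)=0$, $\phi'(r_-)=1$, $\phi'(r_+)=-1$, and $\phi''+\left(\frac{n-1}{r}-\frac r2\right)\phi'+\frac12\phi=0$ on $(r_-,r_+)$. Linearized problem. With $A=\{y\in\mathbb{R}^n:r_-<|y|<r_+\}$ and $\partial/\partial n$ the derivative along the unit normal pointing into $A$, the linearized eigenvalue problem at $\phi_A(|y|)$ is $$\Delta v-\tfrac12y\cdot\nabla v+\tfrac12v=\lambda v\ \text{ in }A,\qquad \frac{\partial v}{\partial n}-\frac{\partial^2\phi_A}{\partial n^2}v=0\ \text{ on }\partial A.$$ Separating variables $v(r\omega)=\psi(r)g(\omega)$ with $g$ a spherical harmonic of degree $\ell\ge0$ on $\mathbb{S}^{n-1}$ and $\mu_\ell=\ell(\ell+n-2)$,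 it reduces to the Sturm–Liouville problems $$\psi''+\left(\frac{n-1}r-\frac r2\right)\psi'+\left(\frac12-\frac{\mu_\ell}{r^2}\right)\psi=\lambda\psi\ \text{ in }(r_-,r_+),\qquad \psi'(r_\pm)+\left(\frac{n-1}{r_\pm}-\frac{r_\pm}2\right)\psi(r_\pm)=0.$$ For each $\ell$, the eigenvalues of this problem are simple and are listed as $\lambda_{\ell,1}>\lambda_{\ell,2}>\cdots\to-\infty$. *)

theory Defs
  imports "HOL-Analysis.Analysis"
begin

text \<open>
  \<open>f\<close> is of class C1 on [a,b] and of class C2 on (a,b), with first and second derivatives
  \<open>f'\<close> and \<open>f''\<close>. At the endpoints \<open>f'\<close> is the one-sided derivative, because the
  difference quotient is restricted to [a,b]. The values of \<open>f''\<close> at the endpoints are irrelevant.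
\<close>
definition C1_closed_C2_open ::
    "real \<Rightarrow> real \<Rightarrow> (real \<Rightarrow> real) \<Rightarrow> (real \<Rightarrow> real) \<Rightarrow> (real \<Rightarrow> real) \<Rightarrow> bool" where
  "C1_closed_C2_open a b f f' f'' \<longleftrightarrow>
     (\<forall>r\<in>{a..b}. (f has_real_derivative f' r) (at r within {a..b})) \<and>
     continuous_on {a..b} f' \<and>
     (\<forall>r\<in>{a<..<b}. (f' has_real_derivative f'' r) (at r)) \<and>
     continuous_on {a<..<b} f''"

text \<open>The radial profile of the annular self-shrinker, as a function of \<open>r = |y|\<close>.\<close>
definition annular_profile :: "nat \<Rightarrow> real \<Rightarrow> real \<Rightarrow> (real \<Rightarrow> real) \<Rightarrow> bool" where
  "annular_profile n rm rp \<phi> \<longleftrightarrow>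
     0 < rm \<and> rm < rp \<and>
     (\<exists>\<phi>' \<phi>''.
        C1_closed_C2_open rm rp \<phi> \<phi>' \<phi>'' \<and>
        (\<forall>r\<in>{rm<..<rp}. 0 < \<phi> r) \<and>
        \<phi> rm = 0 \<and> \<phi> rp = 0 \<and> \<phi>' rm = 1 \<and> \<phi>' rp = -1 \<and>
        (\<forall>r\<in>{rm<..<rp}. \<phi>'' r + ((real n - 1) / r - r / 2) * \<phi>' r + 1/2 * \<phi> r = 0))"

text \<open>Degree-l eigenvalue of the Laplacian on the unit sphere of n-dimensional space, up to sign.\<close>
definition sphere_eigenvalue :: "nat \<Rightarrow> nat \<Rightarrow> real" where
  "sphere_eigenvalue n l = real l * (real l + real n - 2)"

text \<open>
  \<open>\<nu>\<close> is an eigenvalue of the Sturm--Liouville problem for the radial factor \<open>\<psi>\<close> of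
  \<open>v (r \<omega>) = \<psi> r * g \<omega>\<close>, \<open>g\<close> a spherical harmonic of degree \<open>l\<close>. The zeroth-order
  coefficient of the Robin condition is minus the ratio of the second to the first derivative
  of the profile at the endpoint, evaluated by means of the profile equation.
\<close>
definition linearized_eigenvalue :: "nat \<Rightarrow> nat \<Rightarrow> real \<Rightarrow> real \<Rightarrow> real \<Rightarrow> bool" where
  "linearized_eigenvalue n l rm rp \<nu> \<longleftrightarrow>
     (\<exists>\<psi> \<psi>' \<psi>''.
        C1_closed_C2_open rm rp \<psi> \<psi>' \<psi>'' \<and>
        (\<exists>r\<in>{rm..rp}. \<psi> r \<noteq> 0) \<and>
        (\<forall>r\<in>{rm<..<rp}.
           \<psi>'' r + ((real n - 1) / r - r / 2) * \<psi>' r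
             + (1/2 - sphere_eigenvalue n l / r\<^sup>2) * \<psi> r = \<nu> * \<psi> r) \<and>
        (\<forall>r\<in>{rm, rp}. \<psi>' r + ((real n - 1) / r - r / 2) * \<psi> r = 0))"

text \<open>
  \<open>\<Lambda> 1 > \<Lambda> 2 > \<dots>\<close> tends to minus infinity and lists exactly the degree-l eigenvalues.
  Each eigenvalue is simple, so it occurs once. The index starts at 1, and \<open>\<Lambda> 0\<close> is irrelevant.
\<close>
definition lists_linearized_eigenvalues ::
    "nat \<Rightarrow> nat \<Rightarrow> real \<Rightarrow> real \<Rightarrow> (nat \<Rightarrow> real) \<Rightarrow> bool" where
  "lists_linearized_eigenvalues n l rm rp \<Lambda> \<longleftrightarrow>
     (\<forall>k\<ge>1. \<Lambda> (Suc k) < \<Lambda> k) \<and>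
     filterlim \<Lambda> at_bot sequentially \<and>
     \<Lambda> ` {1..} = {\<nu>. linearized_eigenvalue n l rm rp \<nu>}"

end

theory Submission
  imports Defs
begin

text \<open>In flux form the radial problems are Sturm--Liouville systems, for which several solutions are explicit:
  constants and the translation and dilation modes of the profile. Sturm comparison with them settles every
  eigenvalue except for two scalar inequalities on the radii: an upper bound for the outer radius, which makes the
  potential positive for \<open>l \<ge> 4\<close>, and the sign of a Rayleigh quotient with trial function \<open>r ^ 3\<close>. For \<open>n < 40\<close> these
  follow from polynomial sub- and supersolutions with integer coefficients. For \<open>n \<ge> 40\<close> the second inequality
  degenerates to an equality as \<open>n \<rightarrow> \<infinity>\<close>; splitting the profile into even and odd parts about \<open>ln (sqrt (a b))\<close>
  isolates the first-order term, and the odd part turns out to be negative.\<close>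

text \<open>With \<open>u = wgt * \<psi>\<close> and \<open>x = \<psi>' + drift * \<psi>\<close> the
  Robin conditions say that the flux \<open>x\<close> vanishes at both ends, and an eigenvalue
  \<lambda> becomes the parameter 1 - \<lambda>. Sign claims about \<lambda> are then comparisons
  with parameter 1, where solutions in degrees 0, 2 and 3 are known in closed form or by quadrature.
  The radii are not known: only the overdetermined data of the profile fix them, and the two scalar
  inequalities depend on them. Barriers for the profile equation and for its adjoint enclose them.
  Why large \<open>n\<close> is different: put r = sqrt(2n) + s. As \<open>n\<close> grows the
  profile equation tends to f'' - s f' + f / 2 = 0, the weight to a Gaussian in s, and the factor n
  + 2 - r^2 / 2 of the degree 3 condition becomes proportional to s, so the limiting integrand is
  odd on a symmetric interval. Enclosures of fixed precision cannot decide such a limit; the sign of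
  the first asymmetry does, and it is governed by \<open>\<kappa>\<close>, which is n - a b / 2. In
  the coordinate ln r the midpoint of the interval is exact, so the parity splitting leaves no
  remainder terms.\<close>

section \<open>First-order Sturm-Liouville systems: uniqueness and existence\<close>

definition slsys :: "(real \<Rightarrow> real) \<Rightarrow> (real \<Rightarrow> real) \<Rightarrow> real \<Rightarrow> real \<Rightarrow> (real \<Rightarrow> real) \<Rightarrow> (real \<Rightarrow> real) \<Rightarrow> bool" where
  "slsys p Q a b u x \<longleftrightarrow> (\<forall>r\<in>{a..b}. (u has_real_derivative p r * x r) (at r within {a..b}) \<and>
     (x has_real_derivative Q r * u r) (at r within {a..b}))"

lemma slsysD:
  assumes "slsys p Q a b u x" "r \<in> {a..b}"
  shows "(u has_real_derivative p r * x r) (at r within {a..b})"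
    "(x has_real_derivative Q r * u r) (at r within {a..b})"
  using assms by (auto simp: slsys_def)

lemma slsys_cont:
  assumes "slsys p Q a b u x"
  shows "continuous_on {a..b} u" "continuous_on {a..b} x"
  by (rule DERIV_continuous_on, rule slsysD[OF assms], assumption)+

lemma slsys_interior:
  assumes "slsys p Q a b u x" "a < r" "r < b"
  shows "(u has_real_derivative p r * x r) (at r)" "(x has_real_derivative Q r * u r) (at r)"
proof -
  have "at r within {a..b} = at r"
    using assms by (intro at_within_interior) (auto simp: interior_atLeastAtMost_real)
  with slsysD[OF assms(1), of r] assms show "(u has_real_derivative p r * x r) (at r)" "(x has_real_derivative Q r * u r) (at r)"
    by auto
qed

lemma slsys_scale:
  assumes "slsys p Q a b u x"
  shows "slsys p Q a b (\<lambda>r. k * u r) (\<lambda>r. k * x r)"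
  using assms unfolding slsys_def
  by (auto intro!: derivative_eq_intros simp: algebra_simps)

lemma slsys_diff:
  assumes "slsys p Q a b u x" "slsys p Q a b v y"
  shows "slsys p Q a b (\<lambda>r. u r - v r) (\<lambda>r. x r - y r)"
  using assms unfolding slsys_def
  by (auto intro!: derivative_eq_intros simp: algebra_simps)

lemma slsys_subinterval:
  assumes "slsys p Q a b u x" "a \<le> c" "d \<le> b"
  shows "slsys p Q c d u x"
  unfolding slsys_def
proof
  fix r assume "r \<in> {c..d}"
  then show "(u has_real_derivative p r * x r) (at r within {c..d}) \<and> (x has_real_derivative Q r * u r) (at r within {c..d})"
    using slsysD[OF assms(1), of r] assms(2,3)
    by (auto intro: DERIV_subset)
qed

text \<open>Both systems share \<open>p\<close>, so the products of the two fluxes cancel and only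
  the difference of the potentials is left. Its sign drives every comparison below.\<close>

lemma slsys_wronskian:
  assumes "slsys p Q1 a b u x" "slsys p Q2 a b v y" "a < r" "r < b"
  shows "((\<lambda>r. u r * y r - v r * x r) has_real_derivative (Q2 r - Q1 r) * (u r * v r)) (at r)"
  by (rule derivative_eq_intros slsys_interior[OF assms(1,3,4)] slsys_interior[OF assms(2,3,4)] refl)+
     (simp add: algebra_simps)

lemma slsys_wronskian_cont:
  assumes "slsys p Q1 a b u x" "slsys p Q2 a b v y" "a \<le> s" "t \<le> b"
  shows "continuous_on {s..t} (\<lambda>r. u r * y r - v r * x r)"
proof -
  have "continuous_on {a..b} (\<lambda>r. u r * y r - v r * x r)"
    by (intro continuous_intros slsys_cont[OF assms(1)] slsys_cont[OF assms(2)])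
  then show ?thesis
    by (rule continuous_on_subset) (use assms in auto)
qed

lemma continuous_on_interval_bounded:
  fixes f :: "real \<Rightarrow> real"
  assumes "continuous_on {a..b} f"
  obtains M where "M \<ge> 0" "\<And>r. r \<in> {a..b} \<Longrightarrow> \<bar>f r\<bar> \<le> M"
proof -
  have "bounded (f ` {a..b})"
    using assms by (intro compact_imp_bounded compact_continuous_image) auto
  then obtain M where "\<And>x. x \<in> f ` {a..b} \<Longrightarrow> norm x \<le> M"
    unfolding bounded_iff by blast
  then show ?thesis
    by (intro that[of "max M 0"]) (auto simp: le_max_iff_disj)
qed

text \<open>The squared norm has derivative 2 (p + Q) u x, which is at most \<open>K\<close> times
  the squared norm in absolute value. The distance in the exponent makes the bound valid in both
  directions, so that uniqueness can start at either end or in the interior.\<close>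

lemma slsys_gronwall:
  assumes sys: "slsys p Q a b u x" and "a \<le> b"
    and bd: "\<And>r. r \<in> {a..b} \<Longrightarrow> \<bar>p r + Q r\<bar> \<le> K" and st: "s \<in> {a..b}" "t \<in> {a..b}"
  shows "(u t)\<^sup>2 + (x t)\<^sup>2 \<le> ((u s)\<^sup>2 + (x s)\<^sup>2) * exp (K * \<bar>t - s\<bar>)"
proof -
  define E where "E = (\<lambda>r. (u r)\<^sup>2 + (x r)\<^sup>2)"
  have E0: "E r \<ge> 0" for r by (simp add: E_def)
  have cE: "continuous_on {a..b} E"
    unfolding E_def by (intro continuous_intros slsys_cont[OF sys])
  have dE: "(E has_real_derivative 2 * (p r + Q r) * (u r * x r)) (at r)" if "a < r" "r < b" for r
    unfolding E_def
    by (rule derivative_eq_intros slsys_interior[OF sys that] refl)+ (simp add: algebra_simps)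
  have dE_le: "\<bar>2 * (p r + Q r) * (u r * x r)\<bar> \<le> K * E r" if "r \<in> {a..b}" for r
  proof -
    have "2 * \<bar>u r * x r\<bar> \<le> E r"
      using sum_squares_bound[of "\<bar>u r\<bar>" "\<bar>x r\<bar>"] by (simp add: E_def abs_mult)
    then have "\<bar>p r + Q r\<bar> * (2 * \<bar>u r * x r\<bar>) \<le> K * E r"
      using bd[OF that] by (intro mult_mono) auto
    then show ?thesis by (simp only: abs_mult mult_ac abs_numeral)
  qed
  have main: "E t \<le> E s * exp (K * (t - s))" if "s \<le> t" "s \<in> {a..b}" "t \<in> {a..b}" for s t
  proof -
    have "E t * exp (- K * t) \<le> E s * exp (- K * s)"
    proof (rule DERIV_nonpos_imp_decreasing_open[OF that(1)])
      fix r assume r: "s < r" "r < t"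
      have rr: "a < r" "r < b" using r that by auto
      have "((\<lambda>r. E r * exp (- K * r)) has_real_derivative (2 * (p r + Q r) * (u r * x r) - K * E r) * exp (- K * r)) (at r)"
        by (rule derivative_eq_intros dE[OF rr] refl)+ (simp add: algebra_simps)
      moreover have "(2 * (p r + Q r) * (u r * x r) - K * E r) * exp (- K * r) \<le> 0"
        using dE_le[of r] rr by (intro mult_nonpos_nonneg) auto
      ultimately show "\<exists>y. ((\<lambda>r. E r * exp (- K * r)) has_real_derivative y) (at r) \<and> y \<le> 0" by blast
    next
      show "continuous_on {s..t} (\<lambda>r. E r * exp (- K * r))"
        by (intro continuous_intros continuous_on_subset[OF cE]) (use that in auto)
    qed
    then have "E t * exp (- K * t) * exp (K * t) \<le> E s * exp (- K * s) * exp (K * t)"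
      by (rule mult_right_mono) simp
    then show ?thesis by (simp add: mult.assoc exp_add[symmetric] algebra_simps)
  qed
  have main2: "E t \<le> E s * exp (K * (s - t))" if "t \<le> s" "s \<in> {a..b}" "t \<in> {a..b}" for s t
  proof -
    have "E t * exp (K * t) \<le> E s * exp (K * s)"
    proof (rule DERIV_nonneg_imp_increasing_open[OF that(1)])
      fix r assume r: "t < r" "r < s"
      have rr: "a < r" "r < b" using r that by auto
      have "((\<lambda>r. E r * exp (K * r)) has_real_derivative (2 * (p r + Q r) * (u r * x r) + K * E r) * exp (K * r)) (at r)"
        by (rule derivative_eq_intros dE[OF rr] refl)+ (simp add: algebra_simps)
      moreover have "(2 * (p r + Q r) * (u r * x r) + K * E r) * exp (K * r) \<ge> 0"
        using dE_le[of r] rr by (intro mult_nonneg_nonneg) auto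
      ultimately show "\<exists>y. ((\<lambda>r. E r * exp (K * r)) has_real_derivative y) (at r) \<and> y \<ge> 0" by blast
    next
      show "continuous_on {t..s} (\<lambda>r. E r * exp (K * r))"
        by (intro continuous_intros continuous_on_subset[OF cE]) (use that in auto)
    qed
    then have "E t * exp (K * t) * exp (- K * t) \<le> E s * exp (K * s) * exp (- K * t)"
      by (rule mult_right_mono) simp
    then show ?thesis by (simp add: mult.assoc exp_add[symmetric] algebra_simps)
  qed
  show ?thesis
    using main[of s t] main2[of t s] st unfolding E_def by (cases "s \<le> t") auto
qed

lemma slsys_unique:
  assumes sys: "slsys p Q a b u x" and cont: "continuous_on {a..b} p" "continuous_on {a..b} Q"
    and t: "t \<in> {a..b}" "u t = 0" "x t = 0" and r: "r \<in> {a..b}"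
  shows "u r = 0" "x r = 0"
proof -
  have ab: "a \<le> b" using t by simp
  have "continuous_on {a..b} (\<lambda>r. p r + Q r)"
    by (intro continuous_intros cont)
  from continuous_on_interval_bounded[OF this] obtain K where "\<And>r. r \<in> {a..b} \<Longrightarrow> \<bar>p r + Q r\<bar> \<le> K"
    by blast
  from slsys_gronwall[OF sys ab this t(1) r] t(2,3)
  have "(u r)\<^sup>2 + (x r)\<^sup>2 \<le> 0" by simp
  then show "u r = 0" "x r = 0"
    by (simp_all add: sum_power2_le_zero_iff)
qed

text \<open>These are the terms of the Picard series, not its partial sums: each term is the
  integral of the previous one, and the solution is the sum over all of them.\<close>

primrec picard :: "(real \<Rightarrow> real) \<Rightarrow> (real \<Rightarrow> real) \<Rightarrow> real \<Rightarrow> real \<Rightarrow> real \<Rightarrow> nat \<Rightarrow> (real \<Rightarrow> real) \<times> (real \<Rightarrow> real)" where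
  "picard p Q a u0 x0 0 = ((\<lambda>_. u0), (\<lambda>_. x0))"
| "picard p Q a u0 x0 (Suc k) =
     ((\<lambda>r. integral {a..r} (\<lambda>s. p s * snd (picard p Q a u0 x0 k) s)),
      (\<lambda>r. integral {a..r} (\<lambda>s. Q s * fst (picard p Q a u0 x0 k) s)))"

lemma integral_power_shift:
  fixes a r M :: real
  assumes "a \<le> r"
  shows "((\<lambda>s. M * (M * (s - a)) ^ k / fact k) has_integral (M * (r - a)) ^ Suc k / fact (Suc k)) {a..r}"
proof -
  have "((\<lambda>s. (M * (s - a)) ^ Suc k / fact (Suc k)) has_vector_derivative M * (M * (s - a)) ^ k / fact k) (at s within {a..r})" for s
  proof -
    have "((\<lambda>s. (M * (s - a)) ^ Suc k / fact (Suc k)) has_real_derivative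
        (of_nat (Suc k) * M * (M * (s - a)) ^ k) / fact (Suc k)) (at s within {a..r})"
      by (rule derivative_eq_intros refl | simp)+
    moreover have "(of_nat (Suc k) * M * (M * (s - a)) ^ k) / fact (Suc k) = M * (M * (s - a)) ^ k / fact k"
      by (simp add: fact_Suc del: of_nat_Suc)
    ultimately show ?thesis
      by (simp only: has_real_derivative_iff_has_vector_derivative)
  qed
  from fundamental_theorem_of_calculus[OF assms this] show ?thesis by simp
qed

text \<open>Term \<open>k\<close> is at most \<open>B * (M * (r - a)) ^ k / fact k\<close>, with one
  bound \<open>M\<close> for both coefficients. The series is therefore dominated by an exponential
  series and may be differentiated term by term.\<close>

lemma slsys_exists:
  assumes ab: "a < b" and cp: "continuous_on {a..b} p" and cQ: "continuous_on {a..b} Q"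
  obtains u x where "slsys p Q a b u x" "u a = u0" "x a = x0"
proof -
  define e where "e = (\<lambda>k. fst (picard p Q a u0 x0 k))"
  define f where "f = (\<lambda>k. snd (picard p Q a u0 x0 k))"
  have eS: "e (Suc k) = (\<lambda>r. integral {a..r} (\<lambda>s. p s * f k s))"
    and fS: "f (Suc k) = (\<lambda>r. integral {a..r} (\<lambda>s. Q s * e k s))" for k
    by (simp_all add: e_def f_def)
  have e0: "e 0 = (\<lambda>_. u0)" and f0: "f 0 = (\<lambda>_. x0)" by (simp_all add: e_def f_def)
  have cont: "continuous_on {a..b} (e k) \<and> continuous_on {a..b} (f k)" for k
  proof (induction k)
    case 0 then show ?case by (simp add: e0 f0)
  next
    case (Suc k)
    then show ?case
      unfolding eS fS
      by (intro conjI indefinite_integral_continuous_1 integrable_continuous_interval continuous_intros cp cQ) auto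
  qed
  have de: "(e (Suc k) has_real_derivative p r * f k r) (at r within {a..b})"
    and df: "(f (Suc k) has_real_derivative Q r * e k r) (at r within {a..b})" if "r \<in> {a..b}" for k r
    unfolding eS fS using that cont[of k] cp cQ
    by (auto intro!: integral_has_real_derivative continuous_intros)
  obtain M1 where M1: "M1 \<ge> 0" "\<And>r. r \<in> {a..b} \<Longrightarrow> \<bar>p r\<bar> \<le> M1"
    using continuous_on_interval_bounded[OF cp] by blast
  obtain M2 where M2: "M2 \<ge> 0" "\<And>r. r \<in> {a..b} \<Longrightarrow> \<bar>Q r\<bar> \<le> M2"
    using continuous_on_interval_bounded[OF cQ] by blast
  define M where "M = M1 + M2"
  have M: "M \<ge> 0" "\<And>r. r \<in> {a..b} \<Longrightarrow> \<bar>p r\<bar> \<le> M" "\<And>r. r \<in> {a..b} \<Longrightarrow> \<bar>Q r\<bar> \<le> M"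
    using M1 M2 by (fastforce simp: M_def)+
  define B where "B = \<bar>u0\<bar> + \<bar>x0\<bar>"
  have B: "B \<ge> 0" by (simp add: B_def)
  have bnd: "\<bar>e k r\<bar> \<le> B * ((M * (r - a)) ^ k / fact k) \<and> \<bar>f k r\<bar> \<le> B * ((M * (r - a)) ^ k / fact k)"
    if "r \<in> {a..b}" for k r
    using that
  proof (induction k arbitrary: r)
    case 0 then show ?case by (simp add: e0 f0 B_def)
  next
    case (Suc k)
    have gi: "((\<lambda>s. B * (M * (M * (s - a)) ^ k / fact k)) has_integral B * ((M * (r - a)) ^ Suc k / fact (Suc k))) {a..r}"
      by (rule has_integral_mult_right, rule integral_power_shift) (use Suc.prems in auto)
    have le: "\<bar>q s * g s\<bar> \<le> B * (M * (M * (s - a)) ^ k / fact k)"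
      if "s \<in> {a..r}" "\<bar>q s\<bar> \<le> M" "\<bar>g s\<bar> \<le> B * ((M * (s - a)) ^ k / fact k)" for q g :: "real \<Rightarrow> real" and s
    proof -
      have "\<bar>q s\<bar> * \<bar>g s\<bar> \<le> M * (B * ((M * (s - a)) ^ k / fact k))"
        using that M(1) by (intro mult_mono) auto
      then show ?thesis by (simp add: abs_mult mult_ac)
    qed
    have sub: "{a..r} \<subseteq> {a..b}" using Suc.prems by auto
    have gen: "\<bar>integral {a..r} (\<lambda>s. q s * g s)\<bar> \<le> B * ((M * (r - a)) ^ Suc k / fact (Suc k))"
      if "continuous_on {a..b} q" "continuous_on {a..b} g" "\<And>s. s \<in> {a..b} \<Longrightarrow> \<bar>q s\<bar> \<le> M"
        "\<And>s. s \<in> {a..b} \<Longrightarrow> \<bar>g s\<bar> \<le> B * ((M * (s - a)) ^ k / fact k)" for q g :: "real \<Rightarrow> real"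
    proof -
      have "(\<lambda>s. q s * g s) integrable_on {a..r}"
        by (intro integrable_continuous_interval continuous_intros continuous_on_subset[OF that(1) sub] continuous_on_subset[OF that(2) sub])
      then have "norm (integral {a..r} (\<lambda>s. q s * g s)) \<le> integral {a..r} (\<lambda>s. B * (M * (M * (s - a)) ^ k / fact k))"
        using gi le that(3,4) sub by (intro integral_norm_bound_integral) (auto simp: has_integral_integrable)
      also have "\<dots> = B * ((M * (r - a)) ^ Suc k / fact (Suc k))"
        using gi by (rule integral_unique)
      finally show ?thesis by simp
    qed
    show ?case
      unfolding eS fS
      using gen[OF cp _ M(2), of "f k"] gen[OF cQ _ M(3), of "e k"] cont[of k] Suc.IH
      by auto
  qed
  define m where "m = (\<lambda>k. B * ((M * (b - a)) ^ k / fact k))"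
  have "summable (\<lambda>k. (M * (b - a)) ^ k / fact k)"
    using summable_exp_generic[of "M * (b - a)"] by (simp add: divide_inverse mult.commute)
  then have sm: "summable m" unfolding m_def by (rule summable_mult)
  have bm: "\<bar>e k r\<bar> \<le> m k" "\<bar>f k r\<bar> \<le> m k" if "r \<in> {a..b}" for k r
  proof -
    have "(M * (r - a)) ^ k / fact k \<le> (M * (b - a)) ^ k / fact k"
      using that M(1) by (intro divide_right_mono power_mono mult_left_mono) auto
    then have "B * ((M * (r - a)) ^ k / fact k) \<le> m k"
      unfolding m_def using B by (intro mult_left_mono) auto
    with bnd[OF that, of k] show "\<bar>e k r\<bar> \<le> m k" "\<bar>f k r\<bar> \<le> m k" by auto
  qed
  have sums: "summable (\<lambda>k. e k r)" "summable (\<lambda>k. f k r)" if "r \<in> {a..b}" for r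
    using bm[OF that] by (auto intro: summable_comparison_test'[OF sm, of 0])
  define u where "u = (\<lambda>r. \<Sum>k. e k r)"
  define x where "x = (\<lambda>r. \<Sum>k. f k r)"
  have main: "\<And>r. r \<in> {a..b} \<Longrightarrow> ((\<lambda>r. \<Sum>k. E k r) has_real_derivative q r * (\<Sum>k. F k r)) (at r within {a..b})"
    if E0: "E 0 = (\<lambda>_. v0)" and dE: "\<And>k r. r \<in> {a..b} \<Longrightarrow> (E (Suc k) has_real_derivative q r * F k r) (at r within {a..b})"
      and qM: "\<And>r. r \<in> {a..b} \<Longrightarrow> \<bar>q r\<bar> \<le> M" and Em: "\<And>k r. r \<in> {a..b} \<Longrightarrow> \<bar>E k r\<bar> \<le> m k"
      and Fm: "\<And>k r. r \<in> {a..b} \<Longrightarrow> \<bar>F k r\<bar> \<le> m k" for E F :: "nat \<Rightarrow> real \<Rightarrow> real" and q v0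
  proof -
    \<comment> \<open>Term 0 is constant, so the differentiated series starts with 0 and is
      afterwards the series of the other component shifted by one index.\<close>
    define E' where "E' = (\<lambda>k r. case k of 0 \<Rightarrow> 0 | Suc j \<Rightarrow> q r * F j r)"
    have d: "(E k has_real_derivative E' k r) (at r within {a..b})" if "r \<in> {a..b}" for k r
      using dE[OF that] by (cases k) (auto simp: E'_def E0)
    have sF: "summable (\<lambda>k. F k r)" if "r \<in> {a..b}" for r
      using Fm[OF that] by (auto intro: summable_comparison_test'[OF sm, of 0])
    have sE: "summable (\<lambda>k. E k r)" if "r \<in> {a..b}" for r
      using Em[OF that] by (auto intro: summable_comparison_test'[OF sm, of 0])
    have ul: "uniform_limit {a..b} (\<lambda>n r. \<Sum>i<n. E' i r) (\<lambda>r. \<Sum>i. E' i r) sequentially"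
    proof (rule Weierstrass_m_test)
      show "norm (E' k r) \<le> (case k of 0 \<Rightarrow> 0 | Suc j \<Rightarrow> M * m j)" if "r \<in> {a..b}" for k r
        using qM[OF that] Fm[OF that] M(1)
        by (cases k) (auto simp: E'_def abs_mult intro!: mult_mono)
      have "summable (\<lambda>j. M * m j)" using sm by (rule summable_mult)
      then show "summable (\<lambda>k. case k of 0 \<Rightarrow> 0 | Suc j \<Rightarrow> M * m j)"
        by (subst summable_Suc_iff[symmetric]) simp
    qed
    have lim: "(\<Sum>i. E' i r) = q r * (\<Sum>k. F k r)" if "r \<in> {a..b}" for r
    proof -
      have "(\<lambda>k. E' (Suc k) r) sums (q r * (\<Sum>k. F k r))"
        using sF[OF that] by (simp add: E'_def sums_mult summable_sums)
      then have "(\<lambda>k. E' k r) sums (q r * (\<Sum>k. F k r) + E' 0 r)"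
        by (subst (asm) sums_Suc_iff) simp
      then show ?thesis by (simp add: E'_def sums_iff)
    qed
    have "a \<in> {a..b}" using ab by simp
    from has_field_derivative_series[OF convex_real_interval(5) d ul this sE[OF this]]
    obtain g where g: "\<And>r. r \<in> {a..b} \<Longrightarrow> (\<lambda>n. E n r) sums g r \<and> (g has_real_derivative (\<Sum>i. E' i r)) (at r within {a..b})"
      by blast
    have gs: "(\<Sum>k. E k r) = g r" if "r \<in> {a..b}" for r using g[OF that] by (auto simp: sums_iff)
    fix r assume r: "r \<in> {a..b}"
    have "(g has_real_derivative q r * (\<Sum>k. F k r)) (at r within {a..b})"
      using g[OF r] lim[OF r] by simp
    then show "((\<lambda>r. \<Sum>k. E k r) has_real_derivative q r * (\<Sum>k. F k r)) (at r within {a..b})"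
      by (rule has_field_derivative_transform_within[OF _ zero_less_one r]) (use gs in auto)
  qed
  have "slsys p Q a b u x"
    unfolding slsys_def u_def x_def
    using main[of e u0 p f, OF e0 de M(2) bm(1) bm(2)] main[of f x0 Q e, OF f0 df M(3) bm(2) bm(1)]
    by auto
  moreover have "u a = u0" "x a = x0"
  proof -
    have "(\<lambda>k. e k a) sums e 0 a" "(\<lambda>k. f k a) sums f 0 a"
      by (rule sums_finite[of "{0}", simplified], auto simp: gr0_conv_Suc eS fS)+
    then show "u a = u0" "x a = x0" by (auto simp: u_def x_def e0 f0 sums_iff)
  qed
  ultimately show ?thesis using that by blast
qed

section \<open>Sturm comparison and zeros of eigenfunctions\<close>

lemma slsys_comparison_strict:
  assumes "slsys p Q1 a b u x" "slsys p Q2 a b v y" "a \<le> s" "s < t" "t \<le> b"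
    and "\<And>r. s < r \<Longrightarrow> r < t \<Longrightarrow> (Q2 r - Q1 r) * (u r * v r) < 0"
  shows "u t * y t - v t * x t < u s * y s - v s * x s"
proof (rule DERIV_neg_imp_decreasing_open[OF assms(4)])
  fix r assume "s < r" "r < t"
  then show "\<exists>d. ((\<lambda>r. u r * y r - v r * x r) has_real_derivative d) (at r) \<and> d < 0"
    using slsys_wronskian[OF assms(1,2), of r] assms(3,5,6) by force
qed (rule slsys_wronskian_cont[OF assms(1,2,3,5)])

lemma slsys_comparison:
  assumes "slsys p Q1 a b u x" "slsys p Q2 a b v y" "a \<le> s" "s \<le> t" "t \<le> b"
    and "\<And>r. s < r \<Longrightarrow> r < t \<Longrightarrow> (Q2 r - Q1 r) * (u r * v r) \<le> 0"
  shows "u t * y t - v t * x t \<le> u s * y s - v s * x s"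
proof (rule DERIV_nonpos_imp_decreasing_open[OF assms(4)])
  fix r assume "s < r" "r < t"
  then show "\<exists>d. ((\<lambda>r. u r * y r - v r * x r) has_real_derivative d) (at r) \<and> d \<le> 0"
    using slsys_wronskian[OF assms(1,2), of r] assms(3,5,6) by force
qed (rule slsys_wronskian_cont[OF assms(1,2,3,5)])

text \<open>A positive flux at \<open>t\<close> would persist near \<open>t\<close>, so
  \<open>v\<close> would increase up to its zero and could not be positive before it. Arguing by
  monotonicity inside the interval also covers \<open>t = b\<close>, where only a one-sided
  derivative is available.\<close>

lemma slsys_flux_at_right_zero:
  assumes sys: "slsys p Q a b v y" and p: "\<And>r. r \<in> {a..b} \<Longrightarrow> 0 < p r"
    and st: "a \<le> s" "s < t" "t \<le> b" and v: "\<And>r. s < r \<Longrightarrow> r < t \<Longrightarrow> 0 < v r" "v t = 0"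
  shows "y t \<le> 0"
proof (rule ccontr)
  assume "\<not> y t \<le> 0"
  then have yt: "0 < y t" by simp
  have cy: "continuous_on {s..t} y"
    by (rule continuous_on_subset[OF slsys_cont(2)[OF sys]]) (use st in auto)
  then have "continuous (at t within {s..t}) y"
    using st by (simp add: continuous_on_eq_continuous_within)
  then obtain d where d: "d > 0" "\<And>r. r \<in> {s..t} \<Longrightarrow> dist r t < d \<Longrightarrow> dist (y r) (y t) < y t"
    using yt unfolding continuous_within_eps_delta by blast
  define w where "w = max ((s + t) / 2) (t - d / 2)"
  have w: "s < w" "w < t" "t - d < w" using st d by (auto simp: w_def less_max_iff_disj max_def)
  have "v w < v t"
  proof (rule DERIV_pos_imp_increasing_open[OF w(2)])
    fix r assume r: "w < r" "r < t"
    have "0 < y r" using d(2)[of r] r w st by (auto simp: dist_real_def)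
    moreover have "0 < p r" using r w st p by auto
    ultimately show "\<exists>z. (v has_real_derivative z) (at r) \<and> 0 < z"
      using slsys_interior(1)[OF sys, of r] r w st by (intro exI[of _ "p r * y r"]) auto
  next
    show "continuous_on {w..t} v"
      by (rule continuous_on_subset[OF slsys_cont(1)[OF sys]]) (use st w in auto)
  qed
  with v(1)[of w] v(2) w show False by simp
qed

lemma slsys_reflect:
  assumes "slsys p Q a b u x"
  shows "slsys (\<lambda>r. p (a + b - r)) (\<lambda>r. Q (a + b - r)) a b (\<lambda>r. u (a + b - r)) (\<lambda>r. - x (a + b - r))"
proof -
  have im: "(\<lambda>r. a + b - r) ` {a..b} = {a..b}"
    by (simp add: image_diff_atLeastAtMost)
  have d: "((\<lambda>r. f (a + b - r)) has_real_derivative - D) (at r within {a..b})"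
    if "(f has_real_derivative D) (at (a + b - r) within {a..b})" for f D r
  proof -
    have "((\<lambda>r. a + b - r) has_real_derivative -1) (at r within {a..b})"
      by (auto intro!: derivative_eq_intros)
    from DERIV_image_chain[of f D "\<lambda>r. a + b - r" r "{a..b}", OF _ this] that
    show ?thesis by (simp add: im o_def)
  qed
  show ?thesis
    unfolding slsys_def
  proof (intro ballI conjI)
    fix r assume "r \<in> {a..b}"
    then have r: "a + b - r \<in> {a..b}" by auto
    show "((\<lambda>r. u (a + b - r)) has_real_derivative p (a + b - r) * - x (a + b - r)) (at r within {a..b})"
      using d[OF slsysD(1)[OF assms r]] by simp
    show "((\<lambda>r. - x (a + b - r)) has_real_derivative Q (a + b - r) * u (a + b - r)) (at r within {a..b})"
      using DERIV_minus[OF d[OF slsysD(2)[OF assms r]]] by simp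
  qed
qed

lemma slsys_flux_at_left_zero:
  assumes sys: "slsys p Q a b v y" and p: "\<And>r. r \<in> {a..b} \<Longrightarrow> 0 < p r"
    and st: "a \<le> s" "s < t" "t \<le> b" and v: "\<And>r. s < r \<Longrightarrow> r < t \<Longrightarrow> 0 < v r" "v s = 0"
  shows "0 \<le> y s"
  using slsys_flux_at_right_zero[OF slsys_reflect[OF sys], of "a + b - t" "a + b - s"] assms by auto

lemma nonvanishing_sign:
  fixes f :: "real \<Rightarrow> real"
  assumes "continuous_on S f" "connected S" "\<And>r. r \<in> S \<Longrightarrow> f r \<noteq> 0"
  shows "(\<forall>r\<in>S. 0 < f r) \<or> (\<forall>r\<in>S. f r < 0)"
proof (rule ccontr)
  assume "\<not> ?thesis"
  then obtain r1 r2 where r: "r1 \<in> S" "r2 \<in> S" "f r1 \<le> 0" "0 \<le> f r2" by (force simp: not_less)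
  have "connected (f ` S)" using assms by (intro connected_continuous_image) auto
  then have "0 \<in> f ` S" using r by (meson connectedD_interval image_eqI)
  then show False using assms(3) by auto
qed

lemma nonvanishing_normalize:
  fixes f :: "real \<Rightarrow> real"
  assumes "continuous_on S f" "connected S" "\<And>r. r \<in> S \<Longrightarrow> f r \<noteq> 0"
  obtains i :: real where "\<And>r. r \<in> S \<Longrightarrow> 0 < i * f r"
  using nonvanishing_sign[OF assms]
proof
  assume "\<forall>r\<in>S. 0 < f r"
  then show ?thesis by (intro that[of 1]) auto
next
  assume "\<forall>r\<in>S. f r < 0"
  then show ?thesis by (intro that[of "-1"]) auto
qed

lemma first_zero:
  fixes f :: "real \<Rightarrow> real"
  assumes "continuous_on {a..b} f" "z \<in> {a..b}" "f z = 0" "f a \<noteq> 0"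
  obtains t where "a < t" "t \<le> z" "f t = 0" "\<And>r. a \<le> r \<Longrightarrow> r < t \<Longrightarrow> f r \<noteq> 0"
proof -
  define Z where "Z = {r \<in> {a..b}. f r = 0}"
  have "closed Z"
    using continuous_closed_preimage[OF assms(1), of "{0}"] by (auto simp: Z_def vimage_def Int_def)
  have bb: "bdd_below Z" by (auto simp: Z_def)
  have zZ: "z \<in> Z" using assms by (simp add: Z_def)
  then have "Inf Z \<in> Z" using closed_contains_Inf[OF _ bb \<open>closed Z\<close>] by auto
  moreover have "Inf Z \<le> z" using zZ bb by (rule cInf_lower)
  moreover have "f r \<noteq> 0" if "a \<le> r" "r < Inf Z" for r
  proof
    assume "f r = 0"
    then have "r \<in> Z" using that \<open>Inf Z \<le> z\<close> assms(2) by (auto simp: Z_def)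
    then show False using cInf_lower[OF _ bb, of r] that by simp
  qed
  moreover have "a \<noteq> Inf Z" using \<open>Inf Z \<in> Z\<close> assms(4) by (auto simp: Z_def)
  ultimately show ?thesis using that[of "Inf Z"] by (auto simp: Z_def)
qed

text \<open>The Neumann condition concerns the flux \<open>x\<close>; for the original radial factor
  it is the Robin condition. The spectral parameter is part of \<open>Q\<close>.\<close>

definition neumann :: "(real \<Rightarrow> real) \<Rightarrow> (real \<Rightarrow> real) \<Rightarrow> real \<Rightarrow> real \<Rightarrow> (real \<Rightarrow> real) \<Rightarrow> (real \<Rightarrow> real) \<Rightarrow> bool" where
  "neumann p Q a b u x \<longleftrightarrow> slsys p Q a b u x \<and> x a = 0 \<and> x b = 0 \<and> (\<exists>r\<in>{a..b}. u r \<noteq> 0)"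

lemma neumann_nonzero_ends:
  assumes "neumann p Q a b u x" "a \<le> b" "continuous_on {a..b} p" "continuous_on {a..b} Q"
  shows "u a \<noteq> 0" "u b \<noteq> 0"
proof -
  from assms(1) have sys: "slsys p Q a b u x" and x: "x a = 0" "x b = 0" and nz: "\<exists>r\<in>{a..b}. u r \<noteq> 0"
    by (auto simp: neumann_def)
  show "u a \<noteq> 0" using slsys_unique(1)[OF sys assms(3,4), of a] x nz assms(2) by auto
  show "u b \<noteq> 0" using slsys_unique(1)[OF sys assms(3,4), of b] x nz assms(2) by auto
qed

lemma neumann_reflect:
  assumes "neumann p Q a b u x"
  shows "neumann (\<lambda>r. p (a + b - r)) (\<lambda>r. Q (a + b - r)) a b (\<lambda>r. u (a + b - r)) (\<lambda>r. - x (a + b - r))"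
proof -
  from assms obtain r where "r \<in> {a..b}" "u r \<noteq> 0" by (auto simp: neumann_def)
  then have "\<exists>r\<in>{a..b}. u (a + b - r) \<noteq> 0" by (intro bexI[of _ "a + b - r"]) auto
  with assms show ?thesis by (auto simp: neumann_def slsys_reflect)
qed

text \<open>The smaller potential oscillates faster. Without a zero of \<open>v\<close>, the
  Wronskian of the pair normalised to be positive starts at 0 and strictly decreases; but at
  \<open>t\<close> it is nonnegative if \<open>u t = 0\<close>, by the sign of the flux there, and
  it is 0 if \<open>t = b\<close>. The alternative in the hypothesis lets the nodal interval of
  \<open>u\<close> end at a zero or at the right end point.\<close>

lemma neumann_zero_before:
  assumes u: "neumann p Q1 a b u x" and v: "neumann p Q2 a b v y" and ab: "a < b"
    and c: "continuous_on {a..b} p" "continuous_on {a..b} Q1" "continuous_on {a..b} Q2"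
    and p: "\<And>r. r \<in> {a..b} \<Longrightarrow> 0 < p r" and Q: "\<And>r. r \<in> {a..b} \<Longrightarrow> Q2 r < Q1 r"
    and t: "a < t" "t \<le> b" "u t = 0 \<or> t = b" "\<And>r. a \<le> r \<Longrightarrow> r < t \<Longrightarrow> u r \<noteq> 0"
  shows "\<exists>z. a < z \<and> z < t \<and> v z = 0"
proof (rule ccontr)
  assume no: "\<not> ?thesis"
  have su: "slsys p Q1 a b u x" and sv: "slsys p Q2 a b v y" and x: "x a = 0" "x b = 0" and y: "y a = 0" "y b = 0"
    using u v by (auto simp: neumann_def)
  have va: "v a \<noteq> 0" using neumann_nonzero_ends(1)[OF v] ab c by simp
  have vnz: "v r \<noteq> 0" if "r \<in> {a..<t}" for r
  proof (cases "r = a")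
    case False
    with that no show ?thesis by auto
  qed (simp add: va)
  have unz: "u r \<noteq> 0" if "r \<in> {a..<t}" for r
    using t(4) that by simp
  have sub: "{a..<t} \<subseteq> {a..b}" using t by auto
  obtain j where j: "\<And>r. r \<in> {a..<t} \<Longrightarrow> 0 < j * v r"
    using nonvanishing_normalize[OF continuous_on_subset[OF slsys_cont(1)[OF sv] sub] connected_Ico vnz] by blast
  obtain i where i: "\<And>r. r \<in> {a..<t} \<Longrightarrow> 0 < i * u r"
    using nonvanishing_normalize[OF continuous_on_subset[OF slsys_cont(1)[OF su] sub] connected_Ico unz] by blast
  have su': "slsys p Q1 a b (\<lambda>r. i * u r) (\<lambda>r. i * x r)" and sv': "slsys p Q2 a b (\<lambda>r. j * v r) (\<lambda>r. j * y r)"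
    using su sv by (auto intro: slsys_scale)
  have "i * u t * (j * y t) - j * v t * (i * x t) < i * u a * (j * y a) - j * v a * (i * x a)"
  proof (rule slsys_comparison_strict[OF su' sv'])
    fix r assume "a < r" "r < t"
    then show "(Q2 r - Q1 r) * (i * u r * (j * v r)) < 0"
      using mult_neg_pos[of "Q2 r - Q1 r" "i * u r * (j * v r)"] mult_pos_pos[OF i[of r] j[of r]] Q[of r] t by simp
  qed (use t in auto)
  then have neg: "i * u t * (j * y t) - j * v t * (i * x t) < 0" using x y by simp
  \<comment> \<open>A zero of \<open>v\<close> at \<open>t\<close> itself is not excluded, so only
    the limit of positive values is available.\<close>
  have vt: "j * v t \<ge> 0"
  proof -
    have "continuous_on {a..t} (\<lambda>r. j * v r)"
      by (rule continuous_on_subset[OF slsys_cont(1)[OF sv']]) (use t in auto)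
    then have "((\<lambda>r. j * v r) \<longlongrightarrow> j * v t) (at t within {a..t})"
      using t by (simp add: continuous_on_def)
    moreover have "\<forall>\<^sub>F r in at t within {a..t}. j * v r \<ge> 0"
      using j by (auto simp: eventually_at_filter intro!: always_eventually less_imp_le)
    moreover have "at t within {a..t} \<noteq> bot"
      using t(1) by (simp add: trivial_limit_within islimpt_Icc)
    ultimately show ?thesis by (rule tendsto_lowerbound)
  qed
  show False
  proof (cases "u t = 0")
    case True
    have "i * x t \<le> 0"
      by (rule slsys_flux_at_right_zero[OF su' p, of a]) (use t i True in auto)
    with vt have "j * v t * (i * x t) \<le> 0" by (rule mult_nonneg_nonpos)
    with neg True show False by simp
  next
    case False
    with t have "t = b" by simp
    with neg x y show False by simp
  qed
qed

lemma neumann_zero_after: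
  assumes u: "neumann p Q1 a b u x" and v: "neumann p Q2 a b v y" and ab: "a < b"
    and c: "continuous_on {a..b} p" "continuous_on {a..b} Q1" "continuous_on {a..b} Q2"
    and p: "\<And>r. r \<in> {a..b} \<Longrightarrow> 0 < p r" and Q: "\<And>r. r \<in> {a..b} \<Longrightarrow> Q2 r < Q1 r"
    and t: "a \<le> t" "t < b" "u t = 0" "\<And>r. t < r \<Longrightarrow> r \<le> b \<Longrightarrow> u r \<noteq> 0"
  shows "\<exists>z. t < z \<and> z < b \<and> v z = 0"
proof -
  have cr: "continuous_on {a..b} (\<lambda>r. f (a + b - r))" if "continuous_on {a..b} f" for f :: "real \<Rightarrow> real"
    by (rule continuous_on_compose2[OF that]) (auto intro!: continuous_intros)
  have "\<exists>z. a < z \<and> z < a + b - t \<and> v (a + b - z) = 0"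
    by (rule neumann_zero_before[OF neumann_reflect[OF u] neumann_reflect[OF v] ab cr[OF c(1)] cr[OF c(2)] cr[OF c(3)]])
       (use p Q t in auto)
  then obtain z where "a < z" "z < a + b - t" "v (a + b - z) = 0" by blast
  then show ?thesis by (intro exI[of _ "a + b - z"]) auto
qed

lemma neumann_zero:
  assumes u: "neumann p Q1 a b u x" and v: "neumann p Q2 a b v y" and ab: "a < b"
    and c: "continuous_on {a..b} p" "continuous_on {a..b} Q1" "continuous_on {a..b} Q2"
    and p: "\<And>r. r \<in> {a..b} \<Longrightarrow> 0 < p r" and Q: "\<And>r. r \<in> {a..b} \<Longrightarrow> Q2 r < Q1 r"
  shows "\<exists>z. a < z \<and> z < b \<and> v z = 0"
proof (cases "\<exists>r\<in>{a..b}. u r = 0")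
  case True
  then obtain z where z: "z \<in> {a..b}" "u z = 0" by blast
  have ua: "u a \<noteq> 0" using neumann_nonzero_ends(1)[OF u] ab c by simp
  have cu: "continuous_on {a..b} u" using u by (auto simp: neumann_def intro: slsys_cont)
  obtain t where t: "a < t" "t \<le> z" "u t = 0" "\<And>r. a \<le> r \<Longrightarrow> r < t \<Longrightarrow> u r \<noteq> 0"
    using first_zero[OF cu z ua] by blast
  have tb: "t \<le> b" using t(2) z(1) by simp
  have "u t = 0 \<or> t = b" using t(3) by simp
  from neumann_zero_before[OF u v ab c p Q t(1) tb this t(4)] obtain w where "a < w" "w < t" "v w = 0" by blast
  with tb show ?thesis by (intro exI[of _ w]) simp
next
  case False
  then have "u r \<noteq> 0" if "a \<le> r" "r < b" for r using that by auto
  from neumann_zero_before[OF u v ab c p Q ab order_refl disjI2[OF refl] this] show ?thesis by blast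
qed

text \<open>The middle function \<open>v\<close> has a zero by comparison with \<open>u\<close>.
  Then \<open>w\<close> vanishes before the first zero of \<open>v\<close> and again after the last
  one.\<close>

lemma neumann_two_zeros:
  assumes u: "neumann p Q1 a b u x" and v: "neumann p Q2 a b v y" and w: "neumann p Q3 a b w z" and ab: "a < b"
    and c: "continuous_on {a..b} p" "continuous_on {a..b} Q1" "continuous_on {a..b} Q2" "continuous_on {a..b} Q3"
    and p: "\<And>r. r \<in> {a..b} \<Longrightarrow> 0 < p r"
    and Q: "\<And>r. r \<in> {a..b} \<Longrightarrow> Q2 r < Q1 r" "\<And>r. r \<in> {a..b} \<Longrightarrow> Q3 r < Q2 r"
  shows "\<exists>s t. a < s \<and> s < t \<and> t < b \<and> w s = 0 \<and> w t = 0"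
proof -
  obtain m where m: "a < m" "m < b" "v m = 0" using neumann_zero[OF u v ab c(1-3) p Q(1)] by blast
  have mab: "m \<in> {a..b}" and mab': "a + b - m \<in> {a..b}" "v (a + b - (a + b - m)) = 0" "v (a + b - a) \<noteq> 0"
    using m neumann_nonzero_ends(2)[OF v] ab c by auto
  have cv: "continuous_on {a..b} v" using v by (auto simp: neumann_def intro: slsys_cont)
  have va: "v a \<noteq> 0" and vb: "v b \<noteq> 0" using neumann_nonzero_ends[OF v] ab c by simp_all
  obtain t where t: "a < t" "t \<le> m" "v t = 0" "\<And>r. a \<le> r \<Longrightarrow> r < t \<Longrightarrow> v r \<noteq> 0"
    using first_zero[OF cv mab m(3) va] by blast
  have tb: "t \<le> b" using t(2) m(2) by simp
  obtain z1 where z1: "a < z1" "z1 < t" "w z1 = 0"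
    using neumann_zero_before[OF v w ab c(1,3,4) p Q(2) t(1) tb disjI1[OF t(3)] t(4)] by blast
  have cv': "continuous_on {a..b} (\<lambda>r. v (a + b - r))"
    by (rule continuous_on_compose2[OF cv]) (auto intro!: continuous_intros)
  obtain t' where t': "a < t'" "t' \<le> a + b - m" "v (a + b - t') = 0" "\<And>r. a \<le> r \<Longrightarrow> r < t' \<Longrightarrow> v (a + b - r) \<noteq> 0"
    using first_zero[OF cv' mab'] by blast
  have nz: "v r \<noteq> 0" if "a + b - t' < r" "r \<le> b" for r
    using t'(4)[of "a + b - r"] that by auto
  then obtain z2 where z2: "a + b - t' < z2" "z2 < b" "w z2 = 0"
    using neumann_zero_after[OF v w ab c(1,3,4) p Q(2) _ _ t'(3) nz] t' m by auto
  have "z1 < z2" using z1 z2 t t' m by linarith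
  with z1 z2 show ?thesis by blast
qed

section \<open>Dependence on the parameter and ground states by shooting\<close>

text \<open>The difference of two solutions solves the system with the source
  \<open>(\<nu> - \<nu>') * g * v\<close>, and \<open>v\<close> is bounded by the Gronwall estimate.
  The constant is uniform for parameters up to \<open>B\<close> because \<open>M\<close> already
  contains \<open>\<bar>B\<bar> * \<bar>g r\<bar>\<close>.\<close>

lemma slsys_parameter_lipschitz:
  assumes c: "continuous_on {a..b} p" "continuous_on {a..b} Q" "continuous_on {a..b} g" and ab: "a \<le> b"
  obtains C where "C > 0" "\<And>\<nu> \<nu>' u x v y r. \<lbrakk>slsys p (\<lambda>r. Q r - \<nu> * g r) a b u x; slsys p (\<lambda>r. Q r - \<nu>' * g r) a b v y;
      u a = u0; v a = u0; x a = x0; y a = x0; \<bar>\<nu>\<bar> \<le> B; \<bar>\<nu>'\<bar> \<le> B; r \<in> {a..b}\<rbrakk> \<Longrightarrow>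
      \<bar>u r - v r\<bar> \<le> C * \<bar>\<nu> - \<nu>'\<bar> \<and> \<bar>x r - y r\<bar> \<le> C * \<bar>\<nu> - \<nu>'\<bar>"
proof -
  obtain M where M: "M \<ge> 0" "\<And>r. r \<in> {a..b} \<Longrightarrow> \<bar>\<bar>p r\<bar> + \<bar>Q r\<bar> + \<bar>B\<bar> * \<bar>g r\<bar>\<bar> \<le> M"
  proof -
    have "continuous_on {a..b} (\<lambda>r. \<bar>p r\<bar> + \<bar>Q r\<bar> + \<bar>B\<bar> * \<bar>g r\<bar>)"
      by (intro continuous_intros c)
    from continuous_on_interval_bounded[OF this] that show thesis by blast
  qed
  obtain G where G: "G \<ge> 0" "\<And>r. r \<in> {a..b} \<Longrightarrow> \<bar>g r\<bar> \<le> G"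
    using continuous_on_interval_bounded[OF c(3)] by blast
  define V where "V = (u0\<^sup>2 + x0\<^sup>2) * exp (M * (b - a))"
  define W where "W = G\<^sup>2 * V"
  have V0: "V \<ge> 0" by (simp add: V_def)
  then have W0: "W \<ge> 0" by (simp add: W_def)
  define C where "C = sqrt (W * (b - a) * exp ((M + 1) * (b - a))) + 1"
  have "C > 0" unfolding C_def using W0 ab by (intro add_nonneg_pos real_sqrt_ge_zero mult_nonneg_nonneg) auto
  moreover have "\<bar>u r - v r\<bar> \<le> C * \<bar>\<nu> - \<nu>'\<bar> \<and> \<bar>x r - y r\<bar> \<le> C * \<bar>\<nu> - \<nu>'\<bar>"
    if su: "slsys p (\<lambda>r. Q r - \<nu> * g r) a b u x" and sv: "slsys p (\<lambda>r. Q r - \<nu>' * g r) a b v y"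
      and ini: "u a = u0" "v a = u0" "x a = x0" "y a = x0" and B: "\<bar>\<nu>\<bar> \<le> B" "\<bar>\<nu>'\<bar> \<le> B" and r: "r \<in> {a..b}"
    for \<nu> \<nu>' u x v y r
  proof -
    have K: "\<bar>p s + (Q s - \<mu> * g s)\<bar> \<le> M" if "\<bar>\<mu>\<bar> \<le> B" "s \<in> {a..b}" for \<mu> s
    proof -
      have "\<bar>\<mu> * g s\<bar> \<le> \<bar>B\<bar> * \<bar>g s\<bar>" using that by (simp add: abs_mult mult_right_mono)
      then show ?thesis using M(2)[OF that(2)] by linarith
    qed
    have vV: "(v s)\<^sup>2 \<le> V" if s: "s \<in> {a..b}" for s
    proof -
      have "(v s)\<^sup>2 + (y s)\<^sup>2 \<le> ((v a)\<^sup>2 + (y a)\<^sup>2) * exp (M * \<bar>s - a\<bar>)"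
        by (rule slsys_gronwall[OF sv ab K]) (use B s ab in auto)
      also have "\<dots> \<le> V"
        unfolding V_def ini using s M(1) by (intro mult_left_mono) (auto intro!: mult_left_mono)
      finally show ?thesis using zero_le_power2[of "y s"] by linarith
    qed
    define E where "E = (\<lambda>s. (u s - v s)\<^sup>2 + (x s - y s)\<^sup>2)"
    \<comment> \<open>The extra 1 in \<open>M + 1\<close> absorbs the square of the flux difference
      that arises when the source term is estimated by 2 x y \<le> x^2 + y^2; the subtracted linear
      term absorbs the source itself.\<close>
    define F where "F = (\<lambda>s. E s * exp (- (M + 1) * (s - a)) - (\<nu> - \<nu>')\<^sup>2 * W * (s - a))"
    have "F r \<le> F a"
    proof (rule DERIV_nonpos_imp_decreasing_open[of a r F])
      show "a \<le> r" using r by simp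
      show "continuous_on {a..r} F"
      proof (rule continuous_on_subset)
        show "continuous_on {a..b} F"
          unfolding F_def E_def by (intro continuous_intros slsys_cont[OF su] slsys_cont[OF sv])
      qed (use r in auto)
      fix s assume s: "a < s" "s < r"
      have sb: "s < b" and sab: "s \<in> {a..b}" using s r by auto
      define D X where "D = u s - v s" and "X = x s - y s"
      define E' where "E' = 2 * D * X * (p s + (Q s - \<nu> * g s)) - 2 * (\<nu> - \<nu>') * g s * v s * X"
      have dE: "(E has_real_derivative E') (at s)"
        unfolding E_def
        by (rule derivative_eq_intros slsys_interior[OF su s(1) sb] slsys_interior[OF sv s(1) sb] refl)+
           (simp add: E'_def D_def X_def algebra_simps power2_eq_square)
      have "(F has_real_derivative (E' - (M + 1) * E s) * exp (- (M + 1) * (s - a)) - (\<nu> - \<nu>')\<^sup>2 * W) (at s)"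
        unfolding F_def by (rule derivative_eq_intros dE refl)+ (simp add: algebra_simps)
      moreover have "(E' - (M + 1) * E s) * exp (- (M + 1) * (s - a)) - (\<nu> - \<nu>')\<^sup>2 * W \<le> 0"
      proof -
        have EDX: "E s = D\<^sup>2 + X\<^sup>2" by (simp add: E_def D_def X_def)
        have "\<bar>2 * D * X\<bar> \<le> E s"
          using sum_squares_bound[of "\<bar>D\<bar>" "\<bar>X\<bar>"] by (simp add: EDX abs_mult)
        then have "\<bar>2 * D * X\<bar> * \<bar>p s + (Q s - \<nu> * g s)\<bar> \<le> E s * M"
          using K[OF B(1) sab] by (intro mult_mono) (auto simp: EDX)
        then have e1: "2 * D * X * (p s + (Q s - \<nu> * g s)) \<le> M * E s"
          unfolding abs_mult[symmetric] mult.commute[of M] by (rule order_trans[OF abs_ge_self])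
        have "- 2 * ((\<nu> - \<nu>') * g s * v s) * X \<le> ((\<nu> - \<nu>') * g s * v s)\<^sup>2 + X\<^sup>2"
          using sum_squares_bound[of "- ((\<nu> - \<nu>') * g s * v s)" X] by simp
        moreover have "((\<nu> - \<nu>') * g s * v s)\<^sup>2 \<le> (\<nu> - \<nu>')\<^sup>2 * W"
        proof -
          have "(g s)\<^sup>2 * (v s)\<^sup>2 \<le> G\<^sup>2 * V"
            using vV[OF sab] G(2)[OF sab] by (intro mult_mono) (auto simp: abs_le_square_iff[symmetric] G(1))
          then show ?thesis by (simp add: W_def power_mult_distrib mult.assoc mult_left_mono)
        qed
        ultimately have e2: "E' - (M + 1) * E s \<le> (\<nu> - \<nu>')\<^sup>2 * W"
        proof -
          assume h: "- 2 * ((\<nu> - \<nu>') * g s * v s) * X \<le> ((\<nu> - \<nu>') * g s * v s)\<^sup>2 + X\<^sup>2"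
            "((\<nu> - \<nu>') * g s * v s)\<^sup>2 \<le> (\<nu> - \<nu>')\<^sup>2 * W"
          have "X\<^sup>2 \<le> E s" by (simp add: EDX)
          moreover have "E' = 2 * D * X * (p s + (Q s - \<nu> * g s)) + - 2 * ((\<nu> - \<nu>') * g s * v s) * X"
            by (simp add: E'_def algebra_simps)
          moreover have "(M + 1) * E s = M * E s + E s" by (simp add: algebra_simps)
          ultimately show ?thesis using e1 h by linarith
        qed
        have "exp (- (M + 1) * (s - a)) \<le> 1" using M(1) s by (simp add: mult_nonpos_nonneg)
        then have "(\<nu> - \<nu>')\<^sup>2 * W * exp (- (M + 1) * (s - a)) \<le> (\<nu> - \<nu>')\<^sup>2 * W * 1"
          using W0 by (intro mult_left_mono) auto
        moreover have "(E' - (M + 1) * E s) * exp (- (M + 1) * (s - a)) \<le> (\<nu> - \<nu>')\<^sup>2 * W * exp (- (M + 1) * (s - a))"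
          using e2 by (intro mult_right_mono) auto
        ultimately show ?thesis by linarith
      qed
      ultimately show "\<exists>d. (F has_real_derivative d) (at s) \<and> d \<le> 0" by blast
    qed
    also have "F a = 0" by (simp add: F_def E_def ini)
    finally have "E r * exp (- (M + 1) * (r - a)) \<le> (\<nu> - \<nu>')\<^sup>2 * W * (r - a)" by (simp add: F_def)
    then have "E r * exp (- (M + 1) * (r - a)) * exp ((M + 1) * (r - a)) \<le> (\<nu> - \<nu>')\<^sup>2 * W * (r - a) * exp ((M + 1) * (r - a))"
      by (rule mult_right_mono) simp
    then have "E r \<le> (\<nu> - \<nu>')\<^sup>2 * (W * (r - a) * exp ((M + 1) * (r - a)))"
      by (simp add: mult.assoc exp_add[symmetric] algebra_simps)
    also have "\<dots> \<le> (\<nu> - \<nu>')\<^sup>2 * (W * (b - a) * exp ((M + 1) * (b - a)))"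
      using r W0 M(1) by (intro mult_left_mono mult_mono) (auto intro!: mult_left_mono)
    also have "\<dots> \<le> (\<nu> - \<nu>')\<^sup>2 * C\<^sup>2"
    proof (intro mult_left_mono)
      have "W * (b - a) * exp ((M + 1) * (b - a)) = (sqrt (W * (b - a) * exp ((M + 1) * (b - a))))\<^sup>2"
        using W0 ab by simp
      also have "\<dots> \<le> C\<^sup>2" unfolding C_def using W0 ab by (intro power_mono) auto
      finally show "W * (b - a) * exp ((M + 1) * (b - a)) \<le> C\<^sup>2" .
    qed simp
    also have "\<dots> = (C * \<bar>\<nu> - \<nu>'\<bar>)\<^sup>2" by (simp add: power_mult_distrib)
    finally have "E r \<le> (C * \<bar>\<nu> - \<nu>'\<bar>)\<^sup>2" .
    then have "(u r - v r)\<^sup>2 \<le> (C * \<bar>\<nu> - \<nu>'\<bar>)\<^sup>2" "(x r - y r)\<^sup>2 \<le> (C * \<bar>\<nu> - \<nu>'\<bar>)\<^sup>2"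
      unfolding E_def using zero_le_power2[of "u r - v r"] zero_le_power2[of "x r - y r"] by linarith+
    moreover have "C * \<bar>\<nu> - \<nu>'\<bar> \<ge> 0" using \<open>C > 0\<close> by simp
    ultimately show ?thesis by (simp add: abs_le_square_iff[symmetric])
  qed
  ultimately show ?thesis using that by blast
qed


lemma continuous_on_interval_positive_min:
  fixes f :: "real \<Rightarrow> real"
  assumes "continuous_on {a..b} f" "\<And>r. r \<in> {a..b} \<Longrightarrow> 0 < f r"
  obtains m where "m > 0" "\<And>r. r \<in> {a..b} \<Longrightarrow> m \<le> f r"
proof (cases "a \<le> b")
  case True
  then obtain z where "z \<in> {a..b}" "\<And>r. r \<in> {a..b} \<Longrightarrow> f z \<le> f r"
    using continuous_attains_inf[of "{a..b}" f] assms(1) by (auto simp: Ball_def)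
  then show ?thesis using that[of "f z"] assms(2) by blast
qed (use that[of 1] in auto)

text \<open>Shooting from the left end with zero flux. A parameter is \<open>good\<close> if the
  solution stays positive and arrives with positive flux. Very negative parameters are good,
  \<open>\<nu>B\<close> is not, and goodness is an open condition. At the infimum of the failing
  parameters the solution is a limit of good ones without being good, which makes it a positive
  eigenfunction.\<close>

lemma neumann_ground_state:
  assumes ab: "a < b" and c: "continuous_on {a..b} p" "continuous_on {a..b} Q" "continuous_on {a..b} g"
    and p: "\<And>r. r \<in> {a..b} \<Longrightarrow> 0 < p r" and g: "\<And>r. r \<in> {a..b} \<Longrightarrow> 0 < g r"
    and B: "slsys p (\<lambda>r. Q r - \<nu>B * g r) a b uB xB" "uB a = 1" "xB a = 0"
    and bad: "(\<exists>r\<in>{a..b}. uB r \<le> 0) \<or> xB b \<le> 0"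
  shows "\<exists>\<nu>\<le>\<nu>B. \<exists>u x. neumann p (\<lambda>r. Q r - \<nu> * g r) a b u x \<and> u a = 1 \<and> (\<forall>r\<in>{a..b}. 0 < u r)"
proof -
  have cQ: "continuous_on {a..b} (\<lambda>r. Q r - \<nu> * g r)" for \<nu>
    by (intro continuous_intros c)
  have "\<exists>w. slsys p (\<lambda>r. Q r - \<nu> * g r) a b (fst w) (snd w) \<and> fst w a = 1 \<and> snd w a = 0" for \<nu>
  proof -
    obtain u x where "slsys p (\<lambda>r. Q r - \<nu> * g r) a b u x" "u a = 1" "x a = 0"
      by (rule slsys_exists[OF ab c(1) cQ])
    then show ?thesis by (intro exI[of _ "(u, x)"]) simp
  qed
  then have "\<exists>W. \<forall>\<nu>. slsys p (\<lambda>r. Q r - \<nu> * g r) a b (fst (W \<nu>)) (snd (W \<nu>)) \<and> fst (W \<nu>) a = 1 \<and> snd (W \<nu>) a = 0"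
    by (intro choice) blast
  then obtain W where W: "\<And>\<nu>. slsys p (\<lambda>r. Q r - \<nu> * g r) a b (fst (W \<nu>)) (snd (W \<nu>))"
    "\<And>\<nu>. fst (W \<nu>) a = 1" "\<And>\<nu>. snd (W \<nu>) a = 0"
    by blast
  define U X where "U = (\<lambda>\<nu>. fst (W \<nu>))" and "X = (\<lambda>\<nu>. snd (W \<nu>))"
  have UX: "\<And>\<nu>. slsys p (\<lambda>r. Q r - \<nu> * g r) a b (U \<nu>) (X \<nu>)" "\<And>\<nu>. U \<nu> a = 1" "\<And>\<nu>. X \<nu> a = 0"
    using W by (auto simp: U_def X_def)
  define good where "good = (\<lambda>\<nu>. (\<forall>r\<in>{a..b}. 0 < U \<nu> r) \<and> 0 < X \<nu> b)"
  obtain M where M: "M \<ge> 0" "\<And>r. r \<in> {a..b} \<Longrightarrow> \<bar>Q r\<bar> \<le> M" using continuous_on_interval_bounded[OF c(2)] by blast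
  obtain m where m: "m > 0" "\<And>r. r \<in> {a..b} \<Longrightarrow> m \<le> g r" using continuous_on_interval_positive_min[OF c(3) g] by blast
  \<comment> \<open>Below this bound the potential is positive. Then \<open>u * x\<close> and hence
    \<open>u\<^sup>2\<close> are nondecreasing, so \<open>u\<close> cannot reach 0, and the flux
    grows strictly.\<close>
  have good_low: "good \<nu>" if nu: "\<nu> \<le> - (M / m) - 1" for \<nu>
  proof -
    have pos: "0 < Q r - \<nu> * g r" if "r \<in> {a..b}" for r
    proof -
      have "(M / m + 1) * m \<le> - \<nu> * g r"
        using nu m(1) m(2)[OF that] divide_nonneg_pos[OF M(1) m(1)] by (intro mult_mono) auto
      moreover have "(M / m + 1) * m = M + m" using m(1) by (simp add: field_simps)
      ultimately have "M + m \<le> - \<nu> * g r" by simp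
      then show ?thesis using M(2)[OF that] m(1) by auto
    qed
    note cu = slsys_cont[OF UX(1)[of \<nu>]]
    have ux: "0 \<le> U \<nu> r * X \<nu> r" if "r \<in> {a..b}" for r
    proof -
      have "U \<nu> a * X \<nu> a \<le> U \<nu> r * X \<nu> r"
      proof (rule DERIV_nonneg_imp_increasing_open[of a r "\<lambda>r. U \<nu> r * X \<nu> r"])
        fix s assume s: "a < s" "s < r"
        then have sb: "s < b" and sab: "s \<in> {a..b}" using that by auto
        have "((\<lambda>r. U \<nu> r * X \<nu> r) has_real_derivative p s * (X \<nu> s)\<^sup>2 + (Q s - \<nu> * g s) * (U \<nu> s)\<^sup>2) (at s)"
          by (rule derivative_eq_intros slsys_interior[OF UX(1) s(1) sb] refl)+ (simp add: power2_eq_square)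
        moreover have "0 \<le> p s * (X \<nu> s)\<^sup>2 + (Q s - \<nu> * g s) * (U \<nu> s)\<^sup>2"
          using p[OF sab] pos[OF sab] by simp
        ultimately show "\<exists>d. ((\<lambda>r. U \<nu> r * X \<nu> r) has_real_derivative d) (at s) \<and> 0 \<le> d" by blast
      next
        show "continuous_on {a..r} (\<lambda>r. U \<nu> r * X \<nu> r)"
          by (intro continuous_intros continuous_on_subset[OF cu(1)] continuous_on_subset[OF cu(2)]) (use that in auto)
      qed (use that in auto)
      then show ?thesis by (simp add: UX)
    qed
    have usq: "1 \<le> (U \<nu> r)\<^sup>2" if "r \<in> {a..b}" for r
    proof -
      have "(U \<nu> a)\<^sup>2 \<le> (U \<nu> r)\<^sup>2"
      proof (rule DERIV_nonneg_imp_increasing_open[of a r "\<lambda>r. (U \<nu> r)\<^sup>2"])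
        fix s assume s: "a < s" "s < r"
        then have sb: "s < b" and sab: "s \<in> {a..b}" using that by auto
        have "((\<lambda>r. (U \<nu> r)\<^sup>2) has_real_derivative 2 * p s * (U \<nu> s * X \<nu> s)) (at s)"
          by (rule derivative_eq_intros slsys_interior[OF UX(1) s(1) sb] refl)+ simp
        moreover have "0 \<le> 2 * p s * (U \<nu> s * X \<nu> s)"
          using p[OF sab] ux[OF sab] by simp
        ultimately show "\<exists>d. ((\<lambda>r. (U \<nu> r)\<^sup>2) has_real_derivative d) (at s) \<and> 0 \<le> d" by blast
      next
        show "continuous_on {a..r} (\<lambda>r. (U \<nu> r)\<^sup>2)"
          by (intro continuous_intros continuous_on_subset[OF cu(1)]) (use that in auto)
      qed (use that in auto)
      then show ?thesis by (simp add: UX)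
    qed
    have "U \<nu> r \<noteq> 0" if "r \<in> {a..b}" for r using usq[OF that] by auto
    from nonvanishing_sign[OF cu(1) connected_Icc this] have upos: "\<forall>r\<in>{a..b}. 0 < U \<nu> r"
      using ab UX(2)[of \<nu>] by force
    have "X \<nu> a < X \<nu> b"
    proof (rule DERIV_pos_imp_increasing_open[OF ab])
      fix s assume s: "a < s" "s < b"
      then show "\<exists>d. (X \<nu> has_real_derivative d) (at s) \<and> 0 < d"
        using slsys_interior(2)[OF UX(1) s] pos[of s] upos by (intro exI[of _ "(Q s - \<nu> * g s) * U \<nu> s"]) auto
    qed (rule cu(2))
    then show ?thesis using upos by (simp add: good_def UX)
  qed
  have nB: "\<not> good \<nu>B"
  proof -
    have d: "slsys p (\<lambda>r. Q r - \<nu>B * g r) a b (\<lambda>r. U \<nu>B r - uB r) (\<lambda>r. X \<nu>B r - xB r)"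
      by (rule slsys_diff[OF UX(1) B(1)])
    have "U \<nu>B r = uB r" "X \<nu>B r = xB r" if "r \<in> {a..b}" for r
      using slsys_unique[OF d c(1) cQ, of a r] that ab B UX by auto
    then show ?thesis using bad ab unfolding good_def by force
  qed
  define A where "A = - (M / m) - 1"
  have AB: "A < \<nu>B" using good_low[of \<nu>B] nB by (force simp: A_def)
  define T where "T = {\<nu>. A \<le> \<nu> \<and> \<nu> \<le> \<nu>B \<and> \<not> good \<nu>}"
  have TB: "\<nu>B \<in> T" using AB nB by (simp add: T_def)
  have bb: "bdd_below T" by (auto simp: T_def)
  define \<nu> where "\<nu> = Inf T"
  have nuB: "\<nu> \<le> \<nu>B" unfolding \<nu>_def by (rule cInf_lower[OF TB bb])
  have Anu: "A \<le> \<nu>" unfolding \<nu>_def by (rule cInf_greatest) (use TB in \<open>auto simp: T_def\<close>)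
  define R where "R = \<bar>A\<bar> + \<bar>\<nu>B\<bar>"
  obtain C where C: "C > 0" "\<And>\<mu> \<mu>' r. \<lbrakk>\<bar>\<mu>\<bar> \<le> R; \<bar>\<mu>'\<bar> \<le> R; r \<in> {a..b}\<rbrakk> \<Longrightarrow>
      \<bar>U \<mu> r - U \<mu>' r\<bar> \<le> C * \<bar>\<mu> - \<mu>'\<bar> \<and> \<bar>X \<mu> r - X \<mu>' r\<bar> \<le> C * \<bar>\<mu> - \<mu>'\<bar>"
  proof -
    obtain C where C: "C > 0" "\<And>\<nu> \<nu>' u x v y r. \<lbrakk>slsys p (\<lambda>r. Q r - \<nu> * g r) a b u x; slsys p (\<lambda>r. Q r - \<nu>' * g r) a b v y;
      u a = 1; v a = 1; x a = 0; y a = 0; \<bar>\<nu>\<bar> \<le> R; \<bar>\<nu>'\<bar> \<le> R; r \<in> {a..b}\<rbrakk> \<Longrightarrow>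
      \<bar>u r - v r\<bar> \<le> C * \<bar>\<nu> - \<nu>'\<bar> \<and> \<bar>x r - y r\<bar> \<le> C * \<bar>\<nu> - \<nu>'\<bar>"
      using slsys_parameter_lipschitz[OF c less_imp_le[OF ab], of 1 0 R] by blast
    show ?thesis
      by (rule that[OF C(1)]) (rule C(2)[OF UX(1) UX(1) UX(2) UX(2) UX(3) UX(3)])
  qed
  have ng: "\<not> good \<nu>"
  proof
    assume gd: "good \<nu>"
    obtain d where d: "d > 0" "\<And>r. r \<in> {a..b} \<Longrightarrow> d \<le> U \<nu> r"
      using continuous_on_interval_positive_min[OF slsys_cont(1)[OF UX(1)[of \<nu>]]] gd by (auto simp: good_def)
    define e where "e = min d (X \<nu> b) / C"
    have e: "e > 0" using d gd C by (auto simp: e_def good_def)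
    obtain \<mu> where mu: "\<mu> \<in> T" "\<mu> < \<nu> + e"
      using cInf_lessD[of T "\<nu> + e"] TB e by (auto simp: \<nu>_def)
    have "\<nu> \<le> \<mu>" unfolding \<nu>_def by (rule cInf_lower[OF mu(1) bb])
    then have "C * \<bar>\<nu> - \<mu>\<bar> < C * e" using mu C(1) by (intro mult_strict_left_mono) auto
    then have lt: "C * \<bar>\<nu> - \<mu>\<bar> < min d (X \<nu> b)" using C(1) by (simp add: e_def)
    have R: "\<bar>\<nu>\<bar> \<le> R" "\<bar>\<mu>\<bar> \<le> R" using mu Anu nuB by (auto simp: R_def T_def)
    have "0 < U \<mu> r" if "r \<in> {a..b}" for r
      using C(2)[OF R that] d(2)[OF that] lt by linarith
    moreover have "0 < X \<mu> b" using C(2)[OF R, of b] ab lt by auto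
    ultimately show False using mu(1) by (auto simp: T_def good_def)
  qed
  then have "A < \<nu>" using good_low[of \<nu>] by (force simp: A_def)
  have good_below: "good \<mu>" if "A \<le> \<mu>" "\<mu> < \<nu>" for \<mu>
    using that cInf_lower[OF _ bb, of \<mu>] nuB by (force simp: T_def \<nu>_def)
  \<comment> \<open>Nonnegativity passes to \<open>\<nu>\<close> from the good parameters below it:
    by the Lipschitz bound, a value \<open>y < 0\<close> would remain negative up to the distance
    \<open>- y / (2 * C)\<close>.\<close>
  have lim: "0 \<le> y" if "\<And>\<mu>. A \<le> \<mu> \<Longrightarrow> \<mu> < \<nu> \<Longrightarrow> \<bar>y - f \<mu>\<bar> \<le> C * \<bar>\<nu> - \<mu>\<bar> \<and> 0 < f \<mu>" for y and f :: "real \<Rightarrow> real"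
  proof (rule ccontr)
    assume "\<not> 0 \<le> y"
    then have y: "y < 0" by simp
    define \<mu> where "\<mu> = max A (\<nu> + y / (2 * C))"
    have yC: "y / (2 * C) < 0" using y C(1) by (simp add: divide_neg_pos)
    have "A \<le> \<mu>" "\<mu> < \<nu>" using \<open>A < \<nu>\<close> yC by (auto simp: \<mu>_def)
    moreover have "C * \<bar>\<nu> - \<mu>\<bar> \<le> C * (- y / (2 * C))"
      using \<open>\<mu> < \<nu>\<close> C(1) by (intro mult_left_mono) (auto simp: \<mu>_def)
    then have "C * \<bar>\<nu> - \<mu>\<bar> \<le> - y / 2" using C(1) by simp
    ultimately show False using that[of \<mu>] y by force
  qed
  have R: "\<bar>\<nu>\<bar> \<le> R" using Anu nuB by (auto simp: R_def)
  have R': "\<bar>\<mu>\<bar> \<le> R" if "A \<le> \<mu>" "\<mu> < \<nu>" for \<mu> using that nuB by (auto simp: R_def)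
  have U0: "0 \<le> U \<nu> r" if "r \<in> {a..b}" for r
    using C(2)[OF R R' that] good_below that by (intro lim[of _ "\<lambda>\<mu>. U \<mu> r"]) (auto simp: good_def)
  have X0: "0 \<le> X \<nu> b"
    using C(2)[OF R R', of _ b] good_below ab by (intro lim[of _ "\<lambda>\<mu>. X \<mu> b"]) (auto simp: good_def)
  \<comment> \<open>A zero of a nonnegative solution is a minimum, so its flux vanishes as well and
    uniqueness would make the solution trivial. At \<open>b\<close> this needs \<open>X0\<close> and
    a one-sided argument, inside the local minimum rule.\<close>
  have Upos: "0 < U \<nu> r" if r: "r \<in> {a..b}" for r
  proof (rule ccontr)
    assume "\<not> 0 < U \<nu> r"
    then have z: "U \<nu> r = 0" using U0[OF r] by simp
    have "r \<noteq> a" using z UX(2)[of \<nu>] by auto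
    then have ar: "a < r" using r by simp
    have "X \<nu> r = 0"
    proof (cases "r = b")
      case True
      have "X \<nu> b \<le> 0"
      proof (rule ccontr)
        assume "\<not> X \<nu> b \<le> 0"
        then have Xb: "0 < X \<nu> b" by simp
        have "continuous (at b within {a..b}) (X \<nu>)"
          using slsys_cont(2)[OF UX(1)] ab by (simp add: continuous_on_eq_continuous_within)
        then obtain d where d: "d > 0" "\<And>s. s \<in> {a..b} \<Longrightarrow> dist s b < d \<Longrightarrow> dist (X \<nu> s) (X \<nu> b) < X \<nu> b"
          using Xb unfolding continuous_within_eps_delta by blast
        define w where "w = max ((a + b) / 2) (b - d / 2)"
        have w: "a < w" "w < b" "b - d < w" using ab d by (auto simp: w_def less_max_iff_disj max_def)
        have "U \<nu> w < U \<nu> b"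
        proof (rule DERIV_pos_imp_increasing_open[OF w(2)])
          fix s assume s: "w < s" "s < b"
          have "0 < X \<nu> s" using d(2)[of s] s w by (auto simp: dist_real_def)
          moreover have "0 < p s" using s w p by auto
          ultimately show "\<exists>z. (U \<nu> has_real_derivative z) (at s) \<and> 0 < z"
            using slsys_interior(1)[OF UX(1), of s] s w by (intro exI[of _ "p s * X \<nu> s"]) auto
        next
          show "continuous_on {w..b} (U \<nu>)"
            by (rule continuous_on_subset[OF slsys_cont(1)[OF UX(1)]]) (use w in auto)
        qed
        then show False using z True U0[of w] w by simp
      qed
      then show ?thesis using X0 True by simp
    next
      case False
      then have rb: "r < b" using r by simp
      define d where "d = min (r - a) (b - r)"
      have "p r * X \<nu> r = 0"
      proof (rule DERIV_local_min[OF slsys_interior(1)[OF UX(1) ar rb]])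
        show "0 < d" using ar rb by (simp add: d_def)
        show "\<forall>y. \<bar>r - y\<bar> < d \<longrightarrow> U \<nu> r \<le> U \<nu> y"
          using U0 z by (auto simp: d_def abs_less_iff)
      qed
      then show ?thesis using p[OF r] by simp
    qed
    from slsys_unique(1)[OF UX(1) c(1) cQ r z this, of a] UX(2)[of \<nu>] ab show False by simp
  qed
  have "X \<nu> b = 0" using ng X0 Upos by (force simp: good_def)
  then have "neumann p (\<lambda>r. Q r - \<nu> * g r) a b (U \<nu>) (X \<nu>)"
    using UX(1)[of \<nu>] UX(2,3)[of \<nu>] ab by (auto simp: neumann_def intro!: bexI[of _ a])
  with nuB Upos UX(2)[of \<nu>] show ?thesis by blast
qed

section \<open>The radial problem in flux form\<close>

definition drift :: "nat \<Rightarrow> real \<Rightarrow> real" where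
  "drift n r = (real n - 1) / r - r / 2"

definition wgt :: "nat \<Rightarrow> real \<Rightarrow> real" where
  "wgt n r = r ^ (n - 1) * exp (- (r\<^sup>2) / 4)"

text \<open>The summand n - 1 comes from differentiating \<open>drift\<close>. It makes the
  potential vanish in degree 1, which is why that degree has a constant solution.\<close>

definition pot :: "nat \<Rightarrow> nat \<Rightarrow> real" where
  "pot n l = sphere_eigenvalue n l - (real n - 1)"

text \<open>The parameter \<open>\<nu>\<close> stands for 1 - \<lambda>: of the 1, one half is the
  zeroth-order term of the equation and the other half comes from the derivative of
  \<open>drift\<close>. Large eigenvalues \<lambda> are small parameters.\<close>

definition slq :: "nat \<Rightarrow> nat \<Rightarrow> real \<Rightarrow> real \<Rightarrow> real" where
  "slq n l \<nu> r = pot n l / r\<^sup>2 / wgt n r - \<nu> * (1 / wgt n r)"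

lemma wgt_pos: "0 < r \<Longrightarrow> 0 < wgt n r"
  by (simp add: wgt_def)

lemma wgt_deriv:
  assumes "0 < r" "n \<ge> 1"
  shows "(wgt n has_real_derivative wgt n r * drift n r) (at r within S)"
proof -
  obtain m where m: "n = Suc m" using assms(2) by (cases n) auto
  have "((\<lambda>r. r ^ m * exp (- (r\<^sup>2) / 4)) has_real_derivative
      (real m * r ^ (m - 1)) * exp (- (r\<^sup>2) / 4) + r ^ m * (exp (- (r\<^sup>2) / 4) * (- (2 * r) / 4))) (at r within S)"
    by (rule derivative_eq_intros refl | simp)+
  moreover have pw: "real m * r ^ (m - 1) = r ^ m * (real m / r)"
    using assms(1) by (cases m) (simp_all add: field_simps)
  have "(real m * r ^ (m - 1)) * exp (- (r\<^sup>2) / 4) + r ^ m * (exp (- (r\<^sup>2) / 4) * (- (2 * r) / 4))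
      = r ^ m * exp (- (r\<^sup>2) / 4) * drift n r"
    unfolding pw by (simp add: drift_def m algebra_simps)
  ultimately show ?thesis
    by (simp add: wgt_def[abs_def] m)
qed

lemma drift_deriv:
  assumes "0 < r"
  shows "(drift n has_real_derivative - (real n - 1) / r\<^sup>2 - 1 / 2) (at r within S)"
  unfolding drift_def[abs_def] using assms
  by (auto intro!: derivative_eq_intros simp: power2_eq_square field_simps)

lemma continuous_on_wgt [continuous_intros]: "continuous_on S (wgt n)"
  unfolding wgt_def[abs_def] by (intro continuous_intros) auto

lemma continuous_on_drift: "0 < a \<Longrightarrow> continuous_on {a..b} (drift n)"
  unfolding drift_def[abs_def] by (intro continuous_intros) auto

lemma continuous_on_slq:
  assumes "0 < a"
  shows "continuous_on {a..b} (\<lambda>r. pot n l / r\<^sup>2 / wgt n r)" "continuous_on {a..b} (\<lambda>r. 1 / wgt n r)"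
    "continuous_on {a..b} (slq n l \<nu>)"
proof -
  have w: "wgt n r \<noteq> 0" if "r \<in> {a..b}" for r using wgt_pos[of r n] that assms by auto
  show 1: "continuous_on {a..b} (\<lambda>r. pot n l / r\<^sup>2 / wgt n r)" "continuous_on {a..b} (\<lambda>r. 1 / wgt n r)"
    using w assms by (auto intro!: continuous_intros)
  show "continuous_on {a..b} (slq n l \<nu>)"
    unfolding slq_def[abs_def] by (intro continuous_intros 1)
qed

text \<open>The definitions provide second derivatives only in the open interval. Where the
  candidate derivative extends continuously, the fundamental theorem extends the differential
  equation to the ends, so that all systems can be stated on closed intervals.\<close>

lemma has_derivative_closed_interval:
  fixes F :: "real \<Rightarrow> real"
  assumes "continuous_on {a..b} F" "continuous_on {a..b} G"
    and "\<And>r. a < r \<Longrightarrow> r < b \<Longrightarrow> (F has_real_derivative G r) (at r)" and r: "r \<in> {a..b}"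
  shows "(F has_real_derivative G r) (at r within {a..b})"
proof -
  have eq: "F a + integral {a..s} G = F s" if s: "s \<in> {a..b}" for s
  proof -
    have "(G has_integral F s - F a) {a..s}"
      by (rule fundamental_theorem_of_calculus_interior)
         (use s assms(3) in \<open>auto intro: continuous_on_subset[OF assms(1)] simp: has_real_derivative_iff_has_vector_derivative[symmetric]\<close>)
    then show ?thesis by (simp add: integral_unique)
  qed
  have "((\<lambda>s. F a + integral {a..s} G) has_real_derivative 0 + G r) (at r within {a..b})"
    by (intro DERIV_add DERIV_const integral_has_real_derivative assms(2) r)
  then have "((\<lambda>s. F a + integral {a..s} G) has_real_derivative G r) (at r within {a..b})" by simp
  then show ?thesis
    by (rule has_field_derivative_transform_within[OF _ zero_less_one r]) (use eq in auto)
qed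

text \<open>\<open>wgt\<close> is the integrating factor of \<open>drift\<close>, so (wgt \<psi>)'
  is \<open>wgt\<close> times the Robin expression. Differentiating that expression and eliminating
  \<psi>'' leaves the multiple \<open>pot n l / r\<^sup>2 - (1 - \<nu>)\<close> of \<psi>.\<close>

lemma linearized_eigenvalue_iff:
  assumes a: "0 < a" and ab: "a < b" and n: "n \<ge> 1"
  shows "linearized_eigenvalue n l a b \<nu> \<longleftrightarrow> (\<exists>u x. neumann (wgt n) (slq n l (1 - \<nu>)) a b u x)"
proof
  assume "linearized_eigenvalue n l a b \<nu>"
  then obtain \<psi> \<psi>' \<psi>'' where C: "C1_closed_C2_open a b \<psi> \<psi>' \<psi>''" and nz: "\<exists>r\<in>{a..b}. \<psi> r \<noteq> 0"
    and ode: "\<And>r. r \<in> {a<..<b} \<Longrightarrow> \<psi>'' r + ((real n - 1) / r - r / 2) * \<psi>' r + (1/2 - sphere_eigenvalue n l / r\<^sup>2) * \<psi> r = \<nu> * \<psi> r"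
    and bc: "\<And>r. r \<in> {a, b} \<Longrightarrow> \<psi>' r + ((real n - 1) / r - r / 2) * \<psi> r = 0"
    unfolding linearized_eigenvalue_def by blast
  have d1: "\<And>r. r \<in> {a..b} \<Longrightarrow> (\<psi> has_real_derivative \<psi>' r) (at r within {a..b})"
    and c1: "continuous_on {a..b} \<psi>'"
    and d2: "\<And>r. r \<in> {a<..<b} \<Longrightarrow> (\<psi>' has_real_derivative \<psi>'' r) (at r)"
    using C by (auto simp: C1_closed_C2_open_def)
  have c0: "continuous_on {a..b} \<psi>" using d1 by (rule DERIV_continuous_on)
  define u where "u = (\<lambda>r. wgt n r * \<psi> r)"
  define x where "x = (\<lambda>r. \<psi>' r + drift n r * \<psi> r)"
  have "slsys (wgt n) (slq n l (1 - \<nu>)) a b u x"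
    unfolding slsys_def
  proof (intro ballI conjI)
    fix r assume r: "r \<in> {a..b}"
    then have r0: "0 < r" using a by simp
    have "(u has_real_derivative (wgt n r * drift n r) * \<psi> r + wgt n r * \<psi>' r) (at r within {a..b})"
      unfolding u_def by (rule derivative_eq_intros wgt_deriv[OF r0 n] d1[OF r] refl)+ simp
    then show "(u has_real_derivative wgt n r * x r) (at r within {a..b})"
      by (simp add: x_def algebra_simps)
    show "(x has_real_derivative slq n l (1 - \<nu>) r * u r) (at r within {a..b})"
    proof (rule has_derivative_closed_interval[OF _ _ _ r])
      show "continuous_on {a..b} x"
        unfolding x_def by (intro continuous_intros c0 c1 continuous_on_drift a)
      show "continuous_on {a..b} (\<lambda>r. slq n l (1 - \<nu>) r * u r)"
        unfolding u_def by (intro continuous_intros continuous_on_slq a c0)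
      fix s assume s: "a < s" "s < b"
      then have s0: "0 < s" and ss: "s \<in> {a<..<b}" using a by auto
      have d1s: "(\<psi> has_real_derivative \<psi>' s) (at s)"
        using d1[of s] s at_within_interior[of s "{a..b}"] by (auto simp: interior_atLeastAtMost_real)
      have "(x has_real_derivative \<psi>'' s + ((- (real n - 1) / s\<^sup>2 - 1 / 2) * \<psi> s + drift n s * \<psi>' s)) (at s)"
        unfolding x_def
        by (rule derivative_eq_intros drift_deriv[OF s0] d1s d2[OF ss] refl)+ simp
      moreover have "slq n l (1 - \<nu>) s * u s = (pot n l / s\<^sup>2 - (1 - \<nu>)) * \<psi> s"
        using wgt_pos[OF s0, of n] by (simp add: slq_def u_def field_simps)
      moreover have "\<psi>'' s + ((- (real n - 1) / s\<^sup>2 - 1 / 2) * \<psi> s + drift n s * \<psi>' s) = (pot n l / s\<^sup>2 - (1 - \<nu>)) * \<psi> s"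
        using ode[OF ss] by (simp add: drift_def pot_def algebra_simps diff_divide_distrib add_divide_distrib)
      ultimately show "(x has_real_derivative slq n l (1 - \<nu>) s * u s) (at s)" by simp
    qed
  qed
  moreover have "x a = 0" "x b = 0" using bc by (auto simp: x_def drift_def)
  moreover have "\<exists>r\<in>{a..b}. u r \<noteq> 0"
  proof -
    obtain r where "r \<in> {a..b}" "\<psi> r \<noteq> 0" using nz by blast
    then show ?thesis using wgt_pos[of r n] a by (intro bexI[of _ r]) (auto simp: u_def)
  qed
  ultimately show "\<exists>u x. neumann (wgt n) (slq n l (1 - \<nu>)) a b u x"
    unfolding neumann_def by blast
next
  assume "\<exists>u x. neumann (wgt n) (slq n l (1 - \<nu>)) a b u x"
  then obtain u x where sys: "slsys (wgt n) (slq n l (1 - \<nu>)) a b u x" and x: "x a = 0" "x b = 0" and nz: "\<exists>r\<in>{a..b}. u r \<noteq> 0"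
    by (auto simp: neumann_def)
  define \<psi> where "\<psi> = (\<lambda>r. u r / wgt n r)"
  define \<psi>' where "\<psi>' = (\<lambda>r. x r - drift n r * \<psi> r)"
  define \<psi>'' where "\<psi>'' = (\<lambda>r. slq n l (1 - \<nu>) r * u r - ((- (real n - 1) / r\<^sup>2 - 1 / 2) * \<psi> r + drift n r * \<psi>' r))"
  have w0: "wgt n r \<noteq> 0" if "r \<in> {a..b}" for r using wgt_pos[of r n] that a by auto
  have d1: "(\<psi> has_real_derivative \<psi>' r) (at r within {a..b})" if r: "r \<in> {a..b}" for r
  proof -
    have r0: "0 < r" using r a by simp
    have "(\<psi> has_real_derivative (wgt n r * x r * wgt n r - u r * (wgt n r * drift n r)) / (wgt n r * wgt n r)) (at r within {a..b})"
      unfolding \<psi>_def by (rule derivative_eq_intros slsysD(1)[OF sys r] wgt_deriv[OF r0 n] w0[OF r] refl)+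
    moreover have "(wgt n r * x r * wgt n r - u r * (wgt n r * drift n r)) / (wgt n r * wgt n r) = \<psi>' r"
      using w0[OF r] by (simp add: \<psi>'_def \<psi>_def field_simps)
    ultimately show ?thesis by simp
  qed
  have c0: "continuous_on {a..b} \<psi>" using d1 by (rule DERIV_continuous_on)
  have c1: "continuous_on {a..b} \<psi>'"
    unfolding \<psi>'_def by (intro continuous_intros slsys_cont[OF sys] continuous_on_drift a c0)
  have d2: "(\<psi>' has_real_derivative \<psi>'' s) (at s)" if s: "s \<in> {a<..<b}" for s
  proof -
    have s0: "0 < s" and s': "a < s" "s < b" using s a by auto
    have d1s: "(\<psi> has_real_derivative \<psi>' s) (at s)"
      using d1[of s] s at_within_interior[of s "{a..b}"] by (auto simp: interior_atLeastAtMost_real)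
    show ?thesis
      unfolding \<psi>''_def
      by (subst \<psi>'_def, (rule derivative_eq_intros drift_deriv[OF s0] d1s slsys_interior(2)[OF sys s'] refl)+, simp?)
  qed
  have c2: "continuous_on {a<..<b} \<psi>''"
  proof -
    have "continuous_on {a..b} \<psi>''"
      unfolding \<psi>''_def using a
      by (intro continuous_intros slsys_cont[OF sys] continuous_on_drift continuous_on_slq c0 c1) auto
    then show ?thesis by (rule continuous_on_subset) auto
  qed
  have "C1_closed_C2_open a b \<psi> \<psi>' \<psi>''"
    using d1 c1 d2 c2 by (auto simp: C1_closed_C2_open_def)
  moreover have "\<exists>r\<in>{a..b}. \<psi> r \<noteq> 0" using nz w0 by (auto simp: \<psi>_def)
  moreover have "\<psi>'' r + ((real n - 1) / r - r / 2) * \<psi>' r + (1/2 - sphere_eigenvalue n l / r\<^sup>2) * \<psi> r = \<nu> * \<psi> r"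
    if r: "r \<in> {a<..<b}" for r
  proof -
    have "slq n l (1 - \<nu>) r * u r = (pot n l / r\<^sup>2 - (1 - \<nu>)) * \<psi> r"
      using w0[of r] r by (simp add: slq_def \<psi>_def field_simps)
    then show ?thesis
      by (simp add: \<psi>''_def drift_def pot_def algebra_simps diff_divide_distrib add_divide_distrib)
  qed
  moreover have "\<psi>' r + ((real n - 1) / r - r / 2) * \<psi> r = 0" if "r \<in> {a, b}" for r
    using that x by (auto simp: \<psi>'_def drift_def)
  ultimately show "linearized_eigenvalue n l a b \<nu>"
    unfolding linearized_eigenvalue_def by blast
qed

section \<open>The annular profile and its explicit solutions\<close>

locale annulus =
  fixes n :: nat and a b :: real and \<phi> \<phi>' :: "real \<Rightarrow> real"
  assumes n2: "n \<ge> 2" and a0: "0 < a" and ab: "a < b"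
    and d\<phi>: "\<And>r. r \<in> {a..b} \<Longrightarrow> (\<phi> has_real_derivative \<phi>' r) (at r within {a..b})"
    and d\<phi>': "\<And>r. r \<in> {a..b} \<Longrightarrow> (\<phi>' has_real_derivative - (drift n r * \<phi>' r + \<phi> r / 2)) (at r within {a..b})"
    and \<phi>pos: "\<And>r. a < r \<Longrightarrow> r < b \<Longrightarrow> 0 < \<phi> r"
    and \<phi>a: "\<phi> a = 0" and \<phi>b: "\<phi> b = 0" and \<phi>'a: "\<phi>' a = 1" and \<phi>'b: "\<phi>' b = -1"

lemma annular_profile_annulus:
  assumes "n \<ge> 2" "annular_profile n a b \<phi>"
  obtains \<phi>' where "annulus n a b \<phi> \<phi>'"
proof -
  from assms(2) obtain \<phi>' \<phi>'' where ab: "0 < a" "a < b" and C: "C1_closed_C2_open a b \<phi> \<phi>' \<phi>''"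
    and pos: "\<And>r. r \<in> {a<..<b} \<Longrightarrow> 0 < \<phi> r" and bc: "\<phi> a = 0" "\<phi> b = 0" "\<phi>' a = 1" "\<phi>' b = -1"
    and ode: "\<And>r. r \<in> {a<..<b} \<Longrightarrow> \<phi>'' r + ((real n - 1) / r - r / 2) * \<phi>' r + 1/2 * \<phi> r = 0"
    unfolding annular_profile_def by blast
  have d1: "\<And>r. r \<in> {a..b} \<Longrightarrow> (\<phi> has_real_derivative \<phi>' r) (at r within {a..b})"
    and c1: "continuous_on {a..b} \<phi>'"
    and d2: "\<And>r. r \<in> {a<..<b} \<Longrightarrow> (\<phi>' has_real_derivative \<phi>'' r) (at r)"
    using C by (auto simp: C1_closed_C2_open_def)
  have c0: "continuous_on {a..b} \<phi>" using d1 by (rule DERIV_continuous_on)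
  have "(\<phi>' has_real_derivative - (drift n r * \<phi>' r + \<phi> r / 2)) (at r within {a..b})" if "r \<in> {a..b}" for r
  proof (rule has_derivative_closed_interval[OF c1 _ _ that])
    show "continuous_on {a..b} (\<lambda>r. - (drift n r * \<phi>' r + \<phi> r / 2))"
      by (intro continuous_intros c0 c1 continuous_on_drift ab) auto
    fix s assume "a < s" "s < b"
    then have s: "s \<in> {a<..<b}" by simp
    have "\<phi>'' s = - (drift n s * \<phi>' s + \<phi> s / 2)" using ode[OF s] by (simp add: drift_def)
    with d2[OF s] show "(\<phi>' has_real_derivative - (drift n s * \<phi>' s + \<phi> s / 2)) (at s)" by simp
  qed
  with assms(1) ab d1 pos bc have "annulus n a b \<phi> \<phi>'"
    by unfold_locales auto
  then show ?thesis by (rule that)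
qed

lemma pot_simps: "pot n 0 = - (real n - 1)" "pot n (Suc 0) = 0" "pot n 1 = 0" "pot n 2 = real n + 1" "pot n 3 = 2 * (real n + 2)"
  by (auto simp: pot_def sphere_eigenvalue_def algebra_simps)

lemma pot_mono: "l \<le> m \<Longrightarrow> n \<ge> 2 \<Longrightarrow> pot n l \<le> pot n m"
  unfolding pot_def sphere_eigenvalue_def by (intro diff_right_mono mult_mono) auto

lemma pot_4: "4 \<le> l \<Longrightarrow> n \<ge> 2 \<Longrightarrow> 3 * (real n + 3) \<le> pot n l"
  using pot_mono[of 4 l n] by (simp add: pot_def sphere_eigenvalue_def algebra_simps)

lemma slq_eq: "0 < r \<Longrightarrow> slq n l \<nu> r * (wgt n r * y) = (pot n l / r\<^sup>2 - \<nu>) * y"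
  using wgt_pos[of r n] by (simp add: slq_def field_simps)

lemma slq_diff: "slq n l \<nu> r - slq n m \<mu> r = ((pot n l - pot n m) / r\<^sup>2 + (\<mu> - \<nu>)) / wgt n r"
  by (simp add: slq_def diff_divide_distrib add_divide_distrib)

context annulus
begin

lemma r_pos: "r \<in> {a..b} \<Longrightarrow> 0 < r" using a0 by auto

lemma wgt_pos': "r \<in> {a..b} \<Longrightarrow> 0 < wgt n r" using wgt_pos r_pos by blast

lemma n1: "n \<ge> 1" using n2 by simp

lemma cont_slq: "continuous_on {a..b} (slq n l \<nu>)"
  by (rule continuous_on_slq[OF a0])

lemma cont_\<phi>: "continuous_on {a..b} \<phi>" using d\<phi> by (rule DERIV_continuous_on)
lemma cont_\<phi>': "continuous_on {a..b} \<phi>'" using d\<phi>' by (rule DERIV_continuous_on)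

lemma int_deriv:
  assumes "a < r" "r < b"
  shows "(\<phi> has_real_derivative \<phi>' r) (at r)" "(\<phi>' has_real_derivative - (drift n r * \<phi>' r + \<phi> r / 2)) (at r)"
  using d\<phi>[of r] d\<phi>'[of r] assms at_within_interior[of r "{a..b}"] by (auto simp: interior_atLeastAtMost_real)

lemma \<phi>_nonneg: "r \<in> {a..b} \<Longrightarrow> 0 \<le> \<phi> r"
  using \<phi>pos[of r] \<phi>a \<phi>b by (cases "r = a"; cases "r = b") force+

text \<open>The radial factor is 1 / wgt. In degree 1 with parameter 0 the potential is identically
  0, which gives the eigenvalue 1.\<close>

lemma sys_const: "slsys (wgt n) (slq n 1 0) a b (\<lambda>_. 1) (\<lambda>_. 0)"
  by (auto simp: slsys_def slq_def pot_simps)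

text \<open>Differentiating the profile in a coordinate direction gives the radial factor
  \<open>\<phi>'\<close> in degree 1. By the profile equation its flux is - \<phi> / 2, which
  vanishes at both ends.\<close>

lemma sys_translation: "slsys (wgt n) (slq n 1 (1/2)) a b (\<lambda>r. wgt n r * \<phi>' r) (\<lambda>r. - \<phi> r / 2)"
  unfolding slsys_def
proof (intro ballI conjI)
  fix r assume r: "r \<in> {a..b}"
  show "((\<lambda>r. wgt n r * \<phi>' r) has_real_derivative wgt n r * (- \<phi> r / 2)) (at r within {a..b})"
    by (rule derivative_eq_intros wgt_deriv[OF r_pos[OF r] n1] d\<phi>'[OF r] refl)+ (simp add: algebra_simps)
  show "((\<lambda>r. - \<phi> r / 2) has_real_derivative slq n 1 (1/2) r * (wgt n r * \<phi>' r)) (at r within {a..b})"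
    unfolding slq_eq[OF r_pos[OF r]] pot_simps
    using DERIV_cmult[OF d\<phi>[OF r], of "- 1 / 2"] by simp
qed

text \<open>The radial factor r \<phi>' - \<phi> is, up to sign, the derivative at c = 1 of the
  dilations c \<phi>(r / c). Its flux is a multiple of \<phi> and vanishes at the ends.\<close>

lemma sys_time: "slsys (wgt n) (slq n 0 0) a b (\<lambda>r. wgt n r * (r * \<phi>' r - \<phi> r)) (\<lambda>r. - ((real n - 1) / r) * \<phi> r)"
  unfolding slsys_def
proof (intro ballI conjI)
  fix r assume r: "r \<in> {a..b}"
  note r0 = r_pos[OF r]
  show "((\<lambda>r. wgt n r * (r * \<phi>' r - \<phi> r)) has_real_derivative wgt n r * (- ((real n - 1) / r) * \<phi> r)) (at r within {a..b})"
    by (rule DERIV_cong, (rule derivative_eq_intros wgt_deriv[OF r0 n1] d\<phi>[OF r] d\<phi>'[OF r] refl)+)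
       (use r0 in \<open>simp add: drift_def field_simps\<close>)
  have r0': "r \<noteq> 0" using r0 by simp
  have "((\<lambda>r. - ((real n - 1) / r) * \<phi> r) has_real_derivative ((real n - 1) / r\<^sup>2) * \<phi> r + - ((real n - 1) / r) * \<phi>' r) (at r within {a..b})"
    by (rule DERIV_cong, (rule derivative_eq_intros d\<phi>[OF r] r0' refl)+) (use r0 in \<open>simp add: field_simps power2_eq_square\<close>)
  moreover have "((real n - 1) / r\<^sup>2) * \<phi> r + - ((real n - 1) / r) * \<phi>' r = slq n 0 0 r * (wgt n r * (r * \<phi>' r - \<phi> r))"
    unfolding slq_eq[OF r0] pot_simps using r0 by (simp add: field_simps power2_eq_square)
  ultimately show "((\<lambda>r. - ((real n - 1) / r) * \<phi> r) has_real_derivative slq n 0 0 r * (wgt n r * (r * \<phi>' r - \<phi> r))) (at r within {a..b})"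
    by simp
qed

text \<open>The profile solves the equation at the threshold \<lambda> = 0 but has flux 1 and -1 at
  the ends. It is no eigenfunction and serves as a comparison function that is positive inside and
  zero at the ends.\<close>

lemma sys_profile: "slsys (wgt n) (slq n 0 1) a b (\<lambda>r. wgt n r * \<phi> r) (\<lambda>r. \<phi>' r + drift n r * \<phi> r)"
  unfolding slsys_def
proof (intro ballI conjI)
  fix r assume r: "r \<in> {a..b}"
  note r0 = r_pos[OF r]
  show "((\<lambda>r. wgt n r * \<phi> r) has_real_derivative wgt n r * (\<phi>' r + drift n r * \<phi> r)) (at r within {a..b})"
    by (rule derivative_eq_intros wgt_deriv[OF r0 n1] d\<phi>[OF r] refl)+ (simp add: algebra_simps)
  show "((\<lambda>r. \<phi>' r + drift n r * \<phi> r) has_real_derivative slq n 0 1 r * (wgt n r * \<phi> r)) (at r within {a..b})"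
    unfolding slq_eq[OF r0] pot_simps
    by (rule derivative_eq_intros drift_deriv[OF r0] d\<phi>[OF r] d\<phi>'[OF r] refl)+ (simp add: algebra_simps)
qed

text \<open>Found with ladder operators: applying \<partial>_i raises \<lambda> by 1/2 and applying
  \<partial>_j - y_j / 2 lowers it by 1/2. The trace-free part of \<partial>_i (\<partial>_j - y_j /
  2) \<phi> is thus a solution of degree 2 at \<lambda> = 0; its radial factor \<phi>'' - \<phi>' /
  r - r \<phi>' / 2 reduces, by the profile equation and up to sign, to the one given here.\<close>

lemma sys_degree2: "slsys (wgt n) (slq n 2 1) a b (\<lambda>r. wgt n r * (real n * \<phi>' r / r + \<phi> r / 2))
    (\<lambda>r. (1 / 2 - real n / r\<^sup>2) * \<phi>' r - (1 / (2 * r) + r / 4) * \<phi> r)"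
  unfolding slsys_def
proof (intro ballI conjI)
  fix r assume r: "r \<in> {a..b}"
  note r0 = r_pos[OF r]
  have r0': "r \<noteq> 0" "r\<^sup>2 \<noteq> 0" "2 * r \<noteq> 0" "2 \<noteq> (0::real)" "4 \<noteq> (0::real)" using r0 by auto
  have "((\<lambda>r. real n * \<phi>' r / r + \<phi> r / 2) has_real_derivative
      (real n * - (drift n r * \<phi>' r + \<phi> r / 2) * r - real n * \<phi>' r * 1) / (r * r) + \<phi>' r / 2) (at r within {a..b})"
    by (rule DERIV_cong, (rule derivative_eq_intros d\<phi>[OF r] d\<phi>'[OF r] r0' refl)+) (simp add: algebra_simps)
  from DERIV_mult[OF wgt_deriv[OF r0 n1, of "{a..b}"] this]
  show "((\<lambda>r. wgt n r * (real n * \<phi>' r / r + \<phi> r / 2)) has_real_derivative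
      wgt n r * ((1 / 2 - real n / r\<^sup>2) * \<phi>' r - (1 / (2 * r) + r / 4) * \<phi> r)) (at r within {a..b})"
    by (rule DERIV_cong) (use r0 in \<open>simp add: drift_def field_simps power2_eq_square\<close>)
  have "((\<lambda>r. (1 / 2 - real n / r\<^sup>2) * \<phi>' r - (1 / (2 * r) + r / 4) * \<phi> r) has_real_derivative
      (2 * real n / r ^ 3) * \<phi>' r + (1 / 2 - real n / r\<^sup>2) * - (drift n r * \<phi>' r + \<phi> r / 2)
      - ((- 1 / (2 * r\<^sup>2) + 1 / 4) * \<phi> r + (1 / (2 * r) + r / 4) * \<phi>' r)) (at r within {a..b})"
    by (rule DERIV_cong, (rule derivative_eq_intros d\<phi>[OF r] d\<phi>'[OF r] r0' refl)+)
       (use r0 in \<open>simp add: field_simps power2_eq_square power3_eq_cube\<close>)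
  moreover have "(2 * real n / r ^ 3) * \<phi>' r + (1 / 2 - real n / r\<^sup>2) * - (drift n r * \<phi>' r + \<phi> r / 2)
      - ((- 1 / (2 * r\<^sup>2) + 1 / 4) * \<phi> r + (1 / (2 * r) + r / 4) * \<phi>' r) = slq n 2 1 r * (wgt n r * (real n * \<phi>' r / r + \<phi> r / 2))"
    unfolding slq_eq[OF r0] pot_simps using r0
    by (simp add: drift_def field_simps power2_eq_square power3_eq_cube)
  ultimately show "((\<lambda>r. (1 / 2 - real n / r\<^sup>2) * \<phi>' r - (1 / (2 * r) + r / 4) * \<phi> r) has_real_derivative
      slq n 2 1 r * (wgt n r * (real n * \<phi>' r / r + \<phi> r / 2))) (at r within {a..b})"
    by simp
qed

lemma wgt_translation_decreasing:
  assumes "a \<le> s" "s < t" "t \<le> b"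
  shows "wgt n t * \<phi>' t < wgt n s * \<phi>' s"
proof (rule DERIV_neg_imp_decreasing_open[OF assms(2)])
  fix r assume "s < r" "r < t"
  then show "\<exists>y. ((\<lambda>r. wgt n r * \<phi>' r) has_real_derivative y) (at r) \<and> y < 0"
    using slsys_interior(1)[OF sys_translation, of r] assms wgt_pos'[of r] \<phi>pos[of r]
    by (intro exI[of _ "wgt n r * (- \<phi> r / 2)"]) (auto simp: mult_pos_neg)
qed (rule continuous_on_subset[OF slsys_cont(1)[OF sys_translation]], use assms in auto)

lemma wgt_time_decreasing:
  assumes "a \<le> s" "s < t" "t \<le> b"
  shows "wgt n t * (t * \<phi>' t - \<phi> t) < wgt n s * (s * \<phi>' s - \<phi> s)"
proof (rule DERIV_neg_imp_decreasing_open[OF assms(2)])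
  fix r assume r: "s < r" "r < t"
  then have rr: "a < r" "r < b" and rab: "r \<in> {a..b}" using assms by auto
  have "0 < (real n - 1) / r" using n2 a0 rr by (intro divide_pos_pos) auto
  then have "0 < (real n - 1) / r * \<phi> r" using \<phi>pos[OF rr] by (rule mult_pos_pos)
  from mult_pos_pos[OF wgt_pos'[OF rab] this]
  have "wgt n r * (- ((real n - 1) / r) * \<phi> r) < 0" by simp
  with slsys_interior(1)[OF sys_time rr]
  show "\<exists>y. ((\<lambda>r. wgt n r * (r * \<phi>' r - \<phi> r)) has_real_derivative y) (at r) \<and> y < 0" by blast
qed (rule continuous_on_subset[OF slsys_cont(1)[OF sys_time]], use assms in auto)

text \<open>The quantity \<open>E\<close> equals 1 at both ends because the slopes there have
  modulus 1, and its derivative has the sign of r^2 / 2 - n away from the single zero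
  \<open>m\<close> of \<open>v\<close>. If r^2 stayed on one side of 2n on the whole interval,
  \<open>E\<close> would be strictly monotone.\<close>

lemma ends_2n: "a\<^sup>2 < 2 * real n" "2 * real n < b\<^sup>2"
proof -
  define v where "v = (\<lambda>r. r * \<phi>' r - \<phi> r)"
  define E where "E = (\<lambda>r. (v r / r)\<^sup>2 + (real n - 1) * (\<phi> r / r)\<^sup>2)"
  have dE: "(E has_real_derivative - 2 * (v r)\<^sup>2 / r ^ 3 * (real n - r\<^sup>2 / 2)) (at r)" if r: "a < r" "r < b" for r
  proof -
    have r0: "0 < r" and r0': "r \<noteq> 0" using r a0 by auto
    show ?thesis
      unfolding E_def
      by (rule DERIV_cong, unfold v_def, (rule derivative_eq_intros int_deriv[OF r] r0' refl)+)
         (use r0 in \<open>simp add: drift_def field_simps power2_eq_square power3_eq_cube\<close>)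
  qed
  have cE: "continuous_on {a..b} E"
    unfolding E_def v_def using a0 by (intro continuous_intros cont_\<phi> cont_\<phi>') auto
  have Eab: "E a = 1" "E b = 1" using a0 ab \<phi>a \<phi>b \<phi>'a \<phi>'b by (auto simp: E_def v_def power2_eq_square)
  have "\<exists>m. a < m \<and> m < b \<and> wgt n m * v m = 0"
  proof -
    have va: "0 < wgt n a * v a" and vb: "wgt n b * v b < 0"
      using \<phi>a \<phi>b \<phi>'a \<phi>'b a0 ab wgt_pos'[of a] wgt_pos'[of b] by (auto simp: v_def mult_pos_neg)
    have "continuous_on {a..b} (\<lambda>r. wgt n r * v r)"
      unfolding v_def by (rule slsys_cont(1)[OF sys_time])
    then have "\<exists>m\<ge>a. m \<le> b \<and> wgt n m * v m = 0"
      using va vb ab by (intro IVT2') auto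
    then obtain m where m: "a \<le> m" "m \<le> b" "wgt n m * v m = 0" by blast
    moreover have "m \<noteq> a" "m \<noteq> b" using m(3) va vb by auto
    ultimately show ?thesis by (intro exI[of _ m]) auto
  qed
  then obtain m where m: "a < m" "m < b" "wgt n m * v m = 0" by blast
  have v2: "0 < (v r)\<^sup>2" if "a < r" "r < b" "r \<noteq> m" for r
  proof -
    have "wgt n r * v r \<noteq> 0"
      using wgt_time_decreasing[of r m] wgt_time_decreasing[of m r] that m by (cases "r < m") (auto simp: v_def)
    then show ?thesis by simp
  qed
  define E' where "E' = (\<lambda>r. - 2 * (v r)\<^sup>2 / r ^ 3 * (real n - r\<^sup>2 / 2))"
  have dE': "(E has_real_derivative E' r) (at r)" if "a < r" "r < b" for r
    using dE[OF that] by (simp add: E'_def)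
  have cont: "continuous_on {s..t} E" if "a \<le> s" "t \<le> b" for s t
    using that by (intro continuous_on_subset[OF cE]) auto
  show "2 * real n < b\<^sup>2"
  proof (rule ccontr)
    assume nb: "\<not> ?thesis"
    have neg: "E' r < 0" if r: "a < r" "r < b" "r \<noteq> m" for r
    proof -
      have "r\<^sup>2 < b\<^sup>2" using r a0 by (intro power_strict_mono) auto
      then have "0 < real n - r\<^sup>2 / 2" using nb by simp
      moreover have "0 < 2 * (v r)\<^sup>2 / r ^ 3" using v2[OF r] r a0 by simp
      ultimately show ?thesis using mult_pos_pos by (fastforce simp: E'_def)
    qed
    have "E b < E m"
    proof (rule DERIV_neg_imp_decreasing_open[OF m(2)])
      fix r assume r: "m < r" "r < b"
      then show "\<exists>y. (E has_real_derivative y) (at r) \<and> y < 0"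
        using dE'[of r] neg[of r] m by (intro exI[of _ "E' r"]) auto
    qed (rule cont, use m in auto)
    moreover have "E m < E a"
    proof (rule DERIV_neg_imp_decreasing_open[OF m(1)])
      fix r assume r: "a < r" "r < m"
      then show "\<exists>y. (E has_real_derivative y) (at r) \<and> y < 0"
        using dE'[of r] neg[of r] m by (intro exI[of _ "E' r"]) auto
    qed (rule cont, use m in auto)
    ultimately show False using Eab by simp
  qed
  show "a\<^sup>2 < 2 * real n"
  proof (rule ccontr)
    assume na: "\<not> ?thesis"
    have pos: "0 < E' r" if r: "a < r" "r < b" "r \<noteq> m" for r
    proof -
      have "a\<^sup>2 < r\<^sup>2" using r a0 by (intro power_strict_mono) auto
      then have "real n - r\<^sup>2 / 2 < 0" using na by simp
      moreover have "- 2 * (v r)\<^sup>2 / r ^ 3 < 0" using v2[OF r] r a0 by simp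
      ultimately show ?thesis using mult_neg_neg unfolding E'_def by blast
    qed
    have "E m < E b"
    proof (rule DERIV_pos_imp_increasing_open[OF m(2)])
      fix r assume r: "m < r" "r < b"
      then show "\<exists>y. (E has_real_derivative y) (at r) \<and> 0 < y"
        using dE'[of r] pos[of r] m by (intro exI[of _ "E' r"]) auto
    qed (rule cont, use m in auto)
    moreover have "E a < E m"
    proof (rule DERIV_pos_imp_increasing_open[OF m(1)])
      fix r assume r: "a < r" "r < m"
      then show "\<exists>y. (E has_real_derivative y) (at r) \<and> 0 < y"
        using dE'[of r] pos[of r] m by (intro exI[of _ "E' r"]) auto
    qed (rule cont, use m in auto)
    ultimately show False using Eab by simp
  qed
qed

end

section \<open>Spectrum in degrees 0 and 1\<close>

context annulus
begin

definition eig :: "nat \<Rightarrow> real \<Rightarrow> bool" where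
  "eig l \<nu> \<longleftrightarrow> (\<exists>u x. neumann (wgt n) (slq n l \<nu>) a b u x)"

lemma cont_wgt: "continuous_on {a..b} (wgt n)" by (rule continuous_on_wgt)

lemma slq_less: "\<nu> < \<mu> \<Longrightarrow> r \<in> {a..b} \<Longrightarrow> slq n l \<mu> r < slq n l \<nu> r"
  using slq_diff[of n l \<mu> r l \<nu>] wgt_pos'[of r] divide_neg_pos[of "\<nu> - \<mu>" "wgt n r"] by auto

lemma neumann_const: "neumann (wgt n) (slq n 1 0) a b (\<lambda>_. 1) (\<lambda>_. 0)"
  using sys_const ab by (auto simp: neumann_def)

lemma neumann_translation: "neumann (wgt n) (slq n 1 (1/2)) a b (\<lambda>r. wgt n r * \<phi>' r) (\<lambda>r. - \<phi> r / 2)"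
  using sys_translation \<phi>a \<phi>b \<phi>'a wgt_pos'[of a] ab by (auto simp: neumann_def intro!: bexI[of _ a])

lemma neumann_time: "neumann (wgt n) (slq n 0 0) a b (\<lambda>r. wgt n r * (r * \<phi>' r - \<phi> r)) (\<lambda>r. - ((real n - 1) / r) * \<phi> r)"
  using sys_time \<phi>a \<phi>b \<phi>'a wgt_pos'[of a] a0 ab by (auto simp: neumann_def intro!: bexI[of _ a])

lemma eig_zero:
  assumes "neumann (wgt n) (slq n l \<nu>1) a b u x" "neumann (wgt n) (slq n l \<nu>2) a b v y" "\<nu>1 < \<nu>2"
  shows "\<exists>z. a < z \<and> z < b \<and> v z = 0"
  by (rule neumann_zero[OF assms(1,2) ab cont_wgt cont_slq cont_slq wgt_pos' slq_less[OF assms(3)]])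

lemma eig_two_zeros:
  assumes "neumann (wgt n) (slq n l \<nu>1) a b u x" "neumann (wgt n) (slq n l \<nu>2) a b v y"
    "neumann (wgt n) (slq n l \<nu>3) a b w z" "\<nu>1 < \<nu>2" "\<nu>2 < \<nu>3"
  shows "\<exists>s t. a < s \<and> s < t \<and> t < b \<and> w s = 0 \<and> w t = 0"
  by (rule neumann_two_zeros[OF assms(1,2,3) ab cont_wgt cont_slq cont_slq cont_slq wgt_pos' slq_less[OF assms(4)] slq_less[OF assms(5)]])

lemma eig_1_nonneg: "eig 1 \<nu> \<Longrightarrow> 0 \<le> \<nu>"
  using eig_zero[OF _ neumann_const, of \<nu>] by (force simp: eig_def)

text \<open>A parameter strictly between those of the constant and of the translation mode would
  force two zeros on \<open>wgt n r * \<phi>' r\<close>, which is strictly decreasing.\<close>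

lemma eig_1_gap:
  assumes "eig 1 \<nu>" "0 < \<nu>" shows "1 / 2 \<le> \<nu>"
proof (rule ccontr)
  assume "\<not> ?thesis"
  then have lt: "\<nu> < 1 / 2" by simp
  obtain u x where "neumann (wgt n) (slq n 1 \<nu>) a b u x" using assms(1) by (auto simp: eig_def)
  from eig_two_zeros[OF neumann_const this neumann_translation assms(2) lt]
  obtain s t where "a < s" "s < t" "t < b" "wgt n s * \<phi>' s = 0" "wgt n t * \<phi>' t = 0" by blast
  with wgt_translation_decreasing[of s t] show False by simp
qed

text \<open>Two eigenvalues below the parameter 0 of the dilation mode would give that mode two
  zeros, but it is strictly decreasing after multiplication by \<open>wgt\<close>.\<close>

lemma eig_0_gap:
  assumes "eig 0 \<mu>" "eig 0 \<nu>" "\<mu> < \<nu>" shows "0 \<le> \<nu>"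
proof (rule ccontr)
  assume "\<not> ?thesis"
  then have lt: "\<nu> < 0" by simp
  obtain u x where u: "neumann (wgt n) (slq n 0 \<mu>) a b u x" using assms(1) by (auto simp: eig_def)
  obtain v y where v: "neumann (wgt n) (slq n 0 \<nu>) a b v y" using assms(2) by (auto simp: eig_def)
  from eig_two_zeros[OF u v neumann_time assms(3) lt]
  obtain s t where "a < s" "s < t" "t < b" "wgt n s * (s * \<phi>' s - \<phi> s) = 0" "wgt n t * (t * \<phi>' t - \<phi> t) = 0" by blast
  with wgt_time_decreasing[of s t] show False by simp
qed

lemma ground_state:
  assumes "slsys (wgt n) (slq n l \<nu>B) a b u x" "u a > 0" "x a = 0" "(\<exists>r\<in>{a..b}. u r \<le> 0) \<or> x b \<le> 0"
  obtains \<nu> v y where "\<nu> \<le> \<nu>B" "neumann (wgt n) (slq n l \<nu>) a b v y" "v a = 1" "\<And>r. r \<in> {a..b} \<Longrightarrow> 0 < v r"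
proof -
  have eq: "slq n l \<nu> = (\<lambda>r. pot n l / r\<^sup>2 / wgt n r - \<nu> * (1 / wgt n r))" for \<nu>
    by (rule ext) (rule slq_def)
  define k where "k = 1 / u a"
  have k: "k > 0" "k * u a = 1" using assms(2) by (auto simp: k_def)
  have s: "slsys (wgt n) (\<lambda>r. pot n l / r\<^sup>2 / wgt n r - \<nu>B * (1 / wgt n r)) a b (\<lambda>r. k * u r) (\<lambda>r. k * x r)"
    using slsys_scale[OF assms(1)] unfolding eq .
  have bad: "(\<exists>r\<in>{a..b}. k * u r \<le> 0) \<or> k * x b \<le> 0"
    using assms(4)
  proof
    assume "\<exists>r\<in>{a..b}. u r \<le> 0"
    then obtain r where "r \<in> {a..b}" "u r \<le> 0" by blast
    then show ?thesis using k(1) by (intro disjI1 bexI[of _ r]) (auto simp: mult_nonneg_nonpos)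
  qed (use k(1) in \<open>auto simp: mult_nonneg_nonpos\<close>)
  have "\<exists>\<nu>\<le>\<nu>B. \<exists>v y. neumann (wgt n) (\<lambda>r. pot n l / r\<^sup>2 / wgt n r - \<nu> * (1 / wgt n r)) a b v y \<and> v a = 1 \<and> (\<forall>r\<in>{a..b}. 0 < v r)"
    by (rule neumann_ground_state[OF ab cont_wgt continuous_on_slq(1,2)[OF a0] wgt_pos' _ s _ _ bad])
       (use wgt_pos' k assms(3) in auto)
  then show ?thesis using that unfolding eq by blast
qed

text \<open>The dilation mode becomes negative, so shooting at its parameter 0 fails and a positive
  ground state exists at some \<open>\<nu> \<le> 0\<close>.\<close>

lemma eig_0_negative: "\<exists>\<nu><0. eig 0 \<nu>"
proof -
  let ?u = "\<lambda>r. wgt n r * (r * \<phi>' r - \<phi> r)"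
  have ub: "?u b < 0" using \<phi>b \<phi>'b a0 ab wgt_pos'[of b] by (auto simp: mult_pos_neg)
  have ua: "0 < ?u a" using \<phi>a \<phi>'a a0 ab wgt_pos'[of a] by auto
  obtain \<nu> v y where v: "\<nu> \<le> 0" "neumann (wgt n) (slq n 0 \<nu>) a b v y" "v a = 1" "\<And>r. r \<in> {a..b} \<Longrightarrow> 0 < v r"
    by (rule ground_state[OF sys_time ua]) (use \<phi>a ub ab in \<open>auto intro!: bexI[of _ b] less_imp_le\<close>)
  have "\<nu> \<noteq> 0"
  proof
    assume "\<nu> = 0"
    \<comment> \<open>At \<open>\<nu> = 0\<close> both functions solve the same initial value
      problem after this scaling, so the ground state would be a multiple of the sign-changing
      mode.\<close>
    define k where "k = 1 / ?u a"
    have sv: "slsys (wgt n) (slq n 0 0) a b v y" "y a = 0" using v(2) \<open>\<nu> = 0\<close> by (auto simp: neumann_def)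
    have d: "slsys (wgt n) (slq n 0 0) a b (\<lambda>r. v r - k * ?u r) (\<lambda>r. y r - k * (- ((real n - 1) / r) * \<phi> r))"
      by (rule slsys_diff[OF sv(1) slsys_scale[OF sys_time]])
    have "v b - k * ?u b = 0"
      by (rule slsys_unique(1)[OF d cont_wgt cont_slq, of a]) (use ab sv(2) v(3) ua \<phi>a in \<open>auto simp: k_def\<close>)
    moreover have "k > 0" using ua by (simp add: k_def)
    then have "k * ?u b < 0" using ub by (simp add: mult_pos_neg)
    ultimately show False using v(4)[of b] ab by auto
  qed
  with v show ?thesis unfolding eig_def by (intro exI[of _ \<nu>]) auto
qed

text \<open>The third eigenfunction has a nodal interval whose closure lies inside (a, b). There the
  profile, a solution of degree 0 with parameter 1, is positive including the ends. A solution
  vanishing at both ends of such an interval needs a parameter above 1, since raising the degree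
  only raises the potential.\<close>

lemma eig_third:
  assumes "l \<le> 1" "eig l \<nu>1" "eig l \<nu>2" "eig l \<nu>3" "\<nu>1 < \<nu>2" "\<nu>2 < \<nu>3"
  shows "1 < \<nu>3"
proof (rule ccontr)
  assume "\<not> ?thesis"
  then have le: "\<nu>3 \<le> 1" by simp
  obtain u x where u: "neumann (wgt n) (slq n l \<nu>1) a b u x" using assms(2) by (auto simp: eig_def)
  obtain v y where v: "neumann (wgt n) (slq n l \<nu>2) a b v y" using assms(3) by (auto simp: eig_def)
  obtain w z where w: "neumann (wgt n) (slq n l \<nu>3) a b w z" using assms(4) by (auto simp: eig_def)
  have sw: "slsys (wgt n) (slq n l \<nu>3) a b w z" and zab: "z a = 0" and nz: "w a \<noteq> 0"
    using w neumann_nonzero_ends(1)[OF w] ab cont_wgt cont_slq by (auto simp: neumann_def)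
  have cw: "continuous_on {a..b} w" by (rule slsys_cont(1)[OF sw])
  obtain s t where st: "a < s" "s < t" "t < b" "w s = 0" "w t = 0"
    using eig_two_zeros[OF u v w assms(5,6)] by blast
  have zs: "z s \<noteq> 0"
    using slsys_unique(1)[OF sw cont_wgt cont_slq, of s a] st nz ab by auto
  text \<open>A zero of \<open>w\<close> is simple, so there is a next zero after \<open>s\<close>.\<close>
  define \<sigma> where "\<sigma> = z s"
  have \<sigma>: "\<sigma> \<noteq> 0" "0 < \<sigma> * z s" using zs by (auto simp: \<sigma>_def mult_neg_neg linorder_neq_iff)
  define W Z where "W = (\<lambda>r. \<sigma> * w r)" and "Z = (\<lambda>r. \<sigma> * z r)"
  have sW: "slsys (wgt n) (slq n l \<nu>3) a b W Z" unfolding W_def Z_def by (rule slsys_scale[OF sw])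
  have "(W has_real_derivative wgt n s * Z s) (at s)" using slsys_interior(1)[OF sW] st by simp
  moreover have "0 < wgt n s * Z s" using \<sigma> wgt_pos'[of s] st by (simp add: Z_def)
  ultimately obtain d where d: "0 < d" "\<And>h. 0 < h \<Longrightarrow> h < d \<Longrightarrow> W s < W (s + h)"
    using DERIV_pos_inc_right[of W "wgt n s * Z s" s] by blast
  define m where "m = s + min d (t - s) / 2"
  have m: "s < m" "m < t" "m - s < d" using d(1) st by (auto simp: m_def min_def field_simps)
  have Wm: "0 < W r" if "s < r" "r \<le> m" for r
    using d(2)[of "r - s"] that m st by (simp add: W_def)
  have cW: "continuous_on {m..t} W"
    by (rule continuous_on_subset[OF slsys_cont(1)[OF sW]]) (use m st in auto)
  obtain t' where t': "m < t'" "t' \<le> t" "W t' = 0" "\<And>r. m \<le> r \<Longrightarrow> r < t' \<Longrightarrow> W r \<noteq> 0"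
  proof -
    have "t \<in> {m..t}" "W t = 0" "W m \<noteq> 0" using m st Wm[of m] by (auto simp: W_def)
    from first_zero[OF cW this] that show thesis by blast
  qed
  have nzW: "W r \<noteq> 0" if "r \<in> {m..<t'}" for r using t'(4) that by simp
  have sub: "{m..<t'} \<subseteq> {m..t}" using t' by auto
  have mm: "m \<in> {m..<t'}" "\<not> W m < 0" using t'(1) Wm[of m] m by auto
  have "\<forall>r\<in>{m..<t'}. 0 < W r"
    using nonvanishing_sign[OF continuous_on_subset[OF cW sub] connected_Ico nzW] mm by blast
  then have Wpos: "0 < W r" if "s < r" "r < t'" for r
    using Wm[of r] that by (cases "r \<le> m") auto
  have tb: "t' < b" using t'(2) st by simp
  have st': "s < t'" using m t' by simp
  have W0: "W s = 0" "W t' = 0" using st t' by (auto simp: W_def)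
  have Zt: "Z t' \<le> 0"
    by (rule slsys_flux_at_right_zero[OF sW wgt_pos', of s]) (use st st' tb Wpos W0 in auto)
  have "(wgt n s * \<phi> s) * Z s - W s * (\<phi>' s + drift n s * \<phi> s) \<le> (wgt n t' * \<phi> t') * Z t' - W t' * (\<phi>' t' + drift n t' * \<phi> t')"
  proof -
    have "W t' * (\<phi>' t' + drift n t' * \<phi> t') - (wgt n t' * \<phi> t') * Z t' \<le> W s * (\<phi>' s + drift n s * \<phi> s) - (wgt n s * \<phi> s) * Z s"
    proof (rule slsys_comparison[OF sW sys_profile])
      fix r assume r: "s < r" "r < t'"
      then have rab: "r \<in> {a..b}" using st tb by auto
      have "pot n 0 \<le> pot n l" using pot_mono[of 0 l n] n2 by simp
      then have "(pot n 0 - pot n l) / r\<^sup>2 + (\<nu>3 - 1) \<le> 0"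
        using le r_pos[OF rab] by (intro add_nonpos_nonpos divide_nonpos_nonneg) auto
      then have "slq n 0 1 r - slq n l \<nu>3 r \<le> 0"
        unfolding slq_diff using wgt_pos'[OF rab] by (intro divide_nonpos_nonneg) auto
      moreover have "0 \<le> W r * (wgt n r * \<phi> r)"
        using Wpos[OF r] wgt_pos'[OF rab] \<phi>_nonneg[OF rab] by (intro mult_nonneg_nonneg) auto
      ultimately show "(slq n 0 1 r - slq n l \<nu>3 r) * (W r * (wgt n r * \<phi> r)) \<le> 0"
        by (rule mult_nonpos_nonneg)
    qed (use st st' tb in auto)
    then show ?thesis by simp
  qed
  moreover have "0 < (wgt n s * \<phi> s) * Z s"
    using \<sigma>(2) wgt_pos'[of s] \<phi>pos[of s] st by (intro mult_pos_pos) (auto simp: Z_def)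
  moreover have "(wgt n t' * \<phi> t') * Z t' \<le> 0"
    using Zt wgt_pos'[of t'] \<phi>pos[of t'] st st' tb by (intro mult_nonneg_nonpos) auto
  ultimately show False using W0 by simp
qed

end

section \<open>Degrees two and higher\<close>

lemma power_pred_deriv:
  fixes r :: real
  assumes "0 < r" "n \<ge> 1"
  shows "((\<lambda>r. r ^ (n - 1)) has_real_derivative r ^ (n - 1) * ((real n - 1) / r)) (at r within S)"
proof -
  obtain m where m: "n = Suc m" using assms(2) by (cases n) auto
  have d: "((\<lambda>r. r ^ m) has_real_derivative real m * r ^ (m - 1)) (at r within S)"
    by (auto intro!: derivative_eq_intros)
  have "real m * r ^ (m - 1) = r ^ m * (real m / r)"
    using assms(1) by (cases m) (simp_all add: field_simps)
  from DERIV_cong[OF d this] show ?thesis by (simp add: m)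
qed

context annulus
begin

text \<open>Multiplied by r^n the expression becomes \<open>B\<close>, whose derivative is a
  positive multiple of \<open>\<phi>'\<close>. Hence \<open>B\<close> first increases from a
  positive value and then decreases to a negative one.\<close>

lemma degree2_sign:
  obtains z where "a < z" "z < b" "\<And>r. a \<le> r \<Longrightarrow> r < z \<Longrightarrow> 0 < real n * \<phi>' r / r + \<phi> r / 2"
    "\<And>r. z < r \<Longrightarrow> r \<le> b \<Longrightarrow> real n * \<phi>' r / r + \<phi> r / 2 < 0" "real n * \<phi>' z / z + \<phi> z / 2 = 0"
proof -
  define B where "B = (\<lambda>r. r ^ (n - 1) * (real n * \<phi>' r + r * \<phi> r / 2))"
  have cB: "continuous_on {s..t} B" if "a \<le> s" "t \<le> b" for s t
    unfolding B_def
    by (intro continuous_intros continuous_on_subset[OF cont_\<phi>] continuous_on_subset[OF cont_\<phi>']) (use that in auto)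
  have dB: "(B has_real_derivative (real n + 1) / 2 * (r ^ (n - 1) * r) * \<phi>' r) (at r)" if r: "a < r" "r < b" for r
  proof -
    have r0: "0 < r" and r0': "r \<noteq> 0" "(2::real) \<noteq> 0" using r a0 by auto
    show ?thesis
      unfolding B_def
      by (rule DERIV_cong, (rule derivative_eq_intros power_pred_deriv[OF r0 n1] int_deriv[OF r] r0' refl)+)
         (use r0 in \<open>simp add: drift_def field_simps\<close>)
  qed
  have wa: "0 < wgt n a * \<phi>' a" and wb: "wgt n b * \<phi>' b < 0"
    using wgt_pos'[of a] wgt_pos'[of b] ab \<phi>'a \<phi>'b by auto
  have "\<exists>m\<ge>a. m \<le> b \<and> wgt n m * \<phi>' m = 0"
    using wa wb ab slsys_cont(1)[OF sys_translation] by (intro IVT2') auto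
  then obtain m where m: "a \<le> m" "m \<le> b" "wgt n m * \<phi>' m = 0" by blast
  have m': "a < m" "m < b" using m wa wb by (cases "m = a"; cases "m = b"; force)+
  have p1: "0 < \<phi>' r" if "a \<le> r" "r < m" for r
    using wgt_translation_decreasing[of r m] that m wgt_pos'[of r] by (simp add: zero_less_mult_iff)
  have p2: "\<phi>' r < 0" if "m < r" "r \<le> b" for r
    using wgt_translation_decreasing[of m r] that m wgt_pos'[of r] by (simp add: mult_less_0_iff)
  have Ba: "0 < B a" using \<phi>a \<phi>'a a0 n2 by (simp add: B_def)
  have Bb: "B b < 0" using \<phi>b \<phi>'b a0 ab n2 by (simp add: B_def mult_pos_neg)
  have inc: "B s \<le> B t" if "a \<le> s" "s \<le> t" "t \<le> m" for s t
  proof (rule DERIV_nonneg_imp_increasing_open[OF that(2)])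
    fix r assume r: "s < r" "r < t"
    then have "0 \<le> (real n + 1) / 2 * (r ^ (n - 1) * r) * \<phi>' r"
      using p1[of r] that a0 by (intro mult_nonneg_nonneg) auto
    moreover have "a < r" "r < b" using r that m by auto
    ultimately show "\<exists>y. (B has_real_derivative y) (at r) \<and> 0 \<le> y" using dB by blast
  qed (rule cB, use that m in auto)
  have dec: "B t < B s" if "m \<le> s" "s < t" "t \<le> b" for s t
  proof (rule DERIV_neg_imp_decreasing_open[OF that(2)])
    fix r assume r: "s < r" "r < t"
    then have "(real n + 1) / 2 * (r ^ (n - 1) * r) * \<phi>' r < 0"
      using p2[of r] that a0 m' by (intro mult_pos_neg mult_pos_pos zero_less_power) auto
    moreover have "a < r" "r < b" using r that m' by auto
    ultimately show "\<exists>y. (B has_real_derivative y) (at r) \<and> y < 0" using dB by blast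
  qed (rule cB, use that m' in auto)
  have Bm: "0 < B r" if "a \<le> r" "r \<le> m" for r using inc[of a r] Ba that by simp
  have "\<exists>z\<ge>m. z \<le> b \<and> B z = 0"
    using Bm[of m] Bb m' cB[of m b] by (intro IVT2') auto
  then obtain z where z: "m \<le> z" "z \<le> b" "B z = 0" by blast
  have z': "m < z" "z < b" using z Bm[of m] m' Bb by (cases "z = m"; cases "z = b"; force)+
  have eq: "real n * \<phi>' r / r + \<phi> r / 2 = B r / (r ^ (n - 1) * r)" if "r \<in> {a..b}" for r
    using r_pos[OF that] by (simp add: B_def field_simps)
  have den: "0 < r ^ (n - 1) * r" if "r \<in> {a..b}" for r using r_pos[OF that] by simp
  show ?thesis
  proof (rule that[of z])
    fix r assume r: "a \<le> r" "r < z"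
    have "0 < B r" using Bm[of r] dec[of r z] r z z' by (cases "r \<le> m") auto
    then show "0 < real n * \<phi>' r / r + \<phi> r / 2" using eq[of r] den[of r] r z' by (simp only: atLeastAtMost_iff) (auto intro!: divide_pos_pos)
  next
    fix r assume r: "z < r" "r \<le> b"
    have "B r < 0" using dec[of z r] r z z' by simp
    then show "real n * \<phi>' r / r + \<phi> r / 2 < 0" using eq[of r] den[of r] r z' m' by (simp only: atLeastAtMost_iff) (auto intro!: divide_neg_pos)
  qed (use z z' m' eq[of z] in auto)
qed

text \<open>The second eigenfunction has a zero \<open>m\<close>, the explicit solution
  \<open>U\<close> of degree 2 at parameter 1 has a single zero \<open>z\<close>. On the side of
  \<open>m\<close> away from \<open>z\<close>, a nodal interval of \<open>v\<close> reaching the end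
  point lies where \<open>U\<close> has one sign, and comparison there contradicts the sign of the
  flux of \<open>U\<close> at that end.\<close>

lemma eig_ge2_second:
  assumes l: "2 \<le> l" and e: "eig l \<nu>1" "eig l \<nu>2" "\<nu>1 < \<nu>2"
  shows "1 < \<nu>2"
proof (rule ccontr)
  assume "\<not> ?thesis"
  then have le: "\<nu>2 \<le> 1" by simp
  obtain u x where u: "neumann (wgt n) (slq n l \<nu>1) a b u x" using e by (auto simp: eig_def)
  obtain v y where v: "neumann (wgt n) (slq n l \<nu>2) a b v y" using e by (auto simp: eig_def)
  have sv: "slsys (wgt n) (slq n l \<nu>2) a b v y" and y: "y a = 0" "y b = 0"
    using v by (auto simp: neumann_def)
  have va: "v a \<noteq> 0" and vb: "v b \<noteq> 0" using neumann_nonzero_ends[OF v] ab cont_wgt cont_slq by auto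
  have cv: "continuous_on {a..b} v" by (rule slsys_cont(1)[OF sv])
  obtain m where m: "a < m" "m < b" "v m = 0" using eig_zero[OF u v e(3)] by blast
  define U where "U = (\<lambda>r. wgt n r * (real n * \<phi>' r / r + \<phi> r / 2))"
  define X where "X = (\<lambda>r. (1 / 2 - real n / r\<^sup>2) * \<phi>' r - (1 / (2 * r) + r / 4) * \<phi> r)"
  have sU: "slsys (wgt n) (slq n 2 1) a b U X" unfolding U_def X_def by (rule sys_degree2)
  obtain z where z: "a < z" "z < b" "\<And>r. a \<le> r \<Longrightarrow> r < z \<Longrightarrow> 0 < real n * \<phi>' r / r + \<phi> r / 2"
    "\<And>r. z < r \<Longrightarrow> r \<le> b \<Longrightarrow> real n * \<phi>' r / r + \<phi> r / 2 < 0" "real n * \<phi>' z / z + \<phi> z / 2 = 0"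
    by (rule degree2_sign) blast
  have Upos: "0 < U r" if "a \<le> r" "r < z" for r using z(3)[OF that] wgt_pos'[of r] that z by (auto simp: U_def)
  have Uneg: "U r < 0" if "z < r" "r \<le> b" for r using z(4)[OF that] wgt_pos'[of r] that z by (auto simp: U_def mult_pos_neg)
  have Uz: "U z = 0" using z(5) by (simp add: U_def)
  \<comment> \<open>At the ends only the term with \<open>\<phi>'\<close> survives, so these signs
    are exactly a^2 < 2n < b^2.\<close>
  have Xa: "X a < 0" using \<phi>a \<phi>'a ends_2n(1) a0 by (simp add: X_def field_simps)
  have Xb: "X b < 0" using \<phi>b \<phi>'b ends_2n(2) a0 ab by (simp add: X_def field_simps)
  have q: "slq n 2 1 r - slq n l \<nu>2 r \<le> 0" if "r \<in> {a..b}" for r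
  proof -
    have "(pot n 2 - pot n l) / r\<^sup>2 + (\<nu>2 - 1) \<le> 0"
      using le pot_mono[OF l n2] r_pos[OF that] by (intro add_nonpos_nonpos divide_nonpos_nonneg) auto
    then show ?thesis unfolding slq_diff using wgt_pos'[OF that] by (intro divide_nonpos_nonneg) auto
  qed
  show False
  proof (cases "m \<le> z")
    case True
    have mab: "m \<in> {a..b}" using m by auto
    obtain t where t: "a < t" "t \<le> m" "v t = 0" "\<And>r. a \<le> r \<Longrightarrow> r < t \<Longrightarrow> v r \<noteq> 0"
      using first_zero[OF cv mab m(3) va] by blast
    have sub: "{a..<t} \<subseteq> {a..b}" using t m by auto
    have nz: "v r \<noteq> 0" if "r \<in> {a..<t}" for r using t(4) that by simp
    obtain i where i: "\<And>r. r \<in> {a..<t} \<Longrightarrow> 0 < i * v r"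
      using nonvanishing_normalize[OF continuous_on_subset[OF cv sub] connected_Ico nz] by blast
    have sv': "slsys (wgt n) (slq n l \<nu>2) a b (\<lambda>r. i * v r) (\<lambda>r. i * y r)" by (rule slsys_scale[OF sv])
    have tb: "t \<le> b" "t \<le> z" using t m True by auto
    have yt: "i * y t \<le> 0"
      by (rule slsys_flux_at_right_zero[OF sv' wgt_pos', of a]) (use t tb i in auto)
    have "i * v t * X t - U t * (i * y t) \<le> i * v a * X a - U a * (i * y a)"
    proof (rule slsys_comparison[OF sv' sU])
      fix r assume r: "a < r" "r < t"
      show "(slq n 2 1 r - slq n l \<nu>2 r) * (i * v r * U r) \<le> 0"
        using q[of r] mult_pos_pos[OF i[of r] Upos[of r]] r tb by (intro mult_nonpos_nonneg) auto
    qed (use t tb in auto)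
    moreover have "i * v a * X a < 0" using mult_pos_neg[OF i[of a] Xa] t by simp
    moreover have "U t * (i * y t) \<le> 0"
      using Upos[of t] Uz yt t tb by (cases "t = z") (auto intro!: mult_nonneg_nonpos)
    ultimately show False using t(3) y by simp
  next
    case False
    then have zm: "z < m" by simp
    have mab: "a + b - m \<in> {a..b}" using m by auto
    have cv': "continuous_on {a..b} (\<lambda>r. v (a + b - r))"
      by (rule continuous_on_compose2[OF cv]) (auto intro!: continuous_intros)
    obtain t' where t': "a < t'" "t' \<le> a + b - m" "v (a + b - t') = 0" "\<And>r. a \<le> r \<Longrightarrow> r < t' \<Longrightarrow> v (a + b - r) \<noteq> 0"
      using first_zero[OF cv' mab] m vb by auto
    define t where "t = a + b - t'"
    have t: "m \<le> t" "t < b" "v t = 0" using t' by (auto simp: t_def)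
    have nz: "v r \<noteq> 0" if "r \<in> {t<..b}" for r using t'(4)[of "a + b - r"] that by (auto simp: t_def)
    have sub: "{t<..b} \<subseteq> {a..b}" using t m by auto
    obtain i where i: "\<And>r. r \<in> {t<..b} \<Longrightarrow> 0 < i * v r"
      using nonvanishing_normalize[OF continuous_on_subset[OF cv sub] connected_Ioc nz] by blast
    have sv': "slsys (wgt n) (slq n l \<nu>2) a b (\<lambda>r. i * v r) (\<lambda>r. i * y r)" by (rule slsys_scale[OF sv])
    have sU': "slsys (wgt n) (slq n 2 1) a b (\<lambda>r. -1 * U r) (\<lambda>r. -1 * X r)" by (rule slsys_scale[OF sU])
    have yt: "0 \<le> i * y t"
      by (rule slsys_flux_at_left_zero[OF sv' wgt_pos', of t b]) (use t m i in auto)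
    have "i * v b * (-1 * X b) - (-1 * U b) * (i * y b) \<le> i * v t * (-1 * X t) - (-1 * U t) * (i * y t)"
    proof (rule slsys_comparison[OF sv' sU'])
      fix r assume r: "t < r" "r < b"
      show "(slq n 2 1 r - slq n l \<nu>2 r) * (i * v r * (-1 * U r)) \<le> 0"
        using q[of r] mult_pos_neg[OF i[of r] Uneg[of r]] r t m zm by (intro mult_nonpos_nonneg) auto
    qed (use t m in auto)
    moreover have "0 < i * v b * (-1 * X b)" using mult_pos_neg[OF i[of b] Xb] t by simp
    moreover have "U t * (i * y t) \<le> 0" using Uneg[of t] yt t zm by (intro mult_nonpos_nonneg) auto
    ultimately show False using t(3) y by simp
  qed
qed

text \<open>The bound on \<open>b\<close> is b^2 \<le> \<open>pot n 4\<close>, so for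
  \<open>\<nu> \<le> 1\<close> the potential is positive. Then the product of \<open>v\<close> and
  its flux is strictly increasing, yet it vanishes at both ends.\<close>

lemma eig_ge4:
  assumes l: "4 \<le> l" and e: "eig l \<nu>" and bb: "b\<^sup>2 \<le> 3 * (real n + 3)"
  shows "1 < \<nu>"
proof (rule ccontr)
  assume "\<not> ?thesis"
  then have le: "\<nu> \<le> 1" by simp
  obtain v y where v: "neumann (wgt n) (slq n l \<nu>) a b v y" using e by (auto simp: eig_def)
  have sv: "slsys (wgt n) (slq n l \<nu>) a b v y" and y: "y a = 0" "y b = 0" and nz: "v a \<noteq> 0"
    using v neumann_nonzero_ends(1)[OF v] ab cont_wgt cont_slq by (auto simp: neumann_def)
  have "v a * y a < v b * y b"
  proof (rule DERIV_pos_imp_increasing_open[OF ab])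
    fix r assume r: "a < r" "r < b"
    then have rab: "r \<in> {a..b}" by simp
    have "r\<^sup>2 < b\<^sup>2" using r a0 by (intro power_strict_mono) auto
    then have "1 < pot n l / r\<^sup>2" using bb pot_4[OF l n2] r_pos[OF rab] by (simp add: field_simps)
    then have "0 < (pot n l / r\<^sup>2 - \<nu>) / wgt n r" using le wgt_pos'[OF rab] by (intro divide_pos_pos) auto
    then have q: "0 < slq n l \<nu> r" by (simp add: slq_def diff_divide_distrib)
    have "v r \<noteq> 0 \<or> y r \<noteq> 0"
      using slsys_unique(1)[OF sv cont_wgt cont_slq rab, of a] nz ab by auto
    then have "0 < wgt n r * (y r)\<^sup>2 + slq n l \<nu> r * (v r)\<^sup>2"
      using q wgt_pos'[OF rab] by (auto intro: add_pos_nonneg add_nonneg_pos)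
    moreover have "((\<lambda>r. v r * y r) has_real_derivative wgt n r * (y r)\<^sup>2 + slq n l \<nu> r * (v r)\<^sup>2) (at r)"
      by (rule DERIV_cong[OF DERIV_mult[OF slsys_interior(1)[OF sv r] slsys_interior(2)[OF sv r]]])
         (simp add: power2_eq_square)
    ultimately show "\<exists>d. ((\<lambda>r. v r * y r) has_real_derivative d) (at r) \<and> 0 < d" by blast
  next
    show "continuous_on {a..b} (\<lambda>r. v r * y r)" by (intro continuous_intros slsys_cont[OF sv])
  qed
  with y show False by simp
qed

text \<open>In degree 3 at parameter 1 the function \<open>u = 1 / r\<^sup>2\<close> solves the
  system. Reduction of order gives the general solution \<open>I r / r\<^sup>2\<close> with
  \<open>I\<close> an antiderivative of \<open>r ^ 4 * wgt n r\<close>. For the solution with zero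
  flux at \<open>a\<close>, the hypothesis says that the flux at \<open>b\<close> is negative, so
  shooting yields a ground state below 1.\<close>

lemma eig_2_3:
  assumes X: "b ^ 5 * wgt n b - a ^ 5 * wgt n a < 2 * integral {a..b} (\<lambda>r. r ^ 4 * wgt n r)"
  shows "\<exists>\<nu><1. eig 3 \<nu>" "\<exists>\<nu><1. eig 2 \<nu>"
proof -
  \<comment> \<open>The constant of integration is the one that makes the flux vanish at
    \<open>a\<close>.\<close>
  define I where "I = (\<lambda>r. a ^ 5 * wgt n a / 2 + integral {a..r} (\<lambda>r. r ^ 4 * wgt n r))"
  define u where "u = (\<lambda>r. I r / r\<^sup>2)"
  define x where "x = (\<lambda>r. r\<^sup>2 - 2 * I r / (r ^ 3 * wgt n r))"
  have dI: "(I has_real_derivative r ^ 4 * wgt n r) (at r within {a..b})" if "r \<in> {a..b}" for r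
  proof -
    have "continuous_on {a..b} (\<lambda>r. r ^ 4 * wgt n r)" by (intro continuous_intros)
    from integral_has_real_derivative[OF this that]
    have "((\<lambda>r. a ^ 5 * wgt n a / 2 + integral {a..r} (\<lambda>r. r ^ 4 * wgt n r)) has_real_derivative 0 + r ^ 4 * wgt n r) (at r within {a..b})"
      by (intro DERIV_add DERIV_const)
    then show ?thesis by (simp add: I_def)
  qed
  have Ipos: "0 < I r" if r: "r \<in> {a..b}" for r
  proof -
    have "0 \<le> integral {a..r} (\<lambda>r. r ^ 4 * wgt n r)"
      using a0 by (intro integral_nonneg integrable_continuous_interval continuous_intros) (auto simp: wgt_def)
    moreover have "0 < a ^ 5 * wgt n a / 2" using a0 wgt_pos[OF a0] by simp
    ultimately show ?thesis unfolding I_def by linarith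
  qed
  have su: "slsys (wgt n) (slq n 3 1) a b u x"
    unfolding slsys_def
  proof (intro ballI conjI)
    fix r assume r: "r \<in> {a..b}"
    have r0: "0 < r" by (rule r_pos[OF r])
    have w: "0 < wgt n r" by (rule wgt_pos'[OF r])
    have nz: "r\<^sup>2 \<noteq> 0" "r ^ 3 * wgt n r \<noteq> 0" using r0 w by auto
    show "(u has_real_derivative wgt n r * x r) (at r within {a..b})"
      unfolding u_def x_def
      by (rule DERIV_cong, (rule derivative_eq_intros dI[OF r] nz refl)+)
         (use r0 w in \<open>simp add: field_simps power2_eq_square power3_eq_cube eval_nat_numeral\<close>)
    have "slq n 3 1 r * u r = (pot n 3 / r\<^sup>2 - 1) * (u r / wgt n r)"
      using slq_eq[OF r0, of n 3 1 "u r / wgt n r"] w by simp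
    also have "\<dots> = 2 * I r * (3 / r + drift n r) / (r ^ 3 * wgt n r)"
      unfolding pot_simps u_def drift_def using r0 w
      by (simp add: field_simps power2_eq_square power3_eq_cube)
    finally have eq: "slq n 3 1 r * u r = 2 * I r * (3 / r + drift n r) / (r ^ 3 * wgt n r)" .
    show "(x has_real_derivative slq n 3 1 r * u r) (at r within {a..b})"
      unfolding eq unfolding x_def
      by (rule DERIV_cong, (rule derivative_eq_intros dI[OF r] wgt_deriv[OF r0 n1] nz refl)+)
         (use r0 w in \<open>simp add: field_simps power2_eq_square power3_eq_cube eval_nat_numeral\<close>)
  qed
  have upos: "0 < u r" if "r \<in> {a..b}" for r using Ipos[OF that] r_pos[OF that] by (simp add: u_def)
  have xa: "x a = 0" using a0 wgt_pos[OF a0, of n] by (simp add: x_def I_def field_simps eval_nat_numeral)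
  have xb: "x b < 0"
  proof -
    have b: "0 < b ^ 3 * wgt n b" using a0 ab wgt_pos[of b n] by simp
    have "b\<^sup>2 * (b ^ 3 * wgt n b) < 2 * I b"
      using X by (simp add: I_def power_add[symmetric] mult.assoc[symmetric])
    then show ?thesis using b by (simp add: x_def field_simps)
  qed
  obtain \<nu> v y where v: "\<nu> \<le> 1" "neumann (wgt n) (slq n 3 \<nu>) a b v y" "v a = 1" "\<And>r. r \<in> {a..b} \<Longrightarrow> 0 < v r"
    by (rule ground_state[OF su upos xa]) (use xb ab in auto)
  have sv: "slsys (wgt n) (slq n 3 \<nu>) a b v y" "y a = 0" "y b = 0" using v(2) by (auto simp: neumann_def)
  have "\<nu> \<noteq> 1"
  proof
    assume "\<nu> = 1"
    have "u b * y b - v b * x b \<le> u a * y a - v a * x a"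
      by (rule slsys_comparison[OF su sv(1)]) (use \<open>\<nu> = 1\<close> ab in auto)
    then have "0 \<le> v b * x b" using sv xa by simp
    with v(4)[of b] xb ab show False by (simp add: zero_le_mult_iff)
  qed
  then have n3: "\<nu> < 1" using v(1) by simp
  then show "\<exists>\<nu><1. eig 3 \<nu>" using v(2) by (auto simp: eig_def)
  \<comment> \<open>Degree 2 has a smaller potential. If shooting at the same parameter succeeded,
    the Wronskian of the positive eigenfunction of degree 3 with this solution would be positive at
    \<open>b\<close>, although it starts at 0 and does not increase.\<close>
  obtain w z where w: "slsys (wgt n) (slq n 2 \<nu>) a b w z" "w a = 1" "z a = 0"
    by (rule slsys_exists[OF ab cont_wgt cont_slq])
  have bad: "(\<exists>r\<in>{a..b}. w r \<le> 0) \<or> z b \<le> 0"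
  proof (rule ccontr)
    assume "\<not> ?thesis"
    then have wpos: "\<And>r. r \<in> {a..b} \<Longrightarrow> 0 < w r" and zb: "0 < z b" by (auto simp: not_le)
    have "v b * z b - w b * y b \<le> v a * z a - w a * y a"
    proof (rule slsys_comparison[OF sv(1) w(1)])
      fix r assume r: "a < r" "r < b"
      have "(pot n 2 - pot n 3) / r\<^sup>2 + (\<nu> - \<nu>) \<le> 0" by (simp add: pot_simps divide_nonpos_nonneg)
      then have "slq n 2 \<nu> r - slq n 3 \<nu> r \<le> 0"
        unfolding slq_diff using wgt_pos'[of r] r by (intro divide_nonpos_nonneg) auto
      then show "(slq n 2 \<nu> r - slq n 3 \<nu> r) * (v r * w r) \<le> 0"
        using v(4)[of r] wpos[of r] r by (intro mult_nonpos_nonneg mult_nonneg_nonneg) auto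
    qed (use ab in auto)
    then have "v b * z b \<le> 0" using sv w by simp
    with v(4)[of b] zb ab show False by (simp add: mult_le_0_iff)
  qed
  have wa: "0 < w a" using w(2) by simp
  obtain \<mu> w' z' where "\<mu> \<le> \<nu>" "neumann (wgt n) (slq n 2 \<mu>) a b w' z'" "w' a = 1" "\<And>r. r \<in> {a..b} \<Longrightarrow> 0 < w' r"
    using ground_state[OF w(1) wa w(3) bad] by blast
  with n3 show "\<exists>\<nu><1. eig 2 \<nu>" unfolding eig_def by (intro exI[of _ \<mu>]) auto
qed

end

section \<open>From the set of eigenvalues to positions in the ordered list\<close>

text \<open>A known eigenvalue occurs at some index, which bounds the early entries of the
  decreasing list from below; the gap lemmas bound them from above. The parameters 0, 1/2 and 1
  correspond to the eigenvalues 1, 1/2 and 0.\<close>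

theorem eigenvalues_conclusion:
  fixes \<Lambda> :: "nat \<Rightarrow> nat \<Rightarrow> real"
  assumes ann: "annulus n a b \<phi> \<phi>'" and L: "\<And>l. lists_linearized_eigenvalues n l a b (\<Lambda> l)"
    and bb: "b\<^sup>2 \<le> 3 * (real n + 3)"
    and X: "b ^ 5 * wgt n b - a ^ 5 * wgt n a < 2 * integral {a..b} (\<lambda>r. r ^ 4 * wgt n r)"
  shows "\<Lambda> 0 1 > 1 \<and> \<Lambda> 0 2 = 1 \<and> \<Lambda> 1 1 = 1 \<and> \<Lambda> 1 2 = 1/2 \<and> \<Lambda> 2 1 > 0 \<and> \<Lambda> 2 2 < 0 \<and>
         \<Lambda> 3 1 > 0 \<and> \<Lambda> 3 2 < 0 \<and> (\<forall>l\<ge>4. \<forall>k\<ge>1. \<Lambda> l k < 0) \<and> (\<forall>l. \<forall>k\<ge>3. \<Lambda> l k < 0)"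
proof -
  interpret annulus n a b \<phi> \<phi>' by (rule ann)
  have dec: "\<Lambda> l k < \<Lambda> l j" if "1 \<le> j" "j < k" for l j k
    using that(2,1)
  proof (induction k rule: less_Suc_induct)
    case (1 i) then show ?case using L[of l] by (simp add: lists_linearized_eigenvalues_def)
  next
    case (2 i j k) then show ?case by fastforce
  qed
  have eL: "eig l (1 - \<Lambda> l k)" if "1 \<le> k" for l k
  proof -
    have "\<Lambda> l k \<in> {\<nu>. linearized_eigenvalue n l a b \<nu>}"
      using L[of l] that unfolding lists_linearized_eigenvalues_def by blast
    then show ?thesis using linearized_eigenvalue_iff[OF a0 ab n1] by (simp add: eig_def)
  qed
  have Le: "\<exists>k\<ge>1. \<nu> = 1 - \<Lambda> l k" if "eig l \<nu>" for l \<nu>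
  proof -
    have "linearized_eigenvalue n l a b (1 - \<nu>)"
      using that linearized_eigenvalue_iff[OF a0 ab n1] by (simp add: eig_def)
    then have "1 - \<nu> \<in> \<Lambda> l ` {1..}" using L[of l] unfolding lists_linearized_eigenvalues_def by blast
    then show ?thesis by auto
  qed
  have top: "\<Lambda> l k \<le> \<Lambda> l 1" if "1 \<le> k" for l k using dec[of 1 k l] that by (cases "k = 1") auto
  have sec: "\<Lambda> l k \<le> \<Lambda> l 2" if "2 \<le> k" for l k using dec[of 2 k l] that by (cases "k = 2") auto
  have thr: "\<Lambda> l k \<le> \<Lambda> l 3" if "3 \<le> k" for l k using dec[of 3 k l] that by (cases "k = 3") auto
  have d12: "\<Lambda> l 2 < \<Lambda> l 1" and d23: "\<Lambda> l 3 < \<Lambda> l 2" for l using dec[of 1 2 l] dec[of 2 3 l] by auto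
  have A01: "1 < \<Lambda> 0 1"
  proof -
    obtain \<nu> where "\<nu> < 0" "eig 0 \<nu>" using eig_0_negative by blast
    then obtain k where "k \<ge> 1" "\<nu> = 1 - \<Lambda> 0 k" using Le by blast
    then show ?thesis using top[of k 0] \<open>\<nu> < 0\<close> by simp
  qed
  have A02: "\<Lambda> 0 2 = 1"
  proof -
    have "eig 0 0" using neumann_time unfolding eig_def by blast
    then obtain k where k: "k \<ge> 1" "\<Lambda> 0 k = 1" using Le[of 0 0] by auto
    have "k \<noteq> 1" using k A01 by auto
    then have "1 \<le> \<Lambda> 0 2" using sec[of k 0] k by simp
    moreover have "0 \<le> 1 - \<Lambda> 0 2"
      by (rule eig_0_gap[OF eL[of 1] eL[of 2]]) (use d12 in auto)
    ultimately show ?thesis by simp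
  qed
  have A11: "\<Lambda> 1 1 = 1"
  proof -
    have "eig 1 0" using neumann_const unfolding eig_def by blast
    then obtain k where "k \<ge> 1" "\<Lambda> 1 k = 1" using Le[of 1 0] by auto
    then have "1 \<le> \<Lambda> 1 1" using top[of k 1] by simp
    moreover have "0 \<le> 1 - \<Lambda> 1 1" by (rule eig_1_nonneg[OF eL]) simp
    ultimately show ?thesis by simp
  qed
  have A12: "\<Lambda> 1 2 = 1 / 2"
  proof -
    have "eig 1 (1/2)" using neumann_translation unfolding eig_def by blast
    then obtain k where k: "k \<ge> 1" "\<Lambda> 1 k = 1 / 2" using Le[of 1 "1/2"] by auto
    then have "k \<noteq> 1" using A11 by auto
    then have "1 / 2 \<le> \<Lambda> 1 2" using sec[of k 1] k by simp
    moreover have "1 / 2 \<le> 1 - \<Lambda> 1 2" by (rule eig_1_gap[OF eL]) (use d12[of 1] A11 in auto)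
    ultimately show ?thesis by simp
  qed
  have ge2: "\<Lambda> l 2 < 0" if "2 \<le> l" for l
    using eig_ge2_second[OF that eL[of 1] eL[of 2]] d12[of l] by auto
  have pos: "0 < \<Lambda> l 1" if "\<exists>\<nu><1. eig l \<nu>" for l
  proof -
    obtain \<nu> where "\<nu> < 1" "eig l \<nu>" using \<open>\<exists>\<nu><1. eig l \<nu>\<close> by blast
    then obtain k where "k \<ge> 1" "\<nu> = 1 - \<Lambda> l k" using Le by blast
    then show ?thesis using top[of k l] \<open>\<nu> < 1\<close> by simp
  qed
  have ge4: "\<Lambda> l k < 0" if "4 \<le> l" "1 \<le> k" for l k
    using eig_ge4[OF that(1) eL[OF that(2)] bb] by simp
  have k3: "\<Lambda> l k < 0" if "3 \<le> k" for l k
  proof (cases "2 \<le> l")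
    case True
    then show ?thesis using ge2[OF True] d23[of l] thr[OF that, of l] by simp
  next
    case False
    then have "l \<le> 1" by simp
    from eig_third[OF this eL[of 1] eL[of 2] eL[of 3]] d12[of l] d23[of l] thr[OF that, of l] show ?thesis by auto
  qed
  show ?thesis
    using A01 A02 A11 A12 ge2 ge4 k3 pos[OF eig_2_3(1)[OF X]] pos[OF eig_2_3(2)[OF X]] by simp
qed

section \<open>Barriers for the two radii\<close>

lemma DERIV_everywhere_continuous_on:
  fixes f :: "real \<Rightarrow> real"
  assumes "\<And>r. (f has_real_derivative f' r) (at r)"
  shows "continuous_on S f"
  by (intro continuous_at_imp_continuous_on ballI) (rule DERIV_isCont[OF assms])

context annulus
begin

text \<open>This is the flux of the profile. It decreases from 1 to -1, which expresses the
  overdetermined slopes and bounds the flux at points that need not be end points.\<close>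

definition robin :: "real \<Rightarrow> real" where
  "robin r = \<phi>' r + drift n r * \<phi> r"

lemma robin_a: "robin a = 1" and robin_b: "robin b = - 1"
  by (simp_all add: robin_def \<phi>a \<phi>b \<phi>'a \<phi>'b)

lemma robin_deriv:
  assumes "a < r" "r < b"
  shows "(robin has_real_derivative - (1 + (real n - 1) / r\<^sup>2) * \<phi> r) (at r)"
proof -
  have r0: "r \<noteq> 0" "(2::real) \<noteq> 0" using a0 assms by simp_all
  show ?thesis unfolding robin_def drift_def
    by (rule DERIV_cong, (rule derivative_eq_intros int_deriv[OF assms] r0 refl)+)
      (use r0 in \<open>simp add: field_simps power2_eq_square drift_def\<close>)
qed

lemma cont_robin: "continuous_on {a..b} robin"
  unfolding robin_def drift_def using a0
  by (intro continuous_intros cont_\<phi> cont_\<phi>') auto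

lemma robin_antimono:
  assumes st: "a \<le> s" "s \<le> t" "t \<le> b"
  shows "robin t \<le> robin s"
proof (cases "s = t")
  case False
  have st': "s < t" using st False by simp
  have "robin t < robin s"
  proof (rule DERIV_neg_imp_decreasing_open[OF st'])
    fix r assume r: "s < r" "r < t"
    then have ab': "a < r" "r < b" using st by auto
    have "0 < \<phi> r" "0 \<le> (real n - 1) / r\<^sup>2" using \<phi>pos ab' n1 by auto
    then have "- (1 + (real n - 1) / r\<^sup>2) * \<phi> r < 0" by (intro mult_neg_pos) linarith+
    then show "\<exists>y. (robin has_real_derivative y) (at r) \<and> y < 0"
      using robin_deriv[OF ab'] by blast
  qed (rule continuous_on_subset[OF cont_robin], use st in auto)
  then show ?thesis by simp
qed simp

lemma robin_bounds: "r \<in> {a..b} \<Longrightarrow> robin r \<le> 1" "r \<in> {a..b} \<Longrightarrow> - 1 \<le> robin r"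
  using robin_antimono[of a r] robin_antimono[of r b] robin_a robin_b by auto

text \<open>For a solution \<open>U\<close> of the adjoint equation the bracket \<open>\<phi> U' - U (\<phi>' + drift \<phi>)\<close> is constant, and the
  overdetermined boundary data turn it into \<open>-U a = U b\<close>. Approximate solutions with a signed residual
  therefore locate the end points.\<close>

definition adjoint_op :: "(real \<Rightarrow> real) \<Rightarrow> (real \<Rightarrow> real) \<Rightarrow> (real \<Rightarrow> real) \<Rightarrow> real \<Rightarrow> real" where
  "adjoint_op U U1 U2 r = r\<^sup>2 * U2 r - r * (real n - 1 - r\<^sup>2 / 2) * U1 r + (r\<^sup>2 + real n - 1) * U r"

definition bracket :: "(real \<Rightarrow> real) \<Rightarrow> (real \<Rightarrow> real) \<Rightarrow> real \<Rightarrow> real" where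
  "bracket U U1 r = \<phi> r * U1 r - U r * robin r"

lemma bracket_deriv:
  assumes "a < r" "r < b" "\<And>r. (U has_real_derivative U1 r) (at r)" "\<And>r. (U1 has_real_derivative U2 r) (at r)"
  shows "(bracket U U1 has_real_derivative \<phi> r * adjoint_op U U1 U2 r / r\<^sup>2) (at r)"
proof -
  have r0: "r \<noteq> 0" using a0 assms by simp
  show ?thesis unfolding bracket_def
    by (rule DERIV_cong, (rule derivative_eq_intros int_deriv[OF assms(1,2)] robin_deriv[OF assms(1,2)] assms(3,4) refl)+)
      (use r0 in \<open>simp add: field_simps power2_eq_square drift_def adjoint_op_def robin_def\<close>)
qed

lemma cont_bracket:
  assumes "\<And>r. (U has_real_derivative U1 r) (at r)" "\<And>r. (U1 has_real_derivative U2 r) (at r)"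
  shows "continuous_on {a..b} (bracket U U1)"
proof -
  note DERIV_everywhere_continuous_on[OF assms(1)] DERIV_everywhere_continuous_on[OF assms(2)]
  then show ?thesis unfolding bracket_def by (intro continuous_intros cont_\<phi> cont_robin)
qed

lemma bracket_mono:
  assumes U: "\<And>r. (U has_real_derivative U1 r) (at r)" "\<And>r. (U1 has_real_derivative U2 r) (at r)"
    and st: "a \<le> s" "s \<le> t" "t \<le> b"
    and pos: "\<And>r. s < r \<Longrightarrow> r < t \<Longrightarrow> 0 \<le> adjoint_op U U1 U2 r"
  shows "bracket U U1 s \<le> bracket U U1 t"
proof (rule DERIV_nonneg_imp_increasing_open[OF st(2)])
  fix r assume r: "s < r" "r < t"
  then have ab': "a < r" "r < b" using st by auto
  have "0 \<le> \<phi> r * adjoint_op U U1 U2 r / r\<^sup>2"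
    using pos[OF r] \<phi>_nonneg[of r] ab' by (intro divide_nonneg_nonneg mult_nonneg_nonneg) auto
  then show "\<exists>y. (bracket U U1 has_real_derivative y) (at r) \<and> 0 \<le> y"
    using bracket_deriv[OF ab' U] by blast
qed (rule continuous_on_subset[OF cont_bracket[OF U]], use st in auto)

lemma bracket_uminus: "bracket (\<lambda>r. - U r) (\<lambda>r. - U1 r) r = - bracket U U1 r"
  by (simp add: bracket_def)

lemma bracket_antimono:
  assumes U: "\<And>r. (U has_real_derivative U1 r) (at r)" "\<And>r. (U1 has_real_derivative U2 r) (at r)"
    and st: "a \<le> s" "s \<le> t" "t \<le> b"
    and neg: "\<And>r. s < r \<Longrightarrow> r < t \<Longrightarrow> adjoint_op U U1 U2 r \<le> 0"
  shows "bracket U U1 t \<le> bracket U U1 s"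
proof -
  have "adjoint_op (\<lambda>r. - U r) (\<lambda>r. - U1 r) (\<lambda>r. - U2 r) r = - adjoint_op U U1 U2 r" for r
    by (simp add: adjoint_op_def algebra_simps)
  then have "bracket (\<lambda>r. - U r) (\<lambda>r. - U1 r) s \<le> bracket (\<lambda>r. - U r) (\<lambda>r. - U1 r) t"
    using neg by (intro bracket_mono[where ?U2.0 = "\<lambda>r. - U2 r"] st) (auto intro!: DERIV_minus U)
  then show ?thesis by (simp add: bracket_uminus)
qed

lemma bracket_a: "bracket U U1 a = - U a" and bracket_b: "bracket U U1 b = U b"
  by (simp_all add: bracket_def \<phi>a \<phi>b robin_a robin_b)

text \<open>If b < d, the bracket would not increase up to \<open>b\<close>, where it equals U b > M
  because b > e2. At its start it is at most \<open>M\<close>, whichever of \<open>a\<close> and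
  \<open>c\<close> is larger, so no lower bound for \<open>a\<close> is required in advance.\<close>

lemma outer_radius_ge:
  assumes U: "\<And>r. (U has_real_derivative U1 r) (at r)" "\<And>r. (U1 has_real_derivative U2 r) (at r)"
    and c0: "0 < c" "c \<le> e2" and e2: "e2\<^sup>2 \<le> 2 * real n" and e1: "0 \<le> e1" "2 * real n \<le> e1\<^sup>2"
    and res: "\<And>r. c \<le> r \<Longrightarrow> r \<le> d \<Longrightarrow> adjoint_op U U1 U2 r \<le> 0"
    and Uc: "U c \<le> 0" "U1 c \<le> 0"
    and lo: "\<And>r. c \<le> r \<Longrightarrow> r \<le> e1 \<Longrightarrow> - M \<le> U r"
    and hi: "\<And>r. e2 \<le> r \<Longrightarrow> r \<le> d \<Longrightarrow> M < U r"
  shows "d \<le> b"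
proof (rule ccontr)
  assume bd: "\<not> d \<le> b"
  have "e2\<^sup>2 < b\<^sup>2" using e2 ends_2n(2) by simp
  then have e2b: "e2 < b" using a0 ab by (simp add: power2_less_imp_less)
  have "a\<^sup>2 < e1\<^sup>2" using ends_2n(1) e1 by simp
  then have ae1: "a < e1" using e1(1) by (rule power2_less_imp_less)
  have "bracket U U1 b \<le> bracket U U1 (max a c)"
    using bd c0 e2b ab by (intro bracket_antimono[OF U] res) auto
  moreover have "M < bracket U U1 b" using hi[of b] bd e2b by (simp add: bracket_b)
  \<comment> \<open>If \<open>c \<le> a\<close>, the value is - U a and a < e1. If a < c, the signs
    of \<open>U\<close> and \<open>U1\<close> at \<open>c\<close> and the bound of the flux by 1
    give at most - U c.\<close>
  moreover have "bracket U U1 (max a c) \<le> M"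
  proof (cases "c \<le> a")
    case True
    then show ?thesis using lo[of a] ae1 by (simp add: bracket_a max_def)
  next
    case False
    then have cab: "c \<in> {a..b}" using e2b c0 by auto
    have "c\<^sup>2 \<le> e2\<^sup>2" using c0 by (intro power_mono) auto
    then have "c\<^sup>2 \<le> e1\<^sup>2" using e2 e1(2) by linarith
    then have "c \<le> e1" using e1(1) by (rule power2_le_imp_le)
    then have "- M \<le> U c" using lo[of c] by simp
    moreover have "\<phi> c * U1 c \<le> 0" using \<phi>_nonneg[OF cab] Uc(2) by (rule mult_nonneg_nonpos)
    moreover have "- U c * robin c \<le> - U c" using mult_left_mono[OF robin_bounds(1)[OF cab], of "- U c"] Uc(1) by simp
    ultimately show ?thesis using False by (simp add: bracket_def max_def)
  qed
  ultimately show False by simp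
qed

text \<open>If d < b, the bracket would rise from - U a, which exceeds \<open>U d\<close>, to its
  value at \<open>d\<close>, which is at most \<open>U d\<close> because the flux of the profile is
  at least -1.\<close>

lemma outer_radius_le:
  assumes U: "\<And>r. (U has_real_derivative U1 r) (at r)" "\<And>r. (U1 has_real_derivative U2 r) (at r)"
    and ad: "c \<le> a" and e: "0 \<le> e" "2 * real n \<le> e\<^sup>2"
    and res: "\<And>r. c \<le> r \<Longrightarrow> r \<le> d \<Longrightarrow> 0 \<le> adjoint_op U U1 U2 r"
    and Ud: "0 \<le> U d" "U1 d \<le> 0"
    and lo: "\<And>r. c \<le> r \<Longrightarrow> r \<le> e \<Longrightarrow> U r < - U d"
    and dn: "a < d"
  shows "b \<le> d"
proof (rule ccontr)
  assume bd: "\<not> b \<le> d"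
  then have dab: "d \<in> {a..b}" using dn by simp
  have "a\<^sup>2 < e\<^sup>2" using ends_2n(1) e by simp
  then have "a < e" using e(1) by (rule power2_less_imp_less)
  then have "U d < bracket U U1 a" using lo[of a] ad by (simp add: bracket_a)
  moreover have "bracket U U1 a \<le> bracket U U1 d"
    using bd dn ad by (intro bracket_mono[OF U] res) auto
  moreover have "\<phi> d * U1 d \<le> 0" using \<phi>_nonneg[OF dab] Ud(2) by (rule mult_nonneg_nonpos)
  moreover have "- U d * robin d \<le> U d" using mult_left_mono[OF robin_bounds(2)[OF dab] Ud(1)] by simp
  ultimately show False by (simp add: bracket_def)
qed

definition profile_op :: "(real \<Rightarrow> real) \<Rightarrow> (real \<Rightarrow> real) \<Rightarrow> (real \<Rightarrow> real) \<Rightarrow> real \<Rightarrow> real" where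
  "profile_op F F1 F2 r = r * F2 r + (real n - 1 - r\<^sup>2 / 2) * F1 r + r / 2 * F r"

text \<open>If a < c, the weighted Wronskian of the profile with the strict subsolution
  \<open>F\<close> would increase on [c, d], but the boundary data of \<open>F\<close> make it
  nonnegative at \<open>c\<close> and nonpositive at \<open>d\<close>.\<close>

lemma inner_radius_ge:
  assumes F: "\<And>r. (F has_real_derivative F1 r) (at r)" "\<And>r. (F1 has_real_derivative F2 r) (at r)"
    and cd: "c < d" "d \<le> b"
    and res: "\<And>r. c \<le> r \<Longrightarrow> r \<le> d \<Longrightarrow> 0 < profile_op F F1 F2 r"
    and ends: "F c = 0" "F d = 0" "0 \<le> F1 c" "F1 d \<le> 0"
  shows "c \<le> a"
proof (rule ccontr)
  assume "\<not> c \<le> a"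
  then have ac: "a < c" by simp
  define W where "W = (\<lambda>r. wgt n r * (\<phi> r * F1 r - \<phi>' r * F r))"
  have dW: "(W has_real_derivative wgt n r * \<phi> r * profile_op F F1 F2 r / r) (at r)" if r: "a < r" "r < b" for r
  proof -
    have r0: "0 < r" "r \<noteq> 0" using a0 r by auto
    show ?thesis unfolding W_def
      by (rule DERIV_cong, (rule derivative_eq_intros int_deriv[OF r] wgt_deriv[OF r0(1) n1] F refl)+)
        (use r0 in \<open>simp add: field_simps power2_eq_square drift_def profile_op_def\<close>)
  qed
  note contF = DERIV_everywhere_continuous_on[OF F(1)] DERIV_everywhere_continuous_on[OF F(2)]
  have "continuous_on {a..b} (wgt n)"
    by (rule DERIV_continuous_on, rule wgt_deriv[OF r_pos n1])
  then have cW: "continuous_on {a..b} W"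
    unfolding W_def by (intro continuous_intros contF cont_\<phi> cont_\<phi>')
  have "W c < W d"
  proof (rule DERIV_pos_imp_increasing_open[OF cd(1)])
    fix r assume r: "c < r" "r < d"
    then have ab': "a < r" "r < b" using ac cd by auto
    then have "0 < wgt n r" "0 < \<phi> r" "0 < r" using wgt_pos'[of r] \<phi>pos[of r] a0 by auto
    then have "0 < wgt n r * \<phi> r * profile_op F F1 F2 r / r" using res[of r] r by simp
    then show "\<exists>y. (W has_real_derivative y) (at r) \<and> 0 < y" using dW[OF ab'] by blast
  qed (rule continuous_on_subset[OF cW], use ac cd in auto)
  moreover have "0 \<le> W c" using wgt_pos'[of c] \<phi>_nonneg[of c] ends ac cd by (simp add: W_def)
  moreover have "W d \<le> 0"
  proof -
    have "\<phi> d * F1 d \<le> 0" using \<phi>_nonneg[of d] ends ac cd by (intro mult_nonneg_nonpos) auto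
    then show ?thesis using wgt_pos'[of d] ends ac cd by (simp add: W_def mult_nonneg_nonpos)
  qed
  ultimately show False by simp
qed

text \<open>The claim is J b < J a for the function \<open>J\<close> below, whose derivative changes
  sign once, at r^2 = 2n + 4. Widening the left end to \<open>c\<close> and cutting the right end at
  \<open>d\<close> can only lose, so J d < J c suffices. Adding
  \<open>r ^ 5 * wgt n r * \<Psi> r\<close> to \<open>J\<close> turns this into a pointwise
  inequality without integrals.\<close>

lemma degree3_condition:
  assumes Psi: "\<And>r. (\<Psi> has_real_derivative \<Psi>1 r) (at r)"
    and ca: "0 < c" "c \<le> a" and d: "a < d" "d \<le> b" "2 * real n + 4 \<le> d\<^sup>2"
    and res: "\<And>r. c \<le> r \<Longrightarrow> r \<le> d \<Longrightarrow>
      r * \<Psi>1 r + (real n + 4 - r\<^sup>2 / 2) * \<Psi> r + (real n + 2 - r\<^sup>2 / 2) < 0"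
    and ends: "\<Psi> c \<le> 0" "0 \<le> \<Psi> d"
  shows "b ^ 5 * wgt n b - a ^ 5 * wgt n a < 2 * integral {a..b} (\<lambda>r. r ^ 4 * wgt n r)"
proof -
  define I where "I = (\<lambda>r. integral {c..r} (\<lambda>r. r ^ 4 * wgt n r))"
  have cw: "continuous_on {c..b} (\<lambda>r. r ^ 4 * wgt n r)"
  proof -
    have "continuous_on {c..b} (wgt n)"
      by (rule DERIV_continuous_on, rule wgt_deriv[OF _ n1]) (use ca in auto)
    then show ?thesis by (intro continuous_intros)
  qed
  have dI: "(I has_real_derivative r ^ 4 * wgt n r) (at r)" if "c < r" "r < b" for r
  proof -
    have "(I has_real_derivative r ^ 4 * wgt n r) (at r within {c..b})"
      unfolding I_def has_real_derivative_iff_has_vector_derivative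
      using that by (intro integral_has_vector_derivative cw) auto
    then show ?thesis using that at_within_interior[of r "{c..b}"] by (simp add: interior_atLeastAtMost_real)
  qed
  have cI: "continuous_on {c..b} I"
    unfolding I_def by (intro indefinite_integral_continuous_1 integrable_continuous_real cw)
  define J where "J = (\<lambda>r. r ^ 5 * wgt n r - 2 * I r)"
  have dJ: "(J has_real_derivative wgt n r * r ^ 4 * (real n + 2 - r\<^sup>2 / 2)) (at r)" if r: "c < r" "r < b" for r
  proof -
    have r0: "0 < r" "r \<noteq> 0" using ca r by auto
    show ?thesis unfolding J_def
      by (rule DERIV_cong, (rule derivative_eq_intros wgt_deriv[OF r0(1) n1] dI[OF r] refl)+)
        (use r0 in \<open>simp add: field_simps eval_nat_numeral drift_def\<close>)
  qed
  have cJ: "continuous_on {c..b} J"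
  proof -
    have "continuous_on {c..b} (wgt n)"
      by (rule DERIV_continuous_on, rule wgt_deriv[OF _ n1]) (use ca in auto)
    then show ?thesis unfolding J_def by (intro continuous_intros cI)
  qed
  have mono: "J s \<le> J t" if "c \<le> s" "s \<le> t" "t \<le> b" "t\<^sup>2 \<le> 2 * real n + 4" for s t
  proof (rule DERIV_nonneg_imp_increasing_open[OF that(2)])
    fix r assume r: "s < r" "r < t"
    then have cb: "c < r" "r < b" using that by auto
    have "r\<^sup>2 \<le> t\<^sup>2" using r ca cb by (intro power_mono) auto
    then have "0 \<le> real n + 2 - r\<^sup>2 / 2" using that(4) by linarith
    then have "0 \<le> wgt n r * r ^ 4 * (real n + 2 - r\<^sup>2 / 2)"
      using that wgt_pos[of r n] ca cb by (intro mult_nonneg_nonneg) auto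
    then show "\<exists>y. (J has_real_derivative y) (at r) \<and> 0 \<le> y" using dJ[OF cb] by blast
  qed (rule continuous_on_subset[OF cJ], use that in auto)
  have antimono: "J t \<le> J s" if "c \<le> s" "s \<le> t" "t \<le> b" "2 * real n + 4 \<le> s\<^sup>2" for s t
  proof (rule DERIV_nonpos_imp_decreasing_open[OF that(2)])
    fix r assume r: "s < r" "r < t"
    then have cb: "c < r" "r < b" using that by auto
    have "s\<^sup>2 \<le> r\<^sup>2" using r ca that by (intro power_mono) auto
    then have "real n + 2 - r\<^sup>2 / 2 \<le> 0" using that(4) by linarith
    then have "wgt n r * r ^ 4 * (real n + 2 - r\<^sup>2 / 2) \<le> 0"
      using that wgt_pos[of r n] ca cb by (intro mult_nonneg_nonpos) auto
    then show "\<exists>y. (J has_real_derivative y) (at r) \<and> y \<le> 0" using dJ[OF cb] by blast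
  qed (rule continuous_on_subset[OF cJ], use that in auto)
  note cPsi = DERIV_everywhere_continuous_on[OF Psi]
  have cwgt: "continuous_on {c..b} (wgt n)"
    by (rule DERIV_continuous_on, rule wgt_deriv[OF _ n1]) (use ca in auto)
  define H where "H = (\<lambda>r. J r + r ^ 5 * wgt n r * \<Psi> r)"
  have cd: "c < d" using ca d by simp
  have "H d < H c"
  proof (rule DERIV_neg_imp_decreasing_open[OF cd])
    fix r assume r: "c < r" "r < d"
    then have cb: "c < r" "r < b" and r0: "0 < r" "r \<noteq> 0" using ca d by auto
    let ?R = "r * \<Psi>1 r + (real n + 4 - r\<^sup>2 / 2) * \<Psi> r + (real n + 2 - r\<^sup>2 / 2)"
    have "(H has_real_derivative wgt n r * r ^ 4 * ?R) (at r)"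
      unfolding H_def
      by (rule DERIV_cong, (rule derivative_eq_intros wgt_deriv[OF r0(1) n1] dJ[OF cb] Psi refl)+)
        (use r0 in \<open>simp add: field_simps eval_nat_numeral drift_def\<close>)
    moreover have "wgt n r * r ^ 4 * ?R < 0"
      using res[of r] r wgt_pos[OF r0(1), of n] r0 by (intro mult_pos_neg) auto
    ultimately show "\<exists>y. (H has_real_derivative y) (at r) \<and> y < 0" by blast
  next
    show "continuous_on {c..d} H" unfolding H_def
      by (intro continuous_intros; rule continuous_on_subset[OF cJ] continuous_on_subset[OF cPsi] continuous_on_subset[OF cwgt])
        (use d in auto)
  qed
  moreover have "J d \<le> H d" using ends ca d wgt_pos[of d n] by (simp add: H_def)
  moreover have "H c \<le> J c"
  proof -
    have "c ^ 5 * wgt n c * \<Psi> c \<le> 0" using ends ca wgt_pos[of c n] by (intro mult_nonneg_nonpos) auto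
    then show ?thesis by (simp add: H_def)
  qed
  moreover have "J c \<le> J a" using ca ab ends_2n by (intro mono) auto
  moreover have "J b \<le> J d" using ca d by (intro antimono) auto
  ultimately have "J b < J a" by simp
  moreover have "I b = I a + integral {a..b} (\<lambda>r. r ^ 4 * wgt n r)"
    unfolding I_def using ca ab by (intro Henstock_Kurzweil_Integration.integral_combine[symmetric] integrable_continuous_real cw) auto
  ultimately show ?thesis by (simp add: J_def)
qed

end

section \<open>Integer polynomials and positivity by Bernstein coefficients\<close>

primrec horner :: "int list \<Rightarrow> real \<Rightarrow> real" where
  "horner [] t = 0"
| "horner (x # xs) t = real_of_int x + t * horner xs t"

fun ladd :: "int list \<Rightarrow> int list \<Rightarrow> int list" where
  "ladd [] ys = ys"
| "ladd (x # xs) [] = x # xs"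
| "ladd (x # xs) (y # ys) = (x + y) # ladd xs ys"

definition lscale :: "int \<Rightarrow> int list \<Rightarrow> int list" where
  "lscale c = map (\<lambda>x. c * x)"

text \<open>The argument \<open>c\<close> carries the preceding coefficient, so that multiplication
  by p + q t is a single pass.\<close>

primrec ladd_mult :: "int \<Rightarrow> int \<Rightarrow> int \<Rightarrow> int list \<Rightarrow> int list" where
  "ladd_mult p q c [] = [q * c]"
| "ladd_mult p q c (x # xs) = (p * x + q * c) # ladd_mult p q x xs"

abbreviation lmult :: "int \<Rightarrow> int \<Rightarrow> int list \<Rightarrow> int list" where
  "lmult p q \<equiv> ladd_mult p q 0"

primrec lderiv_aux :: "int \<Rightarrow> int list \<Rightarrow> int list" where
  "lderiv_aux k [] = []"
| "lderiv_aux k (x # xs) = k * x # lderiv_aux (k + 1) xs"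

definition lderiv :: "int list \<Rightarrow> int list" where
  "lderiv xs = lderiv_aux 1 (tl xs)"

lemma horner_ladd [simp]: "horner (ladd xs ys) t = horner xs t + horner ys t"
  by (induction xs ys rule: ladd.induct) (auto simp: algebra_simps)

lemma horner_lscale [simp]: "horner (lscale c xs) t = real_of_int c * horner xs t"
  by (induction xs) (auto simp: lscale_def algebra_simps)

lemma horner_ladd_mult: "horner (ladd_mult p q c xs) t = real_of_int q * real_of_int c + (real_of_int p + real_of_int q * t) * horner xs t"
  by (induction xs arbitrary: c) (auto simp: algebra_simps)

lemma horner_lmult [simp]: "horner (lmult p q xs) t = (real_of_int p + real_of_int q * t) * horner xs t"
  by (simp add: horner_ladd_mult)

lemma horner_lderiv_aux: "horner (lderiv_aux k xs) t = real_of_int (k - 1) * horner xs t + horner (lderiv_aux 1 xs) t"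
proof (induction xs arbitrary: k)
  case (Cons x xs)
  show ?case using Cons[of "k + 1"] Cons[of 2] by (simp add: algebra_simps)
qed simp

lemma horner_lderiv_Cons: "horner (lderiv (x # xs)) t = horner xs t + t * horner (lderiv xs) t"
proof (cases xs)
  case (Cons y ys)
  show ?thesis using horner_lderiv_aux[of 2 ys t] by (simp add: Cons lderiv_def algebra_simps)
qed (simp add: lderiv_def)

lemma horner_deriv: "(horner xs has_real_derivative horner (lderiv xs) t) (at t)"
proof (induction xs)
  case (Cons x xs)
  have "((\<lambda>t. real_of_int x + t * horner xs t) has_real_derivative horner (lderiv (x # xs)) t) (at t)"
    by (rule DERIV_cong, (rule derivative_eq_intros Cons refl)+) (simp add: horner_lderiv_Cons)
  then show ?case by simp
qed (simp add: lderiv_def)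

text \<open>On a subinterval the homogenised coefficients are the Bernstein coefficients up to binomial factors.\<close>

primrec homog :: "int list \<Rightarrow> real \<Rightarrow> real \<Rightarrow> real" where
  "homog [] u v = 0"
| "homog (x # xs) u v = real_of_int x * v ^ length xs + u * homog xs u v"

lemma length_ladd_mult [simp]: "length (ladd_mult p q c xs) = Suc (length xs)"
  by (induction xs arbitrary: c) auto

lemma homog_ladd_mult:
  "homog (ladd_mult p q c xs) u v = real_of_int q * real_of_int c * v ^ length xs + (real_of_int p * v + real_of_int q * u) * homog xs u v"
  by (induction xs arbitrary: c) (auto simp: algebra_simps)

lemma length_ladd [simp]: "length (ladd xs ys) = max (length xs) (length ys)"
  by (induction xs ys rule: ladd.induct) auto

lemma length_lscale [simp]: "length (lscale c xs) = length xs"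
  by (simp add: lscale_def)

lemma homog_ladd: "length xs = length ys \<Longrightarrow> homog (ladd xs ys) u v = homog xs u v + homog ys u v"
  by (induction xs ys rule: ladd.induct) (auto simp: algebra_simps)

lemma homog_lscale: "homog (lscale c xs) u v = real_of_int c * homog xs u v"
  by (induction xs) (auto simp: lscale_def algebra_simps)

text \<open>Horner's scheme for the substitution t = (lo v + hi u) / d with u + v = 1. The second
  component is the constant d^k written as d^k (u + v)^k, which is needed to add a coefficient in
  the right degree.\<close>

primrec bernstein :: "int \<Rightarrow> int \<Rightarrow> int \<Rightarrow> int list \<Rightarrow> int list \<times> int list" where
  "bernstein lo hi d [] = ([], [1])"
| "bernstein lo hi d (x # xs) = (let (R, B) = bernstein lo hi d xs in (ladd (lmult lo hi R) (lscale x B), lmult d d B))"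

lemma bernstein:
  assumes "u + v = 1" "bernstein lo hi d xs = (R, B)" "real_of_int d * t = real_of_int lo * v + real_of_int hi * u"
  shows "real_of_int d * homog R u v = real_of_int d ^ length xs * horner xs t \<and> homog B u v = real_of_int d ^ length xs \<and>
    length B = Suc (length xs) \<and> length R = length xs"
  using assms(2)
proof (induction xs arbitrary: R B)
  case (Cons x xs)
  obtain R' B' where RB: "bernstein lo hi d xs = (R', B')" by force
  from Cons.IH[OF this]
  have IH: "real_of_int d * homog R' u v = real_of_int d ^ length xs * horner xs t" "homog B' u v = real_of_int d ^ length xs"
      "length B' = Suc (length xs)" "length R' = length xs" by auto
  have R: "R = ladd (lmult lo hi R') (lscale x B')" and B: "B = lmult d d B'"
    using Cons.prems RB by auto
  have "homog R u v = real_of_int d * t * homog R' u v + real_of_int x * real_of_int d ^ length xs"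
    using IH by (simp add: R homog_ladd homog_lscale homog_ladd_mult assms(3))
  also have "real_of_int d * t * homog R' u v = t * (real_of_int d ^ length xs * horner xs t)"
    using IH(1) by (simp add: algebra_simps)
  finally have "real_of_int d * homog R u v = real_of_int d ^ length (x # xs) * horner (x # xs) t"
    by (simp add: algebra_simps)
  moreover have "homog B u v = real_of_int d * (u + v) * homog B' u v"
    by (simp add: B homog_ladd_mult algebra_simps)
  ultimately show ?case using assms(1) IH by (simp add: R B)
qed simp

lemma homog_pos:
  assumes "\<forall>x\<in>set xs. 0 < x" "xs \<noteq> []" "0 \<le> u" "0 \<le> v" "u + v = 1"
  shows "0 < homog xs u v"
  using assms(1,2)
proof (induction xs)
  case (Cons x xs)
  then have x: "0 < real_of_int x" by simp
  show ?case
  proof (cases "xs = []")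
    case False
    then have IH: "0 < homog xs u v" using Cons by simp
    show ?thesis
    proof (cases "u = 0")
      case True
      then show ?thesis using x assms by simp
    next
      case False
      then have "0 < u * homog xs u v" using IH assms by simp
      moreover have "0 \<le> real_of_int x * v ^ length xs" using x assms by simp
      ultimately show ?thesis by simp
    qed
  qed (use x in simp)
qed simp

text \<open>The list holds break points in units of 1 / d. On each piece all scaled Bernstein
  coefficients must be positive; subdividing makes this sufficient test sharp enough.\<close>

fun lpos :: "int \<Rightarrow> int list \<Rightarrow> int list \<Rightarrow> bool" where
  "lpos d (lo # hi # bs) xs \<longleftrightarrow> lo < hi \<and> list_all (\<lambda>x. 0 < x) (fst (bernstein lo hi d xs)) \<and> (bs = [] \<or> lpos d (hi # bs) xs)"
| "lpos d _ xs \<longleftrightarrow> False"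

lemma lpos:
  assumes "lpos d bs xs" "0 < d" "xs \<noteq> []" "real_of_int (hd bs) / d \<le> t" "t \<le> real_of_int (last bs) / d"
  shows "0 < horner xs t"
  using assms
proof (induction d bs xs rule: lpos.induct)
  case (1 d lo hi bs xs)
  show ?case
  proof (cases "d * t \<le> hi")
    case True
    define h where "h = real_of_int hi - lo"
    define u where "u = (d * t - lo) / h"
    have h: "0 < h" and lo: "lo \<le> d * t" using 1 by (auto simp: h_def field_simps)
    have hu: "h * u = d * t - lo" using h by (simp add: u_def)
    have uv: "0 \<le> u" "0 \<le> 1 - u" using h lo True by (auto simp: u_def h_def field_simps)
    have t: "d * t = lo * (1 - u) + hi * u" using hu by (simp add: h_def algebra_simps)
    obtain R B where RB: "bernstein lo hi d xs = (R, B)" by force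
    note R = bernstein[OF _ RB t, simplified]
    have "R \<noteq> []" using R 1 by auto
    then have "0 < homog R u (1 - u)" using 1(2) RB uv by (intro homog_pos) (auto simp: list_all_iff)
    then have "0 < real_of_int d ^ length xs * horner xs t" using R 1(3) by (metis mult_pos_pos of_int_0_less_iff)
    then show ?thesis using 1(3) by (simp add: zero_less_mult_iff)
  next
    case False
    then have "bs \<noteq> []" using 1 by (auto simp: field_simps)
    then show ?thesis using 1 False by (auto simp: field_simps)
  qed
qed auto

text \<open>The exact integer value of the polynomial at \<open>s\<close>. It is used at 1 and -1,
  the images of the interval ends.\<close>

primrec lsign_sum :: "int \<Rightarrow> int list \<Rightarrow> int" where
  "lsign_sum s [] = 0"
| "lsign_sum s (x # xs) = x + s * lsign_sum s xs"

lemma horner_of_int: "horner xs (real_of_int s) = real_of_int (lsign_sum s xs)"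
  by (induction xs) auto

section \<open>Certificates for the barrier inequalities\<close>

text \<open>The residual of a barrier in the coordinate t with r = (I + J t) / D, multiplied by 2
  J^2 D^2 so that the coefficients stay integral. The next two definitions treat the other residuals
  in the same way.\<close>

definition adjoint_res :: "int \<Rightarrow> int \<Rightarrow> int \<Rightarrow> int \<Rightarrow> int list \<Rightarrow> int list" where
  "adjoint_res n I J D P = (let P1 = lderiv P; P2 = lderiv P1; e = 2 * D * D in
     ladd (lscale e (lmult I J (lmult I J P2)))
      (ladd (lscale (- J) (lmult I J (ladd (lscale (e * (n - 1)) P1) (lscale (- 1) (lmult I J (lmult I J P1))))))
        (lscale (J * J) (ladd (lscale 2 (lmult I J (lmult I J P))) (lscale (e * (n - 1)) P)))))"

definition profile_res :: "int \<Rightarrow> int \<Rightarrow> int \<Rightarrow> int \<Rightarrow> int list \<Rightarrow> int list" where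
  "profile_res n I J D P = (let P1 = lderiv P; P2 = lderiv P1; e = 2 * D * D in
     ladd (lscale e (lmult I J P2))
      (ladd (lscale J (ladd (lscale (e * (n - 1)) P1) (lscale (- 1) (lmult I J (lmult I J P1)))))
        (lscale (J * J) (lmult I J P))))"

definition moment_res :: "int \<Rightarrow> int \<Rightarrow> int \<Rightarrow> int \<Rightarrow> int \<Rightarrow> int list \<Rightarrow> int list" where
  "moment_res n I J D m P = (let e = 2 * D * D in
     ladd (lscale e (lmult I J (lderiv P)))
      (lscale J (ladd (ladd (lscale (e * (n + 4)) P) (lscale (- 1) (lmult I J (lmult I J P))))
        (lscale m (ladd [e * (n + 2)] (lscale (- 1) (lmult I J (lmult I J [1]))))))))"

definition lpos_on :: "int \<Rightarrow> int \<Rightarrow> int \<Rightarrow> int list \<Rightarrow> int list \<Rightarrow> bool" where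
  "lpos_on lo hi d bs xs \<longleftrightarrow> 0 < d \<and> xs \<noteq> [] \<and> hd bs = lo \<and> last bs = hi \<and> lpos d bs xs"

lemma lpos_on:
  assumes "lpos_on lo hi d bs xs" "lo / d \<le> t" "t \<le> hi / d"
  shows "0 < horner xs t"
  using assms lpos[of d bs xs t] by (simp add: lpos_on_def)

lemma neg_of_mult_neg: "c * x < 0 \<Longrightarrow> 0 < c \<Longrightarrow> x < 0" for c x :: real
  by (simp add: mult_less_0_iff)

lemma of_int_quotient_nonneg: "0 \<le> x \<Longrightarrow> 0 < y \<Longrightarrow> 0 \<le> real_of_int x / real_of_int y"
  by simp

text \<open>The rational interval with ends (I - J) / D and (I + J) / D is mapped to
  [-1, 1].\<close>

locale rescaled =
  fixes I J D :: int
  assumes J0: "0 < J" and D0: "0 < D"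
begin

definition coord :: "real \<Rightarrow> real" where
  "coord r = (real_of_int D * r - real_of_int I) / real_of_int J"

lemma coord_deriv: "(coord has_real_derivative D / J) (at r)"
  unfolding coord_def using J0 by (auto intro!: derivative_eq_intros)

lemma radius_coord: "real_of_int D * r = real_of_int I + real_of_int J * coord r"
  using J0 by (simp add: coord_def field_simps)

lemma coord_ge: "0 < d \<Longrightarrow> (d * I + J * k) / (d * D) \<le> r \<Longrightarrow> k / d \<le> coord r" for d k :: int
  using J0 D0 by (simp add: coord_def field_simps)

lemma coord_le: "0 < d \<Longrightarrow> r \<le> (d * I + J * k) / (d * D) \<Longrightarrow> coord r \<le> k / d" for d k :: int
  using J0 D0 by (simp add: coord_def field_simps)

lemma coord_ends: "coord ((I - J) / D) = - 1" "coord ((I + J) / D) = 1"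
  using J0 D0 by (simp_all add: coord_def field_simps)

lemma coord_bounds: "(I - J) / D \<le> r \<Longrightarrow> - 1 \<le> coord r" "r \<le> (I + J) / D \<Longrightarrow> coord r \<le> 1"
  using J0 D0 by (simp_all add: coord_def field_simps)

definition poly0 :: "int list \<Rightarrow> real \<Rightarrow> real" where "poly0 P r = horner P (coord r)"
definition poly1 :: "int list \<Rightarrow> real \<Rightarrow> real" where "poly1 P r = D / J * horner (lderiv P) (coord r)"
definition poly2 :: "int list \<Rightarrow> real \<Rightarrow> real" where "poly2 P r = (D / J)\<^sup>2 * horner (lderiv (lderiv P)) (coord r)"

lemma poly1_nonpos: "horner (lderiv P) (coord r) \<le> 0 \<Longrightarrow> poly1 P r \<le> 0"
  unfolding poly1_def using J0 D0 by (intro mult_nonneg_nonpos) auto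

lemma poly1_nonneg: "0 \<le> horner (lderiv P) (coord r) \<Longrightarrow> 0 \<le> poly1 P r"
  unfolding poly1_def using J0 D0 by (intro mult_nonneg_nonneg) auto

lemma poly0_deriv: "(poly0 P has_real_derivative poly1 P r) (at r)"
  unfolding poly0_def poly1_def
  by (rule DERIV_cong[OF DERIV_chain2[OF horner_deriv coord_deriv]]) simp

lemma poly1_deriv: "(poly1 P has_real_derivative poly2 P r) (at r)"
  unfolding poly1_def poly2_def
  by (rule DERIV_cong[OF DERIV_cmult[OF DERIV_chain2[OF horner_deriv coord_deriv]]]) (simp add: power2_eq_square)

end

text \<open>The hypotheses of \<open>outer_radius_ge\<close> over the integers: \<open>M\<close> is
  the separating level, and the rational coordinates t1 / d1 and t2 / d2 mark radii just beyond and
  just before sqrt(2n), or equal to it.\<close>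

definition outer_ge_cert where
  "outer_ge_cert n I J D P M d0 bs0 d1 t1 bs1 d2 t2 bs2 \<longleftrightarrow>
    0 < J \<and> 0 < D \<and> J < I \<and> lsign_sum (- 1) P \<le> 0 \<and> lsign_sum (- 1) (lderiv P) \<le> 0 \<and>
    lpos_on (- d0) d0 d0 bs0 (lscale (- 1) (adjoint_res (n) I J D P)) \<and>
    lpos_on (- d1) t1 d1 bs1 (ladd [M] P) \<and> lpos_on t2 d2 d2 bs2 (ladd [- M] P) \<and>
    0 \<le> d1 * I + J * t1 \<and> 2 * n * (d1 * D)\<^sup>2 \<le> (d1 * I + J * t1)\<^sup>2 \<and>
    - d2 \<le> t2 \<and> (d2 * I + J * t2)\<^sup>2 \<le> 2 * n * (d2 * D)\<^sup>2"

definition outer_le_cert where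
  "outer_le_cert n I J D P d0 bs0 d1 t1 bs1 \<longleftrightarrow>
    0 < J \<and> 0 < D \<and> J < I \<and> 0 \<le> lsign_sum 1 P \<and> lsign_sum 1 (lderiv P) \<le> 0 \<and>
    lpos_on (- d0) d0 d0 bs0 (adjoint_res (n) I J D P) \<and>
    lpos_on (- d1) t1 d1 bs1 (lscale (- 1) (ladd [lsign_sum 1 P] P)) \<and>
    0 \<le> d1 * I + J * t1 \<and> 2 * n * (d1 * D)\<^sup>2 \<le> (d1 * I + J * t1)\<^sup>2 \<and> 2 * n * D\<^sup>2 \<le> (I + J)\<^sup>2"

definition inner_ge_cert where
  "inner_ge_cert n I J D P d0 bs0 \<longleftrightarrow>
    0 < J \<and> 0 < D \<and> J < I \<and> lsign_sum (- 1) P = 0 \<and> lsign_sum 1 P = 0 \<and>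
    0 \<le> lsign_sum (- 1) (lderiv P) \<and> lsign_sum 1 (lderiv P) \<le> 0 \<and>
    lpos_on (- d0) d0 d0 bs0 (profile_res (n) I J D P)"

text \<open>The barrier in \<open>degree3_condition\<close> is the polynomial divided by
  \<open>m\<close>, so \<open>m\<close> is the common denominator of its coefficients.\<close>

definition moment_cert where
  "moment_cert n I J D P m d0 bs0 \<longleftrightarrow>
    0 < J \<and> 0 < D \<and> J < I \<and> 0 < m \<and> lsign_sum (- 1) P \<le> 0 \<and> 0 \<le> lsign_sum 1 P \<and>
    (2 * n + 4) * D\<^sup>2 \<le> (I + J)\<^sup>2 \<and>
    lpos_on (- d0) d0 d0 bs0 (lscale (- 1) (moment_res (n) I J D m P))"

context annulus
begin

lemma adjoint_res:
  assumes "rescaled J D"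
  shows "horner (adjoint_res (int n) I J D P) (rescaled.coord I J D r) =
    2 * (real_of_int J)\<^sup>2 * (real_of_int D)\<^sup>2 *
      adjoint_op (rescaled.poly0 I J D P) (rescaled.poly1 I J D P) (rescaled.poly2 I J D P) r"
proof -
  interpret rescaled I J D by fact
  define t where "t = coord r"
  have r: "r = (I + J * t) / D" using radius_coord[of r] D0 by (simp add: t_def field_simps)
  show ?thesis unfolding adjoint_op_def poly0_def poly1_def poly2_def t_def[symmetric] adjoint_res_def Let_def
    unfolding r using J0 D0 by (simp add: field_simps power2_eq_square)
qed

lemma profile_res:
  assumes "rescaled J D"
  shows "horner (profile_res (int n) I J D P) (rescaled.coord I J D r) =
    2 * (real_of_int J)\<^sup>2 * real_of_int D *
      profile_op (rescaled.poly0 I J D P) (rescaled.poly1 I J D P) (rescaled.poly2 I J D P) r"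
proof -
  interpret rescaled I J D by fact
  define t where "t = coord r"
  have r: "r = (I + J * t) / D" using radius_coord[of r] D0 by (simp add: t_def field_simps)
  show ?thesis unfolding profile_op_def poly0_def poly1_def poly2_def t_def[symmetric] profile_res_def Let_def
    unfolding r using J0 D0 by (simp add: field_simps power2_eq_square)
qed

lemma moment_res:
  assumes "rescaled J D" "0 < m"
  shows "horner (moment_res (int n) I J D m P) (rescaled.coord I J D r) =
    2 * real_of_int J * (real_of_int D)\<^sup>2 * m *
      (r * (rescaled.poly1 I J D P r / m) + (real n + 4 - r\<^sup>2 / 2) * (rescaled.poly0 I J D P r / m) + (real n + 2 - r\<^sup>2 / 2))"
proof -
  interpret rescaled I J D by fact
  define t where "t = coord r"
  have r: "r = (I + J * t) / D" using radius_coord[of r] D0 by (simp add: t_def field_simps)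
  show ?thesis unfolding poly0_def poly1_def t_def[symmetric] moment_res_def Let_def
    unfolding r using J0 D0 assms(2) by (simp add: field_simps power2_eq_square)
qed

lemma of_int_quotient_square:
  fixes x y :: int
  assumes "0 < y"
  shows "2 * int n * y\<^sup>2 \<le> x\<^sup>2 \<Longrightarrow> 2 * real n \<le> (real_of_int x / real_of_int y)\<^sup>2"
    "x\<^sup>2 \<le> 2 * int n * y\<^sup>2 \<Longrightarrow> (real_of_int x / real_of_int y)\<^sup>2 \<le> 2 * real n"
proof -
  have y: "0 < (real_of_int y)\<^sup>2" using assms by simp
  show "2 * int n * y\<^sup>2 \<le> x\<^sup>2 \<Longrightarrow> 2 * real n \<le> (real_of_int x / real_of_int y)\<^sup>2"
    using y of_int_le_iff[of "2 * int n * y\<^sup>2" "x\<^sup>2", where 'a = real] by (simp add: power_divide pos_le_divide_eq)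
  show "x\<^sup>2 \<le> 2 * int n * y\<^sup>2 \<Longrightarrow> (real_of_int x / real_of_int y)\<^sup>2 \<le> 2 * real n"
    using y of_int_le_iff[of "x\<^sup>2" "2 * int n * y\<^sup>2", where 'a = real] by (simp add: power_divide pos_divide_le_eq)
qed

lemma outer_ge_cert:
  assumes "outer_ge_cert (int n) I J D P M d0 bs0 d1 t1 bs1 d2 t2 bs2"
  shows "real_of_int (I + J) / D \<le> b"
proof -
  have c: "0 < J" "0 < D" "J < I" "lsign_sum (- 1) P \<le> 0" "lsign_sum (- 1) (lderiv P) \<le> 0"
    "lpos_on (- d0) d0 d0 bs0 (lscale (- 1) (adjoint_res (int n) I J D P))"
    "lpos_on (- d1) t1 d1 bs1 (ladd [M] P)" "lpos_on t2 d2 d2 bs2 (ladd [- M] P)"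
    "0 \<le> d1 * I + J * t1" "2 * int n * (d1 * D)\<^sup>2 \<le> (d1 * I + J * t1)\<^sup>2"
    "- d2 \<le> t2" "(d2 * I + J * t2)\<^sup>2 \<le> 2 * int n * (d2 * D)\<^sup>2"
    using assms unfolding outer_ge_cert_def by blast+
  then have d: "0 < d0" "0 < d1" "0 < d2" by (simp_all add: lpos_on_def)
  interpret rescaled I J D by unfold_locales fact+
  show ?thesis
  proof (rule outer_radius_ge[OF poly0_deriv[of P] poly1_deriv[of P]])
    show "0 < real_of_int (I - J) / D" using c by simp
    have "- 1 \<le> real_of_int t2 / d2" using c d by (simp add: field_simps)
    then have "real_of_int J * (- 1) \<le> J * (real_of_int t2 / d2)" using c by (intro mult_left_mono) auto
    then have "real_of_int (I - J) / D \<le> (I + J * (real_of_int t2 / d2)) / D"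
      using c by (intro divide_right_mono) auto
    also have "\<dots> = real_of_int (d2 * I + J * t2) / (d2 * D)" using c d by (simp add: field_simps)
    finally show "real_of_int (I - J) / D \<le> real_of_int (d2 * I + J * t2) / (d2 * D)" .
    show "(real_of_int (d2 * I + J * t2) / (d2 * D))\<^sup>2 \<le> 2 * real n"
      using of_int_quotient_square(2)[OF _ c(12)] c d by simp
    show "0 \<le> real_of_int (d1 * I + J * t1) / (d1 * D)"
      by (rule of_int_quotient_nonneg) (use c d in auto)
    show "2 * real n \<le> (real_of_int (d1 * I + J * t1) / (d1 * D))\<^sup>2"
      using of_int_quotient_square(1)[OF _ c(10)] c d by simp
    fix r
    show "adjoint_op (poly0 P) (poly1 P) (poly2 P) r \<le> 0" if "real_of_int (I - J) / D \<le> r" "r \<le> real_of_int (I + J) / D"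
    proof -
      have "0 < horner (lscale (- 1) (adjoint_res (int n) I J D P)) (coord r)"
        by (rule lpos_on[OF c(6)]) (use that coord_bounds[of r] d in auto)
      then have "2 * (real_of_int J)\<^sup>2 * (real_of_int D)\<^sup>2 * adjoint_op (poly0 P) (poly1 P) (poly2 P) r < 0"
        using adjoint_res[OF rescaled_axioms] by simp
      moreover have "0 < 2 * (real_of_int J)\<^sup>2 * (real_of_int D)\<^sup>2" using c by simp
      ultimately show ?thesis using neg_of_mult_neg less_imp_le by blast
    qed
    show "- real_of_int M \<le> poly0 P r" if "real_of_int (I - J) / D \<le> r" "r \<le> real_of_int (d1 * I + J * t1) / (d1 * D)"
    proof -
      have "0 < horner (ladd [M] P) (coord r)"
        by (rule lpos_on[OF c(7)]) (use that coord_bounds[of r] coord_le[of d1 r t1] d in auto)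
      then show ?thesis by (simp add: poly0_def)
    qed
    show "real_of_int M < poly0 P r" if "real_of_int (d2 * I + J * t2) / (d2 * D) \<le> r" "r \<le> real_of_int (I + J) / D"
    proof -
      have "0 < horner (ladd [- M] P) (coord r)"
        by (rule lpos_on[OF c(8)]) (use that coord_bounds[of r] coord_ge[of d2 t2 r] d in auto)
      then show ?thesis by (simp add: poly0_def)
    qed
  next
    have "poly0 P (real_of_int (I - J) / D) = lsign_sum (- 1) P" "horner (lderiv P) (- 1) = lsign_sum (- 1) (lderiv P)"
      using coord_ends horner_of_int[of _ "- 1"] by (simp_all add: poly0_def)
    then show "poly0 P (real_of_int (I - J) / D) \<le> 0" "poly1 P (real_of_int (I - J) / D) \<le> 0"
      using c coord_ends by (auto intro: poly1_nonpos poly1_nonneg)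
  qed
qed

lemma outer_le_cert:
  assumes "outer_le_cert (int n) I J D P d0 bs0 d1 t1 bs1" "real_of_int (I - J) / D \<le> a"
  shows "b \<le> real_of_int (I + J) / D"
proof -
  have c: "0 < J" "0 < D" "J < I" "0 \<le> lsign_sum 1 P" "lsign_sum 1 (lderiv P) \<le> 0"
    "lpos_on (- d0) d0 d0 bs0 (adjoint_res (int n) I J D P)"
    "lpos_on (- d1) t1 d1 bs1 (lscale (- 1) (ladd [lsign_sum 1 P] P))"
    "0 \<le> d1 * I + J * t1" "2 * int n * (d1 * D)\<^sup>2 \<le> (d1 * I + J * t1)\<^sup>2" "2 * int n * D\<^sup>2 \<le> (I + J)\<^sup>2"
    using assms unfolding outer_le_cert_def by blast+
  then have d: "0 < d0" "0 < d1" by (simp_all add: lpos_on_def)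
  interpret rescaled I J D by unfold_locales fact+
  have P1: "poly0 P (real_of_int (I + J) / D) = lsign_sum 1 P" "horner (lderiv P) 1 = lsign_sum 1 (lderiv P)"
    using coord_ends horner_of_int[of _ 1] by (simp_all add: poly0_def)
  show ?thesis
  proof (rule outer_radius_le[OF poly0_deriv[of P] poly1_deriv[of P] assms(2)])
    show "0 \<le> real_of_int (d1 * I + J * t1) / (d1 * D)"
      by (rule of_int_quotient_nonneg) (use c d in auto)
    show "2 * real n \<le> (real_of_int (d1 * I + J * t1) / (d1 * D))\<^sup>2"
      using of_int_quotient_square(1)[OF _ c(9)] c d by simp
    have "a\<^sup>2 < (real_of_int (I + J) / D)\<^sup>2"
      using of_int_quotient_square(1)[OF c(2) c(10)] ends_2n by simp
    then show "a < real_of_int (I + J) / D" by (rule power2_less_imp_less) (use c in simp)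
    show "0 \<le> poly0 P (real_of_int (I + J) / D)" "poly1 P (real_of_int (I + J) / D) \<le> 0"
      using c coord_ends P1 by (auto intro: poly1_nonpos poly1_nonneg)
    fix r
    show "0 \<le> adjoint_op (poly0 P) (poly1 P) (poly2 P) r" if "real_of_int (I - J) / D \<le> r" "r \<le> real_of_int (I + J) / D"
    proof -
      have "0 < horner (adjoint_res (int n) I J D P) (coord r)"
        by (rule lpos_on[OF c(6)]) (use that coord_bounds[of r] d in auto)
      then have "0 < 2 * (real_of_int J)\<^sup>2 * (real_of_int D)\<^sup>2 * adjoint_op (poly0 P) (poly1 P) (poly2 P) r"
        using adjoint_res[OF rescaled_axioms] by simp
      moreover have "0 < 2 * (real_of_int J)\<^sup>2 * (real_of_int D)\<^sup>2" using c by simp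
      ultimately show ?thesis using zero_less_mult_pos less_imp_le by blast
    qed
    show "poly0 P r < - poly0 P (real_of_int (I + J) / D)" if "real_of_int (I - J) / D \<le> r" "r \<le> real_of_int (d1 * I + J * t1) / (d1 * D)"
    proof -
      have "0 < horner (lscale (- 1) (ladd [lsign_sum 1 P] P)) (coord r)"
        by (rule lpos_on[OF c(7)]) (use that coord_bounds[of r] coord_le[of d1 r t1] d in auto)
      then show ?thesis unfolding P1 by (simp add: poly0_def)
    qed
  qed
qed

lemma inner_ge_cert:
  assumes "inner_ge_cert (int n) I J D P d0 bs0" "real_of_int (I + J) / D \<le> b"
  shows "real_of_int (I - J) / D \<le> a"
proof -
  have c: "0 < J" "0 < D" "J < I" "lsign_sum (- 1) P = 0" "lsign_sum 1 P = 0"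
    "0 \<le> lsign_sum (- 1) (lderiv P)" "lsign_sum 1 (lderiv P) \<le> 0"
    "lpos_on (- d0) d0 d0 bs0 (profile_res (int n) I J D P)"
    using assms unfolding inner_ge_cert_def by blast+
  then have d: "0 < d0" by (simp add: lpos_on_def)
  interpret rescaled I J D by unfold_locales fact+
  have P1: "poly0 P (real_of_int (I + J) / D) = lsign_sum 1 P" "horner (lderiv P) 1 = lsign_sum 1 (lderiv P)"
    "poly0 P (real_of_int (I - J) / D) = lsign_sum (- 1) P" "horner (lderiv P) (- 1) = lsign_sum (- 1) (lderiv P)"
    using coord_ends horner_of_int[of _ 1] horner_of_int[of _ "- 1"] by (simp_all add: poly0_def)
  show ?thesis
  proof (rule inner_radius_ge[OF poly0_deriv[of P] poly1_deriv[of P] _ assms(2)])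
    show "real_of_int (I - J) / D < real_of_int (I + J) / D" using c by (simp add: divide_strict_right_mono)
    show "poly0 P (real_of_int (I - J) / D) = 0" "poly0 P (real_of_int (I + J) / D) = 0"
      "0 \<le> poly1 P (real_of_int (I - J) / D)" "poly1 P (real_of_int (I + J) / D) \<le> 0"
      using c coord_ends P1 by (auto intro: poly1_nonpos poly1_nonneg)
    fix r
    assume r: "real_of_int (I - J) / D \<le> r" "r \<le> real_of_int (I + J) / D"
    have "0 < horner (profile_res (int n) I J D P) (coord r)"
      by (rule lpos_on[OF c(8)]) (use r coord_bounds[of r] d in auto)
    then have "0 < 2 * (real_of_int J)\<^sup>2 * real_of_int D * profile_op (poly0 P) (poly1 P) (poly2 P) r"
      using profile_res[OF rescaled_axioms] by simp
    moreover have "0 < 2 * (real_of_int J)\<^sup>2 * real_of_int D" using c by simp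
    ultimately show "0 < profile_op (poly0 P) (poly1 P) (poly2 P) r" using zero_less_mult_pos by blast
  qed
qed

lemma moment_cert:
  assumes "moment_cert (int n) I J D P m d0 bs0" "real_of_int (I + J) / D \<le> b" "real_of_int (I - J) / D \<le> a"
  shows "b ^ 5 * wgt n b - a ^ 5 * wgt n a < 2 * integral {a..b} (\<lambda>r. r ^ 4 * wgt n r)"
proof -
  have c: "0 < J" "0 < D" "J < I" "0 < m" "lsign_sum (- 1) P \<le> 0" "0 \<le> lsign_sum 1 P"
    "(2 * int n + 4) * D\<^sup>2 \<le> (I + J)\<^sup>2"
    "lpos_on (- d0) d0 d0 bs0 (lscale (- 1) (moment_res (int n) I J D m P))"
    using assms unfolding moment_cert_def by blast+
  then have d: "0 < d0" by (simp add: lpos_on_def)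
  interpret rescaled I J D by unfold_locales fact+
  have P1: "poly0 P (real_of_int (I + J) / D) = lsign_sum 1 P"
    "poly0 P (real_of_int (I - J) / D) = lsign_sum (- 1) P"
    using coord_ends horner_of_int[of _ 1] horner_of_int[of _ "- 1"] by (simp_all add: poly0_def)
  have d2: "2 * real n + 4 \<le> (real_of_int (I + J) / D)\<^sup>2"
    using c(2) of_int_le_iff[of "(2 * int n + 4) * D\<^sup>2" "(I + J)\<^sup>2", where 'a = real] c(7)
    by (simp add: power_divide pos_le_divide_eq)
  show ?thesis
  proof (rule degree3_condition[where \<Psi> = "\<lambda>r. poly0 P r / m" and ?\<Psi>1.0 = "\<lambda>r. poly1 P r / m", OF _ _ assms(3) _ assms(2) d2])
    show "((\<lambda>r. poly0 P r / m) has_real_derivative poly1 P r / m) (at r)" for r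
      by (rule DERIV_cdivide[OF poly0_deriv])
    show "0 < real_of_int (I - J) / D" using c by simp
    have "a\<^sup>2 < (real_of_int (I + J) / D)\<^sup>2" using d2 ends_2n by linarith
    then show "a < real_of_int (I + J) / D" by (rule power2_less_imp_less) (use c in simp)
    show "poly0 P (real_of_int (I - J) / D) / m \<le> 0" "0 \<le> poly0 P (real_of_int (I + J) / D) / m"
      using c P1 by (simp_all add: divide_nonpos_pos)
    fix r
    assume r: "real_of_int (I - J) / D \<le> r" "r \<le> real_of_int (I + J) / D"
    have "0 < horner (lscale (- 1) (moment_res (int n) I J D m P)) (coord r)"
      by (rule lpos_on[OF c(8)]) (use r coord_bounds[of r] d in auto)
    then have "2 * real_of_int J * (real_of_int D)\<^sup>2 * m * (r * (poly1 P r / m) +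
        (real n + 4 - r\<^sup>2 / 2) * (poly0 P r / m) + (real n + 2 - r\<^sup>2 / 2)) < 0"
      using moment_res[OF rescaled_axioms c(4), where P = P and r = r] by simp
    moreover have "0 < 2 * real_of_int J * (real_of_int D)\<^sup>2 * m" using c by simp
    ultimately show "r * (poly1 P r / m) + (real n + 4 - r\<^sup>2 / 2) * (poly0 P r / m) + (real n + 2 - r\<^sup>2 / 2) < 0"
      using neg_of_mult_neg by blast
  qed
qed

end

section \<open>Log-concavity and the symmetrized profile\<close>

context annulus
begin

text \<open>Log-concavity of \<open>\<phi> r / r\<close> in \<open>ln r\<close>.\<close>

lemma scaling_quotient_decreasing:
  assumes st: "a < s" "s < t" "t < b"
  shows "(t * \<phi>' t - \<phi> t) * \<phi> s < (s * \<phi>' s - \<phi> s) * \<phi> t"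
proof -
  define v where "v = (\<lambda>r. r * \<phi>' r - \<phi> r)"
  \<comment> \<open>\<open>M\<close> is - r \<phi>^2 times the derivative of v / \<phi>, so it has
    to be positive. The derivative of \<open>wgt n r * M r / r\<close> has the sign of - v, hence
    this function is smallest at the zero \<open>m\<close> of \<open>v\<close>, where its positivity
    is evident.\<close>
  define M where "M = (\<lambda>r. (v r)\<^sup>2 + (real n - r\<^sup>2 / 2) * v r * \<phi> r + (real n - 1) * (\<phi> r)\<^sup>2)"
  have dv: "(v has_real_derivative - (real n - 1 - r\<^sup>2 / 2) * \<phi>' r - r * \<phi> r / 2) (at r)" if r: "a < r" "r < b" for r
  proof -
    have r0: "r \<noteq> 0" using a0 r by auto
    show ?thesis unfolding v_def
      by (rule DERIV_cong, (rule derivative_eq_intros int_deriv[OF r] r0 refl)+)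
        (use r0 in \<open>simp add: field_simps power2_eq_square drift_def\<close>)
  qed
  have dM: "((\<lambda>r. wgt n r * M r / r) has_real_derivative - wgt n r * \<phi> r * v r) (at r)" if r: "a < r" "r < b" for r
  proof -
    have r0: "0 < r" "r \<noteq> 0" "(2::real) \<noteq> 0" using a0 r by auto
    have v': "\<phi>' r = (v r + \<phi> r) / r" using r0 by (simp add: v_def)
    show ?thesis unfolding M_def
      by (rule DERIV_cong, (rule derivative_eq_intros int_deriv[OF r] dv[OF r] wgt_deriv[OF r0(1) n1] r0 refl)+)
        (use r0 in \<open>simp add: v' field_simps power2_eq_square drift_def\<close>)
  qed
  have cv: "continuous_on {a..b} v" unfolding v_def by (intro continuous_intros cont_\<phi> cont_\<phi>')
  have cwgt: "continuous_on {a..b} (wgt n)" by (rule DERIV_continuous_on, rule wgt_deriv[OF r_pos n1])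
  have cM: "continuous_on {a..b} (\<lambda>r. wgt n r * M r / r)"
    unfolding M_def using a0 by (intro continuous_intros cv cont_\<phi> cwgt) auto
  have "\<exists>m. a \<le> m \<and> m \<le> b \<and> v m = 0"
    by (rule IVT2') (use cv ab a0 in \<open>auto simp: v_def \<phi>a \<phi>b \<phi>'a \<phi>'b\<close>)
  then obtain m where m: "a \<le> m" "m \<le> b" "v m = 0" by blast
  have "v a = a" "v b = - b" by (simp_all add: v_def \<phi>a \<phi>b \<phi>'a \<phi>'b)
  then have "m \<noteq> a" "m \<noteq> b" using m a0 ab by auto
  then have m': "a < m" "m < b" using m by auto
  have vpos: "0 < v r" if "a \<le> r" "r < m" for r
    using wgt_time_decreasing[of r m] that m m' wgt_pos'[of r] by (simp add: v_def[symmetric] zero_less_mult_iff) (auto simp: v_def zero_less_mult_iff)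
  have vneg: "v r < 0" if "m < r" "r \<le> b" for r
    using wgt_time_decreasing[of m r] that m m' wgt_pos'[of r] by (auto simp: v_def mult_less_0_iff)
  have Mm: "0 < wgt n m * M m / m"
    using m m' \<phi>pos[of m] wgt_pos'[of m] n2 a0 by (simp add: M_def)
  have Mpos: "0 < M r" if r: "a < r" "r < b" for r
  proof -
    have "wgt n m * M m / m \<le> wgt n r * M r / r"
    proof (cases "r \<le> m")
      case True
      show ?thesis
      proof (rule DERIV_nonpos_imp_decreasing_open[OF True])
        fix x assume x: "r < x" "x < m"
        then have xab: "a < x" "x < b" using r m' by auto
        have "0 \<le> wgt n x * \<phi> x * v x"
          using wgt_pos'[of x] \<phi>pos[OF xab] vpos[of x] x xab by (intro mult_nonneg_nonneg) auto
        then show "\<exists>y. ((\<lambda>r. wgt n r * M r / r) has_real_derivative y) (at x) \<and> y \<le> 0"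
          using dM[OF xab] by (intro exI conjI) (assumption, simp)
      qed (rule continuous_on_subset[OF cM], use r m' in auto)
    next
      case False
      then have mr: "m \<le> r" by simp
      show ?thesis
      proof (rule DERIV_nonneg_imp_increasing_open[OF mr])
        fix x assume x: "m < x" "x < r"
        then have xab: "a < x" "x < b" using r m' by auto
        have "wgt n x * \<phi> x * v x \<le> 0"
          using wgt_pos'[of x] \<phi>pos[OF xab] vneg[of x] x xab by (intro mult_nonneg_nonpos) auto
        then show "\<exists>y. ((\<lambda>r. wgt n r * M r / r) has_real_derivative y) (at x) \<and> 0 \<le> y"
          using dM[OF xab] by (intro exI conjI) (assumption, simp)
      qed (rule continuous_on_subset[OF cM], use r m' in auto)
    qed
    then have "0 < wgt n r * M r / r" using Mm by linarith
    then show ?thesis using r a0 wgt_pos'[of r] by (simp add: zero_less_divide_iff zero_less_mult_iff)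
  qed
  have "v t / \<phi> t < v s / \<phi> s"
  proof (rule DERIV_neg_imp_decreasing[OF st(2)])
    fix r assume r: "s \<le> r" "r \<le> t"
    then have rab: "a < r" "r < b" using st by auto
    note p = \<phi>pos[OF rab]
    have r0: "0 < r" "r \<noteq> 0" using a0 rab by auto
    have v': "\<phi>' r = (v r + \<phi> r) / r" using r0 by (simp add: v_def)
    have "((\<lambda>r. v r / \<phi> r) has_real_derivative - M r / (r * (\<phi> r)\<^sup>2)) (at r)"
      unfolding M_def
      by (rule DERIV_cong, rule DERIV_divide[OF dv[OF rab] int_deriv(1)[OF rab]])
        (use p r0 in \<open>simp_all add: v' field_simps power2_eq_square\<close>)
    moreover have "- M r / (r * (\<phi> r)\<^sup>2) < 0" using Mpos[OF rab] p r0 by (simp add: divide_neg_pos)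
    ultimately show "\<exists>y. ((\<lambda>r. v r / \<phi> r) has_real_derivative y) (at r) \<and> y < 0" by blast
  qed
  then show ?thesis using \<phi>pos[of s] \<phi>pos[of t] st by (simp add: v_def field_simps)
qed

end

text \<open>Here G x = \<phi>(\<rho>) / \<rho> with \<rho> = sqrt(a b) e^x, so that P = a b and
  \<xi> = ln(b / a) / 2. Division by \<rho> preserves the end slopes 1 and -1. The coefficient N -
  \<rho>^2 / 2 is the even function \<kappa> - Y minus the odd function P S.\<close>

locale symmetrized_profile =
  fixes N P \<xi> :: real and G G1 :: "real \<Rightarrow> real"
  assumes N1: "1 < N" and P0: "0 < P" and \<xi>0: "0 < \<xi>"
    and dG: "\<And>x. x \<in> {- \<xi>..\<xi>} \<Longrightarrow> (G has_real_derivative G1 x) (at x within {- \<xi>..\<xi>})"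
    and dG1: "\<And>x. x \<in> {- \<xi>..\<xi>} \<Longrightarrow> (G1 has_real_derivative
        - (N - P / 2 - P * (sinh x)\<^sup>2 - P * sinh x * cosh x) * G1 x - (N - 1) * G x) (at x within {- \<xi>..\<xi>})"
    and Gpos: "\<And>x. \<lbrakk>- \<xi> < x; x < \<xi>\<rbrakk> \<Longrightarrow> 0 < G x"
    and Gends: "G (- \<xi>) = 0" "G \<xi> = 0" "G1 (- \<xi>) = 1" "G1 \<xi> = - 1"
    and log_concave: "\<And>x. \<lbrakk>0 < x; x < \<xi>\<rbrakk> \<Longrightarrow> G1 x * G (- x) < G x * G1 (- x)"
begin

definition "\<kappa> = N - P / 2"
definition "Y x = P * (sinh x)\<^sup>2"
definition "S (x::real) = sinh x * cosh x"
definition "\<omega> x = exp (- (Y x) / 2)"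
definition "Ymax = Y \<xi>"

definition "Ge x = (G x + G (- x)) / 2"
definition "Go x = (G x - G (- x)) / 2"
definition "Ge1 x = (G1 x - G1 (- x)) / 2"
definition "Go1 x = (G1 x + G1 (- x)) / 2"

lemma Y_deriv: "(Y has_real_derivative 2 * P * S x) (at x)"
  unfolding Y_def S_def by (auto intro!: derivative_eq_intros)

lemma S_deriv: "(S has_real_derivative 1 + 2 * Y x / P) (at x)"
  unfolding Y_def S_def using P0
  by (auto intro!: derivative_eq_intros simp: cosh_square_eq power2_eq_square[symmetric])

lemma \<omega>_deriv: "(\<omega> has_real_derivative - P * S x * \<omega> x) (at x)"
  unfolding \<omega>_def by (auto intro!: derivative_eq_intros Y_deriv)

lemma \<omega>_pos: "0 < \<omega> x" by (simp add: \<omega>_def)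

lemma S_square: "P\<^sup>2 * (S x)\<^sup>2 = Y x * (P + Y x)"
  unfolding Y_def S_def by (simp add: power_mult_distrib cosh_square_eq, simp add: power2_eq_square algebra_simps)

lemma Y_0: "Y 0 = 0" and S_0: "S 0 = 0" by (simp_all add: Y_def S_def)

lemma Y_nonneg: "0 \<le> Y x" using P0 by (simp add: Y_def)

lemma S_pos: "0 < x \<Longrightarrow> 0 < S x"
  unfolding S_def by (intro mult_pos_pos cosh_real_pos) simp

lemma Y_strict_mono: "\<lbrakk>0 \<le> x; x < y\<rbrakk> \<Longrightarrow> Y x < Y y"
  unfolding Y_def using P0 by (intro mult_strict_left_mono power_strict_mono) auto

lemma Y_mono: "\<lbrakk>0 \<le> x; x \<le> y\<rbrakk> \<Longrightarrow> Y x \<le> Y y"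
  using Y_strict_mono[of x y] by (cases "x = y") auto

lemma int_derivs:
  assumes "0 < x" "x < \<xi>"
  shows "(G has_real_derivative G1 x) (at x)"
    "(G1 has_real_derivative - (\<kappa> - Y x - P * S x) * G1 x - (N - 1) * G x) (at x)"
    "((\<lambda>x. G (- x)) has_real_derivative - G1 (- x)) (at x)"
    "((\<lambda>x. G1 (- x)) has_real_derivative (\<kappa> - Y x + P * S x) * G1 (- x) + (N - 1) * G (- x)) (at x)"
proof -
  have i: "x \<in> interior {- \<xi>..\<xi>}" "- x \<in> interior {- \<xi>..\<xi>}" "x \<in> {- \<xi>..\<xi>}" "- x \<in> {- \<xi>..\<xi>}"
    using assms by (auto simp: interior_atLeastAtMost_real)
  show 1: "(G has_real_derivative G1 x) (at x)"
    and 2: "(G1 has_real_derivative - (\<kappa> - Y x - P * S x) * G1 x - (N - 1) * G x) (at x)"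
    using dG[OF i(3)] dG1[OF i(3)] at_within_interior[OF i(1)] by (auto simp: \<kappa>_def Y_def S_def mult.assoc)
  have 3: "(G has_real_derivative G1 (- x)) (at (- x))"
    "(G1 has_real_derivative - (\<kappa> - Y x + P * S x) * G1 (- x) - (N - 1) * G (- x)) (at (- x))"
    using dG[OF i(4)] dG1[OF i(4)] at_within_interior[OF i(2)] by (auto simp: \<kappa>_def Y_def S_def mult.assoc)
  have m: "(uminus has_real_derivative - 1) (at x)" by (auto intro!: derivative_eq_intros)
  show "((\<lambda>x. G (- x)) has_real_derivative - G1 (- x)) (at x)"
    "((\<lambda>x. G1 (- x)) has_real_derivative (\<kappa> - Y x + P * S x) * G1 (- x) + (N - 1) * G (- x)) (at x)"
    using DERIV_chain2[OF 3(1) m] DERIV_chain2[OF 3(2) m] by (simp_all add: algebra_simps)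
qed

lemma cont_G: "continuous_on {0..\<xi>} G" "continuous_on {0..\<xi>} G1"
    "continuous_on {0..\<xi>} (\<lambda>x. G (- x))" "continuous_on {0..\<xi>} (\<lambda>x. G1 (- x))"
proof -
  have c: "continuous_on {- \<xi>..\<xi>} G" "continuous_on {- \<xi>..\<xi>} G1"
    by (rule DERIV_continuous_on, erule dG) (rule DERIV_continuous_on, erule dG1)
  show "continuous_on {0..\<xi>} G" "continuous_on {0..\<xi>} G1"
    using \<xi>0 by (auto intro: continuous_on_subset[OF c(1)] continuous_on_subset[OF c(2)])
  show "continuous_on {0..\<xi>} (\<lambda>x. G (- x))" "continuous_on {0..\<xi>} (\<lambda>x. G1 (- x))"
    using \<xi>0 by (auto intro!: continuous_on_compose2[OF c(1)] continuous_on_compose2[OF c(2)] continuous_intros)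
qed

lemma parity_derivs:
  assumes "0 < x" "x < \<xi>"
  shows "(Ge has_real_derivative Ge1 x) (at x)" "(Go has_real_derivative Go1 x) (at x)"
    "(Ge1 has_real_derivative P * S x * Ge1 x - (\<kappa> - Y x) * Go1 x - (N - 1) * Ge x) (at x)"
    "(Go1 has_real_derivative P * S x * Go1 x - (\<kappa> - Y x) * Ge1 x - (N - 1) * Go x) (at x)"
  unfolding Ge_def Go_def Ge1_def Go1_def
  by (rule DERIV_cong, (rule DERIV_cdivide DERIV_add DERIV_diff int_derivs[OF assms])+, simp add: field_simps)+

lemma cont_parity: "continuous_on {0..\<xi>} Ge" "continuous_on {0..\<xi>} Go" "continuous_on {0..\<xi>} Ge1" "continuous_on {0..\<xi>} Go1"
  unfolding Ge_def Go_def Ge1_def Go1_def by (intro continuous_intros cont_G; simp)+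

lemma cont_Y: "continuous_on A Y" "continuous_on A S" "continuous_on A \<omega>"
  by (rule DERIV_everywhere_continuous_on, rule Y_deriv S_deriv \<omega>_deriv)+

lemma parity_ends: "Ge \<xi> = 0" "Go \<xi> = 0" "Ge1 \<xi> = - 1" "Go1 \<xi> = 0" "Go 0 = 0" "Ge1 0 = 0"
  by (simp_all add: Ge_def Go_def Ge1_def Go1_def Gends)

lemma Ge_pos: "\<lbrakk>0 < x; x < \<xi>\<rbrakk> \<Longrightarrow> 0 < Ge x"
  using Gpos[of x] Gpos[of "- x"] by (simp add: Ge_def)

text \<open>The Wronskian \<open>w\<close> of \<open>G x\<close> and \<open>G (- x)\<close> changes sign at most once, from negative to positive, while
  both the quotient \<open>G x / G (- x)\<close> and its limit at \<open>\<xi>\<close> start and end at \<open>1\<close>.\<close>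

definition "w x = G1 x * G (- x) + G x * G1 (- x)"

lemma w_deriv:
  assumes "0 < x" "x < \<xi>"
  shows "((\<lambda>x. \<omega> x * w x) has_real_derivative (\<kappa> - Y x) * (\<omega> x * (G x * G1 (- x) - G1 x * G (- x)))) (at x)"
  unfolding w_def
  by (rule DERIV_cong, (rule derivative_eq_intros \<omega>_deriv int_derivs[OF assms] refl)+) (simp add: algebra_simps)

lemma cont_w: "continuous_on {0..\<xi>} (\<lambda>x. \<omega> x * w x)"
  unfolding w_def by (intro continuous_intros cont_G cont_Y)

lemma quotient_deriv:
  assumes "0 < x" "x < \<xi>"
  shows "((\<lambda>x. G x / G (- x)) has_real_derivative w x / (G (- x))\<^sup>2) (at x)"
proof -
  have g: "G (- x) \<noteq> 0" using Gpos[of "- x"] assms by simp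
  show ?thesis
    by (rule DERIV_cong, rule DERIV_divide[OF int_derivs(1,3)[OF assms] g])
      (simp add: w_def power2_eq_square algebra_simps)
qed

lemma w_end: "w \<xi> = 0" by (simp add: w_def Gends)

text \<open>Both G x and G (- x) leave 0 at \<xi> with the same slope, so their quotient tends to 1.
  The product form avoids the limit: it vanishes at \<xi> and has derivative (c - 1)^2 > 0
  there.\<close>

lemma quotient_near_end:
  assumes "c \<noteq> 1" "y < \<xi>"
  shows "\<exists>x. max 0 y < x \<and> x < \<xi> \<and> (c - 1) * (G x - c * G (- x)) < 0"
proof -
  define f where "f = (\<lambda>x. (c - 1) * (G x - c * G (- x)))"
  have "(G has_real_derivative G1 (- \<xi>)) (at (- \<xi>) within uminus ` {0..\<xi>})"
    by (rule DERIV_subset[OF dG]) (use \<xi>0 in auto)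
  moreover have "(uminus has_real_derivative - 1) (at \<xi> within {0..\<xi>})" by (auto intro!: derivative_eq_intros)
  ultimately have "(G \<circ> uminus has_real_derivative G1 (- \<xi>) * - 1) (at \<xi> within {0..\<xi>})"
    by (rule DERIV_image_chain)
  then have B: "((\<lambda>x. G (- x)) has_real_derivative - 1) (at \<xi> within {0..\<xi>})"
    by (simp add: o_def Gends)
  have A: "(G has_real_derivative - 1) (at \<xi> within {0..\<xi>})"
    using DERIV_subset[OF dG[of \<xi>], of "{0..\<xi>}"] \<xi>0 by (simp add: Gends)
  have "(f has_real_derivative (c - 1) * (c - 1)) (at \<xi> within {0..\<xi>})"
    unfolding f_def by (rule DERIV_cong, (rule derivative_eq_intros A B refl)+) simp
  moreover have "0 < (c - 1) * (c - 1)" using assms(1) by (simp add: zero_less_mult_iff) linarith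
  ultimately obtain d where d: "0 < d" "\<And>h. \<lbrakk>0 < h; \<xi> - h \<in> {0..\<xi>}; h < d\<rbrakk> \<Longrightarrow> f (\<xi> - h) < f \<xi>"
    using has_real_derivative_pos_inc_left by blast
  define h where "h = min (d / 2) (min (\<xi> / 2) ((\<xi> - y) / 2))"
  have "0 < h" "h < d" "h < \<xi>" "h < \<xi> - y" using d(1) \<xi>0 assms(2) by (auto simp: h_def min_def field_simps)
  moreover have "f \<xi> = 0" by (simp add: f_def Gends)
  ultimately show ?thesis using d(2)[of h] by (intro exI[of _ "\<xi> - h"]) (auto simp: f_def)
qed

lemma \<omega>w_strict:
  assumes st: "0 \<le> s" "s < t" "t \<le> \<xi>"
  shows "(\<And>x. s < x \<Longrightarrow> x < t \<Longrightarrow> Y x < \<kappa>) \<Longrightarrow> \<omega> s * w s < \<omega> t * w t"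
    "(\<And>x. s < x \<Longrightarrow> x < t \<Longrightarrow> \<kappa> < Y x) \<Longrightarrow> \<omega> t * w t < \<omega> s * w s"
proof -
  have c: "continuous_on {s..t} (\<lambda>x. \<omega> x * w x)" using st by (intro continuous_on_subset[OF cont_w]) auto
  have p: "0 < \<omega> x * (G x * G1 (- x) - G1 x * G (- x))" if "s < x" "x < t" for x
    using log_concave[of x] st that \<omega>_pos[of x] by (intro mult_pos_pos) auto
  show "\<omega> s * w s < \<omega> t * w t" if Yk: "\<And>x. s < x \<Longrightarrow> x < t \<Longrightarrow> Y x < \<kappa>"
  proof (rule DERIV_pos_imp_increasing_open[OF st(2) _ c])
    fix x assume x: "s < x" "x < t"
    have "0 < \<kappa> - Y x" using Yk[OF x] by simp
    from mult_pos_pos[OF this p[OF x]] show "\<exists>y. ((\<lambda>x. \<omega> x * w x) has_real_derivative y) (at x) \<and> 0 < y"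
      using w_deriv[of x] st x by (intro exI conjI) auto
  qed
  show "\<omega> t * w t < \<omega> s * w s" if Yk: "\<And>x. s < x \<Longrightarrow> x < t \<Longrightarrow> \<kappa> < Y x"
  proof (rule DERIV_neg_imp_decreasing_open[OF st(2) _ c])
    fix x assume x: "s < x" "x < t"
    have "\<kappa> - Y x < 0" using Yk[OF x] by simp
    from mult_neg_pos[OF this p[OF x]] show "\<exists>y. ((\<lambda>x. \<omega> x * w x) has_real_derivative y) (at x) \<and> y < 0"
      using w_deriv[of x] st x by (intro exI conjI) auto
  qed
qed

lemma quotient_continuous: "\<lbrakk>0 \<le> s; t < \<xi>\<rbrakk> \<Longrightarrow> continuous_on {s..t} (\<lambda>x. G x / G (- x))"
proof (intro continuous_intros ballI)
  assume st: "0 \<le> s" "t < \<xi>"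
  show "continuous_on {s..t} G" "continuous_on {s..t} (\<lambda>x. G (- x))"
    using st by (auto intro: continuous_on_subset[OF cont_G(1)] continuous_on_subset[OF cont_G(3)])
  show "G (- x) \<noteq> 0" if "x \<in> {s..t}" for x using Gpos[of "- x"] that st by simp
qed

lemma quotient_step:
  assumes st: "0 \<le> s" "s < t" "t < \<xi>"
  shows "\<exists>x. s < x \<and> x < t \<and> sgn (G t / G (- t) - G s / G (- s)) = sgn (w x)"
proof -
  have "\<exists>l z. s < z \<and> z < t \<and> ((\<lambda>x. G x / G (- x)) has_real_derivative l) (at z) \<and>
      G t / G (- t) - G s / G (- s) = (t - s) * l"
  proof (rule MVT[OF st(2) quotient_continuous[OF st(1,3)]])
    show "(\<lambda>x. G x / G (- x)) differentiable (at x)" if "s < x" "x < t" for x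
      unfolding real_differentiable_def by (rule exI, rule quotient_deriv) (use st that in auto)
  qed
  then obtain l z where z: "s < z" "z < t" "((\<lambda>x. G x / G (- x)) has_real_derivative l) (at z)"
      "G t / G (- t) - G s / G (- s) = (t - s) * l" by blast
  have l: "l = w z / (G (- z))\<^sup>2" using DERIV_unique[OF z(3) quotient_deriv] z st by simp
  have "0 < (G (- z))\<^sup>2" using Gpos[of "- z"] z st by simp
  then have "sgn l = sgn (w z)" using sgn_divide[of "w z" "(G (- z))\<^sup>2"] by (simp only: l sgn_pos div_by_1)
  then have "sgn (G t / G (- t) - G s / G (- s)) = sgn (w z)"
    using z st by (simp add: sgn_mult)
  then show ?thesis using z by blast
qed

text \<open>If the quotient is \<open>c \<noteq> 1\<close> at \<open>t\<close> and keeps moving away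
  from 1, or rests, up to \<xi>, it cannot return to 1 at the end.\<close>

lemma quotient_trapped:
  assumes H: "c = G t / G (- t)" "c \<noteq> 1" "0 < t" "t < \<xi>" "\<And>x. t < x \<Longrightarrow> x < \<xi> \<Longrightarrow> 0 \<le> (c - 1) * w x"
  shows False
proof -
  obtain x where x: "t < x" "x < \<xi>" "(c - 1) * (G x - c * G (- x)) < 0"
    using quotient_near_end[OF H(2,4)] by auto
  have gx: "0 < G (- x)" using Gpos[of "- x"] x H by simp
  obtain z where z: "t < z" "z < x" "sgn (G x / G (- x) - G t / G (- t)) = sgn (w z)"
    using quotient_step[of t x] x H by auto
  have "sgn (c - 1) * sgn (G x / G (- x) - c) = sgn ((c - 1) * w z)" using z H by (simp add: sgn_mult)
  also have "\<dots> \<ge> 0" using H(5)[of z] z x by simp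
  finally have "0 \<le> (c - 1) * (G x / G (- x) - c)" by (simp flip: sgn_mult)
  also have "(c - 1) * (G x / G (- x) - c) = (c - 1) * (G x - c * G (- x)) / G (- x)"
    using gx by (simp add: field_simps)
  finally have "0 \<le> (c - 1) * (G x - c * G (- x))" using gx by (simp add: zero_le_divide_iff)
  then show False using x by simp
qed

text \<open>The derivative of \<omega> w has the sign of \<kappa> - Y. For \<open>\<kappa>\<close>
  outside this range \<omega> w would be monotone on the whole half interval and vanish at \<xi>, so
  \<open>w\<close> would have one sign and the quotient would start at 1 and never come
  back.\<close>

lemma \<kappa>_bounds: "0 < \<kappa>" "\<kappa> < Ymax"
proof -
  have half: "0 < \<xi> / 2" "\<xi> / 2 < \<xi>" using \<xi>0 by auto
  have q0: "G 0 / G (- 0) = 1" using Gpos[of 0] \<xi>0 by simp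
  obtain z where z: "0 < z" "z < \<xi> / 2" "sgn (G (\<xi> / 2) / G (- (\<xi> / 2)) - 1) = sgn (w z)"
    using quotient_step[of 0 "\<xi> / 2"] half unfolding q0 by auto
  show "\<kappa> < Ymax"
  proof (rule ccontr)
    assume "\<not> \<kappa> < Ymax"
    then have neg: "w x < 0" if "0 < x" "x < \<xi>" for x
    proof -
      have "Y y < \<kappa>" if "x < y" "y < \<xi>" for y
        using \<open>\<not> \<kappa> < Ymax\<close> Y_strict_mono[of y \<xi>] that \<open>0 < x\<close> by (simp add: Ymax_def)
      then have "\<omega> x * w x < \<omega> \<xi> * w \<xi>" using that by (intro \<omega>w_strict(1)) auto
      then show ?thesis using \<omega>_pos[of x] by (simp add: w_end mult_less_0_iff)
    qed
    have "G (\<xi> / 2) / G (- (\<xi> / 2)) < 1" using z(3) neg[of z] z(1,2) half sgn_less[of "w z"] sgn_less[of "G (\<xi> / 2) / G (- (\<xi> / 2)) - 1"] by linarith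
    then show False using quotient_trapped[OF refl _ half] neg half by (smt (verit) mult_nonpos_nonpos)
  qed
  show "0 < \<kappa>"
  proof (rule ccontr)
    assume "\<not> 0 < \<kappa>"
    then have pos: "0 < w x" if "0 < x" "x < \<xi>" for x
    proof -
      have "\<kappa> < Y y" if "x < y" "y < \<xi>" for y
        using \<open>\<not> 0 < \<kappa>\<close> Y_strict_mono[of 0 y] that \<open>0 < x\<close> by (simp add: Y_0)
      then have "\<omega> \<xi> * w \<xi> < \<omega> x * w x" using that by (intro \<omega>w_strict(2)) auto
      then show ?thesis using \<omega>_pos[of x] by (simp add: w_end zero_less_mult_iff)
    qed
    have "1 < G (\<xi> / 2) / G (- (\<xi> / 2))" using z(3) pos[of z] z(1,2) half sgn_greater[of "w z"] sgn_greater[of "G (\<xi> / 2) / G (- (\<xi> / 2)) - 1"] by linarith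
    then show False using quotient_trapped[OF refl _ half] pos half by (smt (verit) mult_nonneg_nonneg)
  qed
qed

end

context symmetrized_profile
begin

text \<open>A quotient above 1 at \<open>x\<close> requires w > 0 at an earlier point. From there
  \<omega> w rises while Y < \<kappa> and then decreases to its end value 0, so \<open>w\<close>
  stays positive and the quotient is trapped above 1.\<close>

lemma Go_nonpos:
  assumes x: "0 < x" "x < \<xi>"
  shows "Go x \<le> 0"
proof (rule ccontr)
  assume "\<not> Go x \<le> 0"
  then have gx: "G (- x) < G x" by (simp add: Go_def)
  have g: "0 < G (- x)" using Gpos[of "- x"] x by simp
  have c: "1 < G x / G (- x)" using gx g by (simp add: less_divide_eq)
  have q0: "G 0 / G (- 0) = 1" using Gpos[of 0] \<xi>0 by simp
  obtain z where z: "0 < z" "z < x" "sgn (G x / G (- x) - 1) = sgn (w z)"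
    using quotient_step[of 0 x] x unfolding q0 by auto
  have wz: "0 < w z" using z c sgn_greater[of "w z"] sgn_greater[of "G x / G (- x) - 1"] by linarith
  have wpos: "0 < w y" if y: "z < y" "y < \<xi>" for y
  proof (cases "Y y \<le> \<kappa>")
    case True
    have "Y u < \<kappa>" if "z < u" "u < y" for u using Y_strict_mono[of u y] that True z by simp
    then have "\<omega> z * w z < \<omega> y * w y" using y z by (intro \<omega>w_strict(1)) auto
    moreover have "0 < \<omega> z * w z" using wz \<omega>_pos[of z] by simp
    ultimately have "0 < \<omega> y * w y" by linarith
    then show ?thesis using \<omega>_pos[of y] by (simp add: zero_less_mult_iff)
  next
    case False
    have "\<kappa> < Y u" if "y < u" "u < \<xi>" for u using Y_strict_mono[of y u] that False z y by simp
    then have "\<omega> \<xi> * w \<xi> < \<omega> y * w y" using y z by (intro \<omega>w_strict(2)) auto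
    then show ?thesis using \<omega>_pos[of y] by (simp add: w_end zero_less_mult_iff)
  qed
  have "0 \<le> (G x / G (- x) - 1) * w y" if "x < y" "y < \<xi>" for y
    using wpos[of y] c that z by (intro mult_nonneg_nonneg) auto
  then show False by (rule quotient_trapped[OF refl _ x, rotated]) (use c in auto)
qed

text \<open>With y = Y x, the two residuals are the factors of \<open>Ge\<close> and of - P S
  \<open>Go\<close> in the derivative of \<open>Z\<close> below, apart from \<omega>. The identity
  P^2 S^2 = y (P + y) removes the hyperbolic functions and leaves expressions in y alone.\<close>

definition even_residual where
  "even_residual k k1 k2 f f1 y = 4 * (y * (P + y)) * k2 y + (2 * (P + 2 * y) - 2 * (y * (P + y))) * k1 y + (N - 1) * k y
    + (\<kappa> - y) * ((P + 2 * y) * f y + 2 * (y * (P + y)) * f1 y) - (\<kappa> - y + 2) * (y * (P + y)) * f y"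

definition odd_residual where
  "odd_residual k k1 f f1 f2 y = 4 * (y * (P + y)) * f2 y + (6 * (P + 2 * y) - 2 * (y * (P + y))) * f1 y
    + (N + 3 - P - 2 * y) * f y + 2 * (\<kappa> - y) * k1 y - (\<kappa> - y + 2) * k y"

text \<open>Green's formula for \<open>G\<close> against \<open>exp (- \<integral> (\<kappa> - Y)) (k (Y x) - P sinh x cosh x f (Y x))\<close>, folded to \<open>x > 0\<close>;
  the exponential makes the boundary terms of the odd part cancel.\<close>

lemma balance:
  assumes dk: "\<And>y. (k has_real_derivative k1 y) (at y)" "\<And>y. (k1 has_real_derivative k2 y) (at y)"
    and df: "\<And>y. (f has_real_derivative f1 y) (at y)" "\<And>y. (f1 has_real_derivative f2 y) (at y)"
    and even: "\<And>y. 0 \<le> y \<Longrightarrow> y \<le> Ymax \<Longrightarrow> 0 < even_residual k k1 k2 f f1 y"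
    and odd: "\<And>y. 0 \<le> y \<Longrightarrow> y \<le> Ymax \<Longrightarrow> 0 \<le> odd_residual k k1 f f1 f2 y"
  shows "0 < k Ymax"
proof -
  define s where "s = (\<lambda>x. P * S x)"
  have ds: "(s has_real_derivative P + 2 * Y x) (at x)" for x
    unfolding s_def using P0 by (auto intro!: derivative_eq_intros S_deriv simp: field_simps)
  have ss: "Y x * (P + Y x) = s x * s x" for x
    using S_square[of x] by (simp add: s_def power2_eq_square algebra_simps)
  have dY: "(Y has_real_derivative 2 * s x) (at x)" for x
    using Y_deriv[of x] by (simp add: s_def mult.assoc)
  have d\<omega>: "(\<omega> has_real_derivative - s x * \<omega> x) (at x)" for x
    using \<omega>_deriv[of x] by (simp add: s_def)
  note ch = DERIV_chain2[OF dk(1) dY] DERIV_chain2[OF dk(2) dY] DERIV_chain2[OF df(1) dY] DERIV_chain2[OF df(2) dY]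
  \<comment> \<open>By parity every term vanishes at 0. At \<xi> the profile and the combined odd
    slope vanish, and only the even slope -1 remains, multiplied by - k.\<close>
  define Z where "Z = (\<lambda>x. \<omega> x * (Ge x * (2 * s x * k1 (Y x) + (\<kappa> - Y x) * (s x * f (Y x))) - Ge1 x * k (Y x)
     + Go x * (- ((P + 2 * Y x) * f (Y x) + 2 * (s x * s x) * f1 (Y x)) - (\<kappa> - Y x) * k (Y x)) + Go1 x * (s x * f (Y x))))"
  have dZ: "(Z has_real_derivative \<omega> x * (Ge x * even_residual k k1 k2 f f1 (Y x) - s x * Go x * odd_residual k k1 f f1 f2 (Y x))) (at x)"
    if x: "0 < x" "x < \<xi>" for x
    unfolding Z_def even_residual_def odd_residual_def ss
    by (rule DERIV_cong, (rule derivative_eq_intros d\<omega> ds dY ch parity_derivs[OF x] refl)+)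
      (simp add: s_def algebra_simps)
  have cont: "continuous_on {0..\<xi>} g" if "\<And>x. (g has_real_derivative g' x) (at x)" for g g' :: "real \<Rightarrow> real"
    by (rule DERIV_everywhere_continuous_on[OF that])
  have cZ: "continuous_on {0..\<xi>} Z"
    unfolding Z_def by (intro continuous_intros cont_parity cont[OF d\<omega>] cont[OF ds] cont[OF dY] cont[OF ch(1)] cont[OF ch(2)] cont[OF ch(3)] cont[OF ch(4)])
  have "Z 0 < Z \<xi>"
  proof (rule DERIV_pos_imp_increasing_open[OF \<xi>0 _ cZ])
    fix x assume x: "0 < x" "x < \<xi>"
    have yx: "0 \<le> Y x" "Y x \<le> Ymax" using Y_nonneg Y_mono[of x \<xi>] x by (auto simp: Ymax_def)
    have "0 < Ge x * even_residual k k1 k2 f f1 (Y x)" using Ge_pos[OF x] even[OF yx] by simp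
    moreover have "s x * Go x * odd_residual k k1 f f1 f2 (Y x) \<le> 0"
      using Go_nonpos[OF x] odd[OF yx] S_pos[OF x(1)] P0 by (simp add: s_def mult_nonneg_nonpos mult_nonpos_nonneg)
    ultimately have "0 < \<omega> x * (Ge x * even_residual k k1 k2 f f1 (Y x) - s x * Go x * odd_residual k k1 f f1 f2 (Y x))"
      using \<omega>_pos[of x] by (intro mult_pos_pos) auto
    then show "\<exists>y. (Z has_real_derivative y) (at x) \<and> 0 < y" using dZ[OF x] by blast
  qed
  moreover have "Z 0 = 0" by (simp add: Z_def parity_ends s_def S_0)
  moreover have "Z \<xi> = \<omega> \<xi> * k Ymax" by (simp add: Z_def parity_ends Ymax_def)
  ultimately show ?thesis using \<omega>_pos[of \<xi>] by (simp add: zero_less_mult_iff)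
qed

text \<open>The odd part in \<open>x\<close> of the logarithm of r^5 wgt; the even part is, up to a
  constant, the exponent - Y / 2 of \<omega>.\<close>

definition "\<Theta> x = (N + 4) * x - P / 2 * S x"

lemma \<Theta>_deriv: "(\<Theta> has_real_derivative 4 + \<kappa> - Y x) (at x)"
  unfolding \<Theta>_def \<kappa>_def using P0 by (auto intro!: derivative_eq_intros S_deriv simp: field_simps)

text \<open>The left side is half the scaled boundary term of the degree 3 condition and
  \<open>M\<close> the scaled integral, folded to x > 0. The combination P p sinh \<Theta> + P S q
  cosh \<Theta>, times \<omega>, is an approximate antiderivative of 2 P \<omega> cosh \<Theta>
  whose error has a sign, separately for the cosh part and the sinh part.\<close>

lemma sinh_\<Theta>_bound:
  assumes dp: "\<And>y. (p has_real_derivative p1 y) (at y)" and dq: "\<And>y. (q has_real_derivative q1 y) (at y)"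
    and Yk: "Ymax \<le> 4 + \<kappa>"
    and sinh_part: "\<And>y. 0 \<le> y \<Longrightarrow> y \<le> Ymax \<Longrightarrow> P * (2 * p1 y - p y) + (4 + \<kappa> - y) * q y \<le> 0"
    and cosh_part: "\<And>y. 0 \<le> y \<Longrightarrow> y \<le> Ymax \<Longrightarrow>
      P * p y * (4 + \<kappa> - y) + (P + 2 * y) * q y + 2 * (y * (P + y)) * q1 y - y * (P + y) * q y < 2 * P"
    and ends: "1 \<le> p Ymax" "0 \<le> q Ymax"
    and M: "continuous_on {0..\<xi>} M" "M 0 = 0" "\<And>x. 0 < x \<Longrightarrow> x < \<xi> \<Longrightarrow> (M has_real_derivative 2 * \<omega> x * cosh (\<Theta> x)) (at x)"
  shows "\<omega> \<xi> * sinh (\<Theta> \<xi>) < M \<xi>"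
proof -
  define s where "s = (\<lambda>x. P * S x)"
  have ds: "(s has_real_derivative P + 2 * Y x) (at x)" for x
    unfolding s_def using P0 by (auto intro!: derivative_eq_intros S_deriv simp: field_simps)
  have ss: "Y x * (P + Y x) = s x * s x" for x
    using S_square[of x] by (simp add: s_def power2_eq_square algebra_simps)
  have dY: "(Y has_real_derivative 2 * s x) (at x)" for x
    using Y_deriv[of x] by (simp add: s_def mult.assoc)
  have d\<omega>: "(\<omega> has_real_derivative - s x * \<omega> x) (at x)" for x
    using \<omega>_deriv[of x] by (simp add: s_def)
  note ch = DERIV_chain2[OF dp dY] DERIV_chain2[OF dq dY]
  have hyp: "((\<lambda>x. sinh (\<Theta> x)) has_real_derivative cosh (\<Theta> x) * (4 + \<kappa> - Y x)) (at x)"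
    "((\<lambda>x. cosh (\<Theta> x)) has_real_derivative sinh (\<Theta> x) * (4 + \<kappa> - Y x)) (at x)" for x
    by (auto intro!: derivative_eq_intros \<Theta>_deriv)
  define D where "D = (\<lambda>x. P * M x - \<omega> x * (P * (p (Y x) * sinh (\<Theta> x)) + s x * (q (Y x) * cosh (\<Theta> x))))"
  define D' where "D' = (\<lambda>x. \<omega> x * (cosh (\<Theta> x) * (2 * P - (P * p (Y x) * (4 + \<kappa> - Y x) + (P + 2 * Y x) * q (Y x)
      + 2 * (Y x * (P + Y x)) * q1 (Y x) - Y x * (P + Y x) * q (Y x)))
      - sinh (\<Theta> x) * s x * (P * (2 * p1 (Y x) - p (Y x)) + (4 + \<kappa> - Y x) * q (Y x))))"
  have dD: "(D has_real_derivative D' x) (at x)" if x: "0 < x" "x < \<xi>" for x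
    unfolding D_def D'_def ss
    by (rule DERIV_cong, (rule derivative_eq_intros d\<omega> ds ch hyp M(3)[OF x] refl)+) (simp add: algebra_simps)
  have \<Theta>0: "0 \<le> \<Theta> x" if x: "0 \<le> x" "x \<le> \<xi>" for x
  proof -
    have "\<Theta> 0 \<le> \<Theta> x"
    proof (rule DERIV_nonneg_imp_nondecreasing[OF x(1)])
      fix z assume z: "0 \<le> z" "z \<le> x"
      have "Y z \<le> Ymax" unfolding Ymax_def using z x by (intro Y_mono) auto
      then show "\<exists>y. (\<Theta> has_real_derivative y) (at z) \<and> 0 \<le> y"
        using \<Theta>_deriv[of z] Yk by (intro exI[of _ "4 + \<kappa> - Y z"]) auto
    qed
    then show ?thesis by (simp add: \<Theta>_def S_0)
  qed
  have cont: "continuous_on {0..\<xi>} g" if "\<And>x. (g has_real_derivative g' x) (at x)" for g g' :: "real \<Rightarrow> real"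
    by (rule DERIV_everywhere_continuous_on[OF that])
  have cD: "continuous_on {0..\<xi>} D"
    unfolding D_def by (intro continuous_intros M(1) cont[OF d\<omega>] cont[OF ds] cont[OF ch(1)] cont[OF ch(2)] cont[OF hyp(1)] cont[OF hyp(2)])
  have "D 0 < D \<xi>"
  proof (rule DERIV_pos_imp_increasing_open[OF \<xi>0 _ cD])
    fix x assume x: "0 < x" "x < \<xi>"
    have yx: "0 \<le> Y x" "Y x \<le> Ymax" using Y_nonneg Y_mono[of x \<xi>] x by (auto simp: Ymax_def)
    have "0 \<le> sinh (\<Theta> x) * s x" using \<Theta>0[of x] x S_pos[OF x(1)] P0 by (simp add: s_def)
    from mult_nonneg_nonpos[OF this sinh_part[OF yx]]
    have "sinh (\<Theta> x) * s x * (P * (2 * p1 (Y x) - p (Y x)) + (4 + \<kappa> - Y x) * q (Y x)) \<le> 0" .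
    moreover have "0 < cosh (\<Theta> x) * (2 * P - (P * p (Y x) * (4 + \<kappa> - Y x) + (P + 2 * Y x) * q (Y x)
      + 2 * (Y x * (P + Y x)) * q1 (Y x) - Y x * (P + Y x) * q (Y x)))"
      using cosh_part[OF yx] by (intro mult_pos_pos cosh_real_pos) simp
    ultimately have "0 < D' x" unfolding D'_def using \<omega>_pos[of x] by (intro mult_pos_pos) auto
    then show "\<exists>y. (D has_real_derivative y) (at x) \<and> 0 < y" using dD[OF x] by blast
  qed
  moreover have "D 0 = 0" by (simp add: D_def M(2) \<Theta>_def s_def S_0)
  ultimately have D\<xi>: "\<omega> \<xi> * (P * (p Ymax * sinh (\<Theta> \<xi>)) + s \<xi> * (q Ymax * cosh (\<Theta> \<xi>))) < P * M \<xi>"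
    by (simp add: D_def Ymax_def)
  have "0 \<le> sinh (\<Theta> \<xi>)" using \<Theta>0[of \<xi>] \<xi>0 by simp
  then have "sinh (\<Theta> \<xi>) \<le> p Ymax * sinh (\<Theta> \<xi>)" using ends(1) mult_right_mono[of 1 "p Ymax"] by simp
  then have "P * sinh (\<Theta> \<xi>) \<le> P * (p Ymax * sinh (\<Theta> \<xi>))" using P0 by simp
  moreover have "0 \<le> s \<xi> * (q Ymax * cosh (\<Theta> \<xi>))"
    using S_pos[OF \<xi>0] P0 ends(2) cosh_real_pos[of "\<Theta> \<xi>"] by (simp add: s_def)
  ultimately have "\<omega> \<xi> * (P * sinh (\<Theta> \<xi>)) \<le> \<omega> \<xi> * (P * (p Ymax * sinh (\<Theta> \<xi>)) + s \<xi> * (q Ymax * cosh (\<Theta> \<xi>)))"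
    using \<omega>_pos[of \<xi>] by (intro mult_left_mono) auto
  with D\<xi> have "P * (\<omega> \<xi> * sinh (\<Theta> \<xi>)) < P * M \<xi>" by (simp add: algebra_simps)
  then show ?thesis using P0 by simp
qed

end

section \<open>Certificates for the symmetrized problem\<close>

primrec lsum :: "int list list \<Rightarrow> int list" where
  "lsum [] = []"
| "lsum (xs # xss) = ladd xs (lsum xss)"

lemma horner_lsum: "horner (lsum []) t = 0" "horner (lsum (xs # xss)) t = horner xs t + horner (lsum xss) t"
  by simp_all

text \<open>After N = \<kappa> + P / 2 is inserted, twice a residual is affine in P and in \<kappa>.
  Names with \<open>const\<close> and \<open>slope\<close> hold the parts without and with \<kappa>;
  a prime marks the part not multiplied by P. The definitions for sinh and cosh are arranged
  alike.\<close>

definition even_const where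
  "even_const k f = (let k1 = lderiv k; k2 = lderiv k1; f1 = lderiv f in
    lsum [lscale 8 (lmult 0 1 k2), lscale 4 k1, lscale (- 4) (lmult 0 1 k1), k, lscale (- 6) (lmult 0 1 f),
      lscale (- 4) (lmult 0 1 (lmult 0 1 f1)), lscale 2 (lmult 0 1 (lmult 0 1 f))])"

definition even_slope where
  "even_slope f = lsum [lscale 2 f, lscale 4 (lmult 0 1 (lderiv f)), lscale (- 2) (lmult 0 1 f)]"

definition even_const' where
  "even_const' k f = (let k1 = lderiv k; k2 = lderiv k1; f1 = lderiv f in
    lsum [lscale 8 (lmult 0 1 (lmult 0 1 k2)), lscale 8 (lmult 0 1 k1), lscale (- 4) (lmult 0 1 (lmult 0 1 k1)), lscale (- 2) k,
      lscale (- 8) (lmult 0 1 (lmult 0 1 f)), lscale (- 4) (lmult 0 1 (lmult 0 1 (lmult 0 1 f1))), lscale 2 (lmult 0 1 (lmult 0 1 (lmult 0 1 f)))])"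

definition even_slope' where
  "even_slope' k f = lsum [lscale 2 k, lscale 4 (lmult 0 1 f), lscale 4 (lmult 0 1 (lmult 0 1 (lderiv f))), lscale (- 2) (lmult 0 1 (lmult 0 1 f))]"

definition odd_const where
  "odd_const f = (let f1 = lderiv f; f2 = lderiv f1 in
    lsum [lscale 8 (lmult 0 1 f2), lscale 12 f1, lscale (- 4) (lmult 0 1 f1), lscale (- 1) f])"

definition odd_const' where
  "odd_const' k f = (let k1 = lderiv k; f1 = lderiv f; f2 = lderiv f1 in
    lsum [lscale 8 (lmult 0 1 (lmult 0 1 f2)), lscale 24 (lmult 0 1 f1), lscale (- 4) (lmult 0 1 (lmult 0 1 f1)), lscale 6 f,
      lscale (- 4) (lmult 0 1 f), lscale (- 4) (lmult 0 1 k1), lscale (- 4) k, lscale 2 (lmult 0 1 k)])"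

definition odd_slope' where
  "odd_slope' k f = lsum [lscale 2 f, lscale 4 (lderiv k), lscale (- 2) k]"

definition sinh_const where "sinh_const p = lsum [p, lscale (- 2) (lderiv p)]"
definition sinh_const' where "sinh_const' q = lsum [lscale (- 4) q, lmult 0 1 q]"
definition cosh_const where
  "cosh_const m p q = lsum [[2 * m], lscale (- 4) p, lmult 0 1 p, lscale (- 1) q, lscale (- 2) (lmult 0 1 (lderiv q)), lmult 0 1 q]"
definition cosh_const' where
  "cosh_const' q = lsum [lscale (- 2) (lmult 0 1 q), lscale (- 2) (lmult 0 1 (lmult 0 1 (lderiv q))), lmult 0 1 (lmult 0 1 q)]"

text \<open>Positivity of \<open>X0 + \<kappa> X1 + (Z0 + \<kappa> Z1) / P\<close> at \<open>\<kappa> = kn / kd\<close> for \<open>P = 72\<close> and \<open>P = \<infinity>\<close>.\<close>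

definition corner_pos where
  "corner_pos kn kd hi d bs X0 X1 Z0 Z1 \<longleftrightarrow>
    lpos_on 0 hi d bs (lsum [lscale kd X0, lscale kn X1]) \<and>
    lpos_on 0 hi d bs (lsum [lscale (72 * kd) X0, lscale (72 * kn) X1, lscale kd Z0, lscale kn Z1])"

text \<open>For fixed y the expression is affine in \<kappa>, so the two ends of its range suffice.
  Its P-coefficient is positive by the test at infinity, so positivity at P = 72 carries over to all
  larger P.\<close>

lemma corner_pos:
  assumes c: "corner_pos kn0 kd hi d bs X0 X1 Z0 Z1" "corner_pos kn1 kd hi d bs X0 X1 Z0 Z1"
    and kd: "0 < kd" and k: "kn0 / kd \<le> \<kappa>" "\<kappa> \<le> kn1 / kd" and P: "72 \<le> P" and y: "0 \<le> y" "y \<le> hi / d"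
  shows "0 < P * (horner X0 y + \<kappa> * horner X1 y) + (horner Z0 y + \<kappa> * horner Z1 y)"
proof -
  have affine: "0 < u + \<kappa> * v" if "0 < kd * u + kn0 * v" "0 < kd * u + kn1 * v" for u v :: real
  proof (cases "0 \<le> v")
    case True
    have "kn0 * v \<le> (kd * \<kappa>) * v" using k kd True by (intro mult_right_mono) (auto simp: field_simps)
    then have "0 < kd * (u + \<kappa> * v)" using that by (simp add: algebra_simps)
    then show ?thesis using kd by (simp add: zero_less_mult_iff)
  next
    case False
    have "kn1 * v \<le> (kd * \<kappa>) * v" using k kd False by (intro mult_right_mono_neg) (auto simp: field_simps)
    then have "0 < kd * (u + \<kappa> * v)" using that by (simp add: algebra_simps)
    then show ?thesis using kd by (simp add: zero_less_mult_iff)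
  qed
  have y0: "real_of_int 0 / d \<le> y" using y by simp
  have h: "0 < kd * horner X0 y + kn * horner X1 y"
    "0 < kd * (72 * horner X0 y + horner Z0 y) + kn * (72 * horner X1 y + horner Z1 y)"
    if "corner_pos kn kd hi d bs X0 X1 Z0 Z1" for kn
    using lpos_on[OF conjunct1[OF that[unfolded corner_pos_def]] y0 y(2)] lpos_on[OF conjunct2[OF that[unfolded corner_pos_def]] y0 y(2)]
    by (simp_all add: algebra_simps)
  have a: "0 < horner X0 y + \<kappa> * horner X1 y" by (rule affine[OF h(1)[OF c(1)] h(1)[OF c(2)]])
  have "0 < (72 * horner X0 y + horner Z0 y) + \<kappa> * (72 * horner X1 y + horner Z1 y)"
    by (rule affine[OF h(2)[OF c(1)] h(2)[OF c(2)]])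
  moreover have "0 \<le> (P - 72) * (horner X0 y + \<kappa> * horner X1 y)" using a P by (intro mult_nonneg_nonneg) auto
  ultimately show ?thesis by (simp add: algebra_simps)
qed

definition balance_cert where
  "balance_cert kn0 kn1 kd l0 l1 d k f be bo bl \<longleftrightarrow> 0 < kd \<and>
    corner_pos kn0 kd l1 d be (even_const k f) (even_slope f) (even_const' k f) (even_slope' k f) \<and>
    corner_pos kn1 kd l1 d be (even_const k f) (even_slope f) (even_const' k f) (even_slope' k f) \<and>
    corner_pos kn0 kd l1 d bo (odd_const f) [] (odd_const' k f) (odd_slope' k f) \<and>
    corner_pos kn1 kd l1 d bo (odd_const f) [] (odd_const' k f) (odd_slope' k f) \<and>
    lpos_on l0 l1 d bl (lscale (- 1) k)"

definition hyperbolic_cert where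
  "hyperbolic_cert kn kd l0 l1 d m p q bs bc bp bq \<longleftrightarrow> 0 < kd \<and> 0 < m \<and>
    corner_pos 0 kd l1 d bs (sinh_const p) [] (sinh_const' q) (lscale (- 1) q) \<and>
    corner_pos kn kd l1 d bs (sinh_const p) [] (sinh_const' q) (lscale (- 1) q) \<and>
    corner_pos 0 kd l1 d bc (cosh_const m p q) (lscale (- 1) p) (cosh_const' q) [] \<and>
    corner_pos kn kd l1 d bc (cosh_const m p q) (lscale (- 1) p) (cosh_const' q) [] \<and>
    lpos_on l0 l1 d bp (ladd [- m] p) \<and> lpos_on l0 l1 d bq q"

context symmetrized_profile
begin

text \<open>The certificate supplies k < 0 on the stated range of \<open>Ymax\<close>, against the
  positivity that \<open>balance\<close> enforces. Each certificate thus excludes a rectangle of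
  values of \<kappa> and \<open>Ymax\<close>.\<close>

lemma balance_cert:
  assumes "balance_cert kn0 kn1 kd l0 l1 d k f be bo bl" "72 \<le> P"
    and k: "kn0 / kd \<le> \<kappa>" "\<kappa> \<le> kn1 / kd" and l: "l0 / d \<le> Ymax" "Ymax \<le> l1 / d"
  shows False
proof -
  have c: "0 < kd"
    "corner_pos kn0 kd l1 d be (even_const k f) (even_slope f) (even_const' k f) (even_slope' k f)"
    "corner_pos kn1 kd l1 d be (even_const k f) (even_slope f) (even_const' k f) (even_slope' k f)"
    "corner_pos kn0 kd l1 d bo (odd_const f) [] (odd_const' k f) (odd_slope' k f)"
    "corner_pos kn1 kd l1 d bo (odd_const f) [] (odd_const' k f) (odd_slope' k f)"
    "lpos_on l0 l1 d bl (lscale (- 1) k)"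
    using assms(1) unfolding balance_cert_def by blast+
  have "0 < horner k Ymax"
  proof (rule balance[OF horner_deriv horner_deriv horner_deriv horner_deriv])
    fix y assume y: "0 \<le> y" "y \<le> Ymax"
    then have y': "y \<le> l1 / d" using l by simp
    have "2 * even_residual (horner k) (horner (lderiv k)) (horner (lderiv (lderiv k))) (horner f) (horner (lderiv f)) y =
      P * (horner (even_const k f) y + \<kappa> * horner (even_slope f) y) + (horner (even_const' k f) y + \<kappa> * horner (even_slope' k f) y)"
      unfolding even_residual_def \<kappa>_def even_const_def even_slope_def even_const'_def even_slope'_def Let_def horner_lsum
      by (simp add: algebra_simps)
    also have "0 < \<dots>" by (rule corner_pos[OF c(2,3,1) k assms(2) y(1) y'])
    finally show "0 < even_residual (horner k) (horner (lderiv k)) (horner (lderiv (lderiv k))) (horner f) (horner (lderiv f)) y" by simp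
    have "2 * odd_residual (horner k) (horner (lderiv k)) (horner f) (horner (lderiv f)) (horner (lderiv (lderiv f))) y =
      P * (horner (odd_const f) y + \<kappa> * horner [] y) + (horner (odd_const' k f) y + \<kappa> * horner (odd_slope' k f) y)"
      unfolding odd_residual_def \<kappa>_def odd_const_def odd_const'_def odd_slope'_def Let_def horner_lsum
      by (simp add: algebra_simps)
    also have "0 < \<dots>" by (rule corner_pos[OF c(4,5,1) k assms(2) y(1) y'])
    finally show "0 \<le> odd_residual (horner k) (horner (lderiv k)) (horner f) (horner (lderiv f)) (horner (lderiv (lderiv f))) y" by simp
  qed
  moreover have "0 < horner (lscale (- 1) k) Ymax" by (rule lpos_on[OF c(6) l])
  ultimately show False by simp
qed

lemma hyperbolic_cert:
  assumes "hyperbolic_cert kn kd l0 l1 d m p q bs bc bp bq" "72 \<le> P"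
    and k: "\<kappa> \<le> kn / kd" and l: "l0 / d \<le> Ymax" "Ymax \<le> l1 / d" "Ymax \<le> 4 + \<kappa>"
    and M: "continuous_on {0..\<xi>} M" "M 0 = 0" "\<And>x. 0 < x \<Longrightarrow> x < \<xi> \<Longrightarrow> (M has_real_derivative 2 * \<omega> x * cosh (\<Theta> x)) (at x)"
  shows "\<omega> \<xi> * sinh (\<Theta> \<xi>) < M \<xi>"
proof -
  have c: "0 < kd" "0 < m"
    "corner_pos 0 kd l1 d bs (sinh_const p) [] (sinh_const' q) (lscale (- 1) q)"
    "corner_pos kn kd l1 d bs (sinh_const p) [] (sinh_const' q) (lscale (- 1) q)"
    "corner_pos 0 kd l1 d bc (cosh_const m p q) (lscale (- 1) p) (cosh_const' q) []"
    "corner_pos kn kd l1 d bc (cosh_const m p q) (lscale (- 1) p) (cosh_const' q) []"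
    "lpos_on l0 l1 d bp (ladd [- m] p)" "lpos_on l0 l1 d bq q"
    using assms(1) unfolding hyperbolic_cert_def by blast+
  have k0: "real_of_int 0 / kd \<le> \<kappa>" using \<kappa>_bounds by simp
  have m: "0 < real_of_int m" using c by simp
  have dm: "((\<lambda>y. horner xs y / m) has_real_derivative horner (lderiv xs) y / m) (at y)" for xs y
    by (rule DERIV_cdivide[OF horner_deriv])
  show ?thesis
  proof (rule sinh_\<Theta>_bound[OF dm[of p] dm[of q] l(3) _ _ _ _ M])
    fix y assume y: "0 \<le> y" "y \<le> Ymax"
    then have y': "y \<le> l1 / d" using l by simp
    define p0 p1 q0 q1 where "p0 = horner p y / m" and "p1 = horner (lderiv p) y / m"
      and "q0 = horner q y / m" and "q1 = horner (lderiv q) y / m"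
    have pq: "horner p y = m * p0" "horner (lderiv p) y = m * p1" "horner q y = m * q0" "horner (lderiv q) y = m * q1"
      using m by (simp_all add: p0_def p1_def q0_def q1_def)
    note fold = p0_def[symmetric] p1_def[symmetric] q0_def[symmetric] q1_def[symmetric]
    have "0 < P * (horner (sinh_const p) y + \<kappa> * horner [] y) + (horner (sinh_const' q) y + \<kappa> * horner (lscale (- 1) q) y)"
      by (rule corner_pos[OF c(3,4,1) k0 k assms(2) y(1) y'])
    also have "\<dots> = - (m * (P * (2 * p1 - p0) + (4 + \<kappa> - y) * q0))"
      unfolding sinh_const_def sinh_const'_def horner_lsum by (simp add: pq algebra_simps)
    finally show "P * (2 * (horner (lderiv p) y / m) - horner p y / m) + (4 + \<kappa> - y) * (horner q y / m) \<le> 0"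
      unfolding fold using m neg_of_mult_neg[of m] by (simp add: less_imp_le)
    have "0 < P * (horner (cosh_const m p q) y + \<kappa> * horner (lscale (- 1) p) y) + (horner (cosh_const' q) y + \<kappa> * horner [] y)"
      by (rule corner_pos[OF c(5,6,1) k0 k assms(2) y(1) y'])
    also have "\<dots> = m * (2 * P - (P * p0 * (4 + \<kappa> - y) + (P + 2 * y) * q0 + 2 * (y * (P + y)) * q1 - y * (P + y) * q0))"
      unfolding cosh_const_def cosh_const'_def horner_lsum by (simp add: pq algebra_simps)
    finally have "0 < 2 * P - (P * p0 * (4 + \<kappa> - y) + (P + 2 * y) * q0 + 2 * (y * (P + y)) * q1 - y * (P + y) * q0)"
      using m zero_less_mult_pos by blast
    then show "P * (horner p y / m) * (4 + \<kappa> - y) + (P + 2 * y) * (horner q y / m)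
        + 2 * (y * (P + y)) * (horner (lderiv q) y / m) - y * (P + y) * (horner q y / m) < 2 * P" unfolding fold by simp
  next
    show "1 \<le> horner p Ymax / m" using lpos_on[OF c(7) l(1,2)] m by (simp add: field_simps)
    show "0 \<le> horner q Ymax / m" using lpos_on[OF c(8) l(1,2)] m by simp
  qed
qed

end

text \<open>The first entry excludes \<open>Ymax\<close> up to 2.6. On each of the three remaining
  ranges of \<open>Ymax\<close> a balance certificate excludes \<kappa> from 1.68, 1.80 or 2.20
  upwards, and a hyperbolic certificate proves the degree 3 condition for \<kappa> up to that
  value.\<close>

lemma large_n_certs:
  "balance_cert 0 52 20 0 52 20 [-3000, 763, 103, 10, 3] [26, 7, 7] [0, 36, 52] [0, 52] [0, 52]"
  "balance_cert 168 275 100 52 55 20 [30000, -30000, 5813, -68, 172] [27074, 2688, 1039] [0, 28, 50, 55] [0, 55] [52, 55]"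
  "hyperbolic_cert 168 100 52 55 20 10000 [2944, 1268, 360, 40, 14] [3206, -393, -201, -29] [0, 55] [0, 51, 55] [52, 55] [52, 55]"
  "balance_cert 180 300 100 55 60 20 [3000, -1784, 194, 0, 7] [1220, 166, 51] [0, 58, 60] [0, 60] [55, 60]"
  "hyperbolic_cert 180 100 55 60 20 10000 [2886, 1156, 329, 34, 13] [3131, -279, -175, -26] [0, 60] [0, 60] [55, 60] [55, 60]"
  "balance_cert 220 395 100 60 79 20 [3000, -1055, -34, -23, 12] [403, 133, 113] [0, 56, 79] [0, 79] [60, 79]"
  "hyperbolic_cert 220 100 60 79 20 10000 [2607, 1008, 298, 25, 13] [3696, -31, -142, -22] [0, 74, 79] [0, 61, 79] [60, 79] [60, 79]"
  by code_simp+

section \<open>Dimensions from 40 on\<close>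

context annulus
begin

definition "\<rho> x = sqrt (a * b) * exp x"
definition "half_width = ln (b / a) / 2"

lemma ab0: "0 < a * b" "0 < b" using a0 ab by (auto intro: mult_pos_pos)

lemma \<rho>_pos: "0 < \<rho> x" using ab0 by (simp add: \<rho>_def)

lemma \<rho>_mono: "x \<le> y \<Longrightarrow> \<rho> x \<le> \<rho> y" and \<rho>_strict_mono: "x < y \<Longrightarrow> \<rho> x < \<rho> y"
  using ab0 by (simp_all add: \<rho>_def)

lemma \<rho>_mult: "\<rho> x * \<rho> y = a * b * exp (x + y)"
  using ab0 by (simp add: \<rho>_def exp_add algebra_simps)

lemma \<rho>_ends: "\<rho> half_width = b" "\<rho> (- half_width) = a"
proof -
  have "\<rho> half_width * \<rho> half_width = b * b"
    using a0 ab0 by (simp add: \<rho>_mult half_width_def exp_ln)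
  then show b: "\<rho> half_width = b" using \<rho>_pos[of half_width] ab0 by (simp add: square_eq_iff)
  have "\<rho> (- half_width) * \<rho> half_width = a * b" by (simp add: \<rho>_mult)
  then show "\<rho> (- half_width) = a" using ab0 by (simp add: b)
qed

lemma \<rho>_range: "x \<in> {- half_width..half_width} \<Longrightarrow> \<rho> x \<in> {a..b}"
  using \<rho>_mono[of "- half_width" x] \<rho>_mono[of x half_width] by (simp add: \<rho>_ends)

lemma half_width_pos: "0 < half_width" using a0 ab by (simp add: half_width_def)

lemma \<rho>_deriv: "(\<rho> has_real_derivative \<rho> x) (at x within A)"
  unfolding \<rho>_def by (auto intro!: derivative_eq_intros)

lemma \<rho>_square: "(\<rho> x)\<^sup>2 / 2 = a * b / 2 + a * b * (sinh x)\<^sup>2 + a * b * sinh x * cosh x"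
proof -
  have sq: "(\<rho> x)\<^sup>2 = a * b * (cosh x + sinh x)\<^sup>2"
    using ab0 by (simp add: \<rho>_def power_mult_distrib cosh_plus_sinh)
  have "(cosh x + sinh x)\<^sup>2 = 1 + 2 * (sinh x)\<^sup>2 + 2 * (sinh x * cosh x)"
    using cosh_square_eq[of x] by (simp add: power2_sum)
  then have "(\<rho> x)\<^sup>2 = 2 * (a * b / 2 + a * b * (sinh x)\<^sup>2 + a * b * sinh x * cosh x)"
    unfolding sq by (simp add: algebra_simps)
  then show ?thesis by simp
qed

lemma symmetrized: "symmetrized_profile (real n) (a * b) half_width (\<lambda>x. \<phi> (\<rho> x) / \<rho> x) (\<lambda>x. \<phi>' (\<rho> x) - \<phi> (\<rho> x) / \<rho> x)"
proof
  show "1 < real n" "0 < a * b" "0 < half_width" using n2 ab0 half_width_pos by auto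
  have chain: "((\<lambda>x. f (\<rho> x)) has_real_derivative f' * \<rho> x) (at x within {- half_width..half_width})"
    if "(f has_real_derivative f') (at (\<rho> x) within {a..b})" for f f' x
  proof -
    have "(f has_real_derivative f') (at (\<rho> x) within \<rho> ` {- half_width..half_width})"
      by (rule DERIV_subset[OF that]) (use \<rho>_range in auto)
    from DERIV_image_chain[OF this \<rho>_deriv] show ?thesis by (simp add: o_def)
  qed
  fix x
  have r0: "\<rho> x \<noteq> 0" "0 < \<rho> x" using \<rho>_pos[of x] by auto
  show dG: "((\<lambda>x. \<phi> (\<rho> x) / \<rho> x) has_real_derivative \<phi>' (\<rho> x) - \<phi> (\<rho> x) / \<rho> x) (at x within {- half_width..half_width})"
    if x: "x \<in> {- half_width..half_width}" for x
    by (rule DERIV_cong, rule DERIV_divide[OF chain[OF d\<phi>[OF \<rho>_range[OF x]]] \<rho>_deriv])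
      (use \<rho>_pos[of x] in \<open>simp_all add: field_simps\<close>)
  show "((\<lambda>x. \<phi>' (\<rho> x) - \<phi> (\<rho> x) / \<rho> x) has_real_derivative
      - (real n - a * b / 2 - a * b * (sinh x)\<^sup>2 - a * b * sinh x * cosh x) * (\<phi>' (\<rho> x) - \<phi> (\<rho> x) / \<rho> x)
      - (real n - 1) * (\<phi> (\<rho> x) / \<rho> x)) (at x within {- half_width..half_width})"
    if x: "x \<in> {- half_width..half_width}"
  proof -
    have H: "real n - a * b / 2 - a * b * (sinh x)\<^sup>2 - a * b * sinh x * cosh x = real n - (\<rho> x)\<^sup>2 / 2"
      using \<rho>_square[of x] by linarith
    show ?thesis unfolding H
      by (rule DERIV_cong, rule DERIV_diff[OF chain[OF d\<phi>'[OF \<rho>_range[OF x]]] dG[OF x]])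
        (use r0 in \<open>simp add: field_simps power2_eq_square drift_def\<close>)
  qed
  show "0 < \<phi> (\<rho> x) / \<rho> x" if x: "- half_width < x" "x < half_width"
    using \<rho>_strict_mono[OF x(1)] \<rho>_strict_mono[OF x(2)] \<phi>pos[of "\<rho> x"] r0 by (simp add: \<rho>_ends)
  show "(\<phi>' (\<rho> x) - \<phi> (\<rho> x) / \<rho> x) * (\<phi> (\<rho> (- x)) / \<rho> (- x)) < \<phi> (\<rho> x) / \<rho> x * (\<phi>' (\<rho> (- x)) - \<phi> (\<rho> (- x)) / \<rho> (- x))"
    if x: "0 < x" "x < half_width"
  proof -
    have st: "a < \<rho> (- x)" "\<rho> (- x) < \<rho> x" "\<rho> x < b"
      using \<rho>_strict_mono[of "- half_width" "- x"] \<rho>_strict_mono[of "- x" x] \<rho>_strict_mono[of x half_width] x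
      by (simp_all add: \<rho>_ends)
    have p: "0 < \<rho> x" "0 < \<rho> (- x)" by (rule \<rho>_pos)+
    show ?thesis
      using divide_strict_right_mono[OF scaling_quotient_decreasing[OF st], of "\<rho> x * \<rho> (- x)"] p
      by (simp add: field_simps)
  qed
next
  show "\<phi> (\<rho> (- half_width)) / \<rho> (- half_width) = 0" "\<phi> (\<rho> half_width) / \<rho> half_width = 0"
    "\<phi>' (\<rho> (- half_width)) - \<phi> (\<rho> (- half_width)) / \<rho> (- half_width) = 1"
    "\<phi>' (\<rho> half_width) - \<phi> (\<rho> half_width) / \<rho> half_width = - 1"
    by (simp_all add: \<rho>_ends \<phi>a \<phi>b \<phi>'a \<phi>'b)
qed

lemma width_square: "a * b * (sinh half_width)\<^sup>2 = (b - a)\<^sup>2 / 4"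
proof -
  have "b - a = 2 * (sqrt (a * b) * sinh half_width)"
    using \<rho>_ends by (simp add: \<rho>_def sinh_def algebra_simps)
  then have "(b - a)\<^sup>2 = 4 * (a * b) * (sinh half_width)\<^sup>2"
    using ab0 by (simp add: power_mult_distrib)
  then show ?thesis by simp
qed

text \<open>These are the bounds 0 < \<kappa> < Ymax, rewritten with P = a b and Ymax = (b - a)^2 /
  4.\<close>

lemma endpoint_relations: "a * b < 2 * real n" "4 * real n < a\<^sup>2 + b\<^sup>2"
proof -
  interpret sp: symmetrized_profile "real n" "a * b" half_width "\<lambda>x. \<phi> (\<rho> x) / \<rho> x" "\<lambda>x. \<phi>' (\<rho> x) - \<phi> (\<rho> x) / \<rho> x"
    by (rule symmetrized)
  show "a * b < 2 * real n" using sp.\<kappa>_bounds(1) by (simp add: sp.\<kappa>_def)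
  have "real n - a * b / 2 < (b - a)\<^sup>2 / 4"
    using sp.\<kappa>_bounds(2) by (simp add: sp.\<kappa>_def sp.Ymax_def sp.Y_def width_square)
  then show "4 * real n < a\<^sup>2 + b\<^sup>2" by (simp add: power2_diff field_simps)
qed

text \<open>The comparison function \<open>(s\<^sub>1\<^sup>2 - s\<^sup>2) (1 + s\<^sup>2 / 10)\<close>, \<open>s\<^sub>1 = 7 / 4\<close>, in the variable \<open>s = r - sqrt (2 n)\<close>.\<close>

lemma width_bound:
  assumes "40 \<le> n"
  shows "b - a < 397 / 100"
proof -
  define q where "q = sqrt (2 * real n)"
  have qq: "q * q = 2 * real n" by (simp add: q_def)
  have q: "89 / 10 < q" unfolding q_def by (rule real_less_rsqrt) (use assms in \<open>simp add: power2_eq_square\<close>)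
  define F F1 F2 :: "real \<Rightarrow> real" where
    "F = (\<lambda>r. 49/16 - 111/160 * (r - q)^2 - 1/10 * (r - q)^4)" and
    "F1 = (\<lambda>r. - 111/80 * (r - q) - 4/10 * (r - q)^3)" and
    "F2 = (\<lambda>r. - 111/80 - 12/10 * (r - q)^2)"
  have "q - 7/4 \<le> a" if "q + 7/4 \<le> b"
  proof (rule inner_radius_ge[where F = F and ?F1.0 = F1 and ?F2.0 = F2, OF _ _ _ that])
    show "(F has_real_derivative F1 r) (at r)" "(F1 has_real_derivative F2 r) (at r)" for r
    proof -
      have d: "((\<lambda>r. (r - q) ^ k) has_real_derivative real k * (r - q) ^ (k - 1)) (at r)" for k
        by (auto intro!: derivative_eq_intros)
      have d1: "((\<lambda>r. r - q) has_real_derivative 1) (at r)" by (auto intro!: derivative_eq_intros)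
      show "(F has_real_derivative F1 r) (at r)"
        unfolding F_def F1_def
        by (rule DERIV_cong[OF DERIV_diff[OF DERIV_diff[OF DERIV_const DERIV_cmult[OF d]] DERIV_cmult[OF d]]]) simp
      show "(F1 has_real_derivative F2 r) (at r)"
        unfolding F1_def F2_def
        by (rule DERIV_cong[OF DERIV_diff[OF DERIV_cmult[OF d1] DERIV_cmult[OF d]]]) simp
    qed
    show "F (q - 7/4) = 0" "F (q + 7/4) = 0" "0 \<le> F1 (q - 7/4)" "F1 (q + 7/4) \<le> 0"
      by (simp_all add: F_def F1_def eval_nat_numeral)
    fix r assume r: "q - 7/4 \<le> r" "r \<le> q + 7/4"
    define s y where "s = r - q" and "y = s * s"
    have s: "\<bar>s\<bar> \<le> 7/4" unfolding s_def using r by (intro abs_leI) linarith+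
    have y: "0 \<le> y" "y \<le> 49/16" using mult_mono[OF s s] by (simp_all add: y_def)
    \<comment> \<open>At r = q + s the residual is q E + s B with y = s^2. The even part gains the
      factor q > 8.9 and has to beat the worst sign of the odd part.\<close>
    define E where "E = 23/160 - 51/320 * y + 7/20 * (y * y)"
    define B where "B = 49/32 - 29/64 * y + 3/20 * (y * y)"
    have E0: "0 < E" using zero_le_square[of "y - 51/224"] by (simp add: E_def algebra_simps)
    have "0 \<le> y * (49/16 - y)" using y by (intro mult_nonneg_nonneg) auto
    then have B1: "B \<le> 156/100" using y by (simp add: B_def algebra_simps)
    have B0: "0 \<le> B" using y by (simp add: B_def)
    have ys: "y = \<bar>s\<bar> * \<bar>s\<bar>" by (simp add: y_def)
    have "\<bar>s\<bar> * B \<le> \<bar>s\<bar> * (156/100)" using B1 by (intro mult_left_mono) auto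
    moreover have "\<bar>s\<bar> \<le> y / (14/10) + 35/100"
      using zero_le_square[of "\<bar>s\<bar> - 7/10"] by (simp add: ys algebra_simps)
    ultimately have "\<bar>s\<bar> * B \<le> 156/140 * y + 546/1000" by simp
    moreover have "156/140 * y + 546/1000 < 89/10 * E"
    proof -
      have "(y - 4/10) * (y - 4/10) = y * y - 8/10 * y + 16/100" by (simp add: field_simps)
      then have "0 \<le> y * y - 8/10 * y + 16/100" using zero_le_square[of "y - 4/10"] by linarith
      moreover have "89/10 * E = 2047/1600 - 4539/3200 * y + 623/200 * (y * y)" by (simp add: E_def field_simps)
      ultimately show ?thesis using y by linarith
    qed
    moreover have "89/10 * E \<le> q * E" using q E0 by (intro mult_right_mono) auto
    moreover have "- (\<bar>s\<bar> * B) \<le> s * B" using mult_right_mono[OF _ B0, of "- \<bar>s\<bar>" s] by simp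
    ultimately have pos: "0 < q * E + s * B" by linarith
    have rs: "r = q + s" by (simp add: s_def)
    have nq: "real n = q * q / 2" using qq by simp
    have "profile_op F F1 F2 r = q * E + s * B"
      unfolding profile_op_def F_def F1_def F2_def nq E_def B_def y_def unfolding rs
      by (simp add: eval_nat_numeral algebra_simps add_divide_distrib diff_divide_distrib)
    then show "0 < profile_op F F1 F2 r" using pos by simp
  qed (use q in simp)
  \<comment> \<open>The width 3.97 is split as 1.75 + 2.22. If \<open>a\<close> is at least q -
    1.75, a larger width contradicts a b < 2n; otherwise b < q + 1.75 and it contradicts a^2 + b^2 >
    4n.\<close>
  then consider "q - 7/4 \<le> a" | "b < q + 7/4" by linarith
  then show ?thesis
  proof cases
    case 1
    show ?thesis
    proof (rule ccontr)
      assume "\<not> ?thesis"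
      then have "q + 222/100 \<le> b" using 1 by simp
      then have "(q - 7/4) * (q + 222/100) \<le> a * b" using 1 q a0 by (intro mult_mono) auto
      moreover have "(q - 7/4) * (q + 222/100) = q * q + 47/100 * q - 3885/1000" by (simp add: field_simps)
      ultimately show False using endpoint_relations(1) qq q by linarith
    qed
  next
    case 2
    show ?thesis
    proof (rule ccontr)
      assume "\<not> ?thesis"
      then have al: "a \<le> q - 222/100" using 2 by simp
      have "a * a \<le> (q - 222/100) * (q - 222/100)" using al a0 by (intro mult_mono) auto
      moreover have "b * b \<le> (q + 7/4) * (q + 7/4)" using 2 ab0 by (intro mult_mono) auto
      moreover have "(q - 222/100) * (q - 222/100) = q * q - 444/100 * q + 49284/10000" by (simp add: field_simps)
      moreover have "(q + 7/4) * (q + 7/4) = q * q + 7/2 * q + 49/16" by (simp add: field_simps)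
      moreover have "4 * real n < a * a + b * b" using endpoint_relations(2) by (simp add: power2_eq_square)
      ultimately show False using qq q by linarith
    qed
  qed
qed

lemma large_n:
  assumes n: "40 \<le> n"
  shows "b\<^sup>2 \<le> 3 * (real n + 3)" "b ^ 5 * wgt n b - a ^ 5 * wgt n a < 2 * integral {a..b} (\<lambda>r. r ^ 4 * wgt n r)"
proof -
  have wid: "0 < b - a" "b - a < 397/100" using ab width_bound[OF n] by auto
  show "b\<^sup>2 \<le> 3 * (real n + 3)"
  proof (rule ccontr)
    assume "\<not> ?thesis"
    then have big: "3 * real n + 9 < b * b" by (simp add: power2_eq_square)
    have b0: "113/10 < b"
    proof (rule ccontr)
      assume "\<not> 113/10 < b"
      then have "b * b \<le> 113/10 * (113/10)" using ab0 by (intro mult_mono) auto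
      then show False using big n by simp
    qed
    have "b * (b - a) \<le> b * (397/100)" using wid ab0 by (intro mult_left_mono) auto
    then have "b * b \<le> 2 * real n + b * (397/100)" using endpoint_relations(1) by (simp add: algebra_simps)
    \<comment> \<open>The coefficient 1191/100 is three times the width bound 397/100, so b can be
      eliminated linearly between this product and the preceding estimate.\<close>
    moreover have "0 < (b - 113/10) * (b - 61/100)" using b0 by (intro mult_pos_pos) auto
    moreover have "(b - 113/10) * (b - 61/100) = b * b - 1191/100 * b + 6893/1000" by (simp add: field_simps)
    ultimately show False using big by linarith
  qed
  interpret sp: symmetrized_profile "real n" "a * b" half_width "\<lambda>x. \<phi> (\<rho> x) / \<rho> x" "\<lambda>x. \<phi>' (\<rho> x) - \<phi> (\<rho> x) / \<rho> x"
    by (rule symmetrized)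
  have Ymax: "sp.Ymax = (b - a)\<^sup>2 / 4" by (simp add: sp.Ymax_def sp.Y_def width_square)
  have "(b - a) * (b - a) \<le> 397/100 * (397/100)" using wid by (intro mult_mono) auto
  then have Y395: "sp.Ymax \<le> 79/20" by (simp add: Ymax power2_eq_square)
  have k: "0 < sp.\<kappa>" "sp.\<kappa> < sp.Ymax" by (rule sp.\<kappa>_bounds)+
  \<comment> \<open>From \<kappa> < 3.95 and n at least 40: a b = 2 (n - \<kappa>) > 72.1.\<close>
  have P72: "72 \<le> a * b" using k Y395 n by (simp add: sp.\<kappa>_def)
  have Yk: "sp.Ymax \<le> 4 + sp.\<kappa>" using Y395 k by simp
  define C where "C = sqrt (a * b) ^ (n + 4) * exp (- (a * b) / 4)"
  have C0: "0 < C" using ab0 by (simp add: C_def)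
  have kern: "\<rho> x ^ 4 * wgt n (\<rho> x) * \<rho> x = C * (sp.\<omega> x * exp (sp.\<Theta> x))" for x
  proof -
    have n4: "4 + (n - 1) + 1 = n + 4" using n by simp
    have "\<rho> x ^ 4 * wgt n (\<rho> x) * \<rho> x = \<rho> x ^ (4 + (n - 1) + 1) * exp (- ((\<rho> x)\<^sup>2) / 4)"
      unfolding wgt_def power_add by simp
    also have "\<dots> = sqrt (a * b) ^ (n + 4) * exp (real (n + 4) * x) * exp (- ((\<rho> x)\<^sup>2) / 4)"
      unfolding n4 by (simp only: \<rho>_def power_mult_distrib exp_of_nat_mult)
    also have "\<dots> = sqrt (a * b) ^ (n + 4) * (exp (real (n + 4) * x) * exp (- ((\<rho> x)\<^sup>2) / 4))"
      by (simp only: mult.assoc)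
    also have "exp (real (n + 4) * x) * exp (- ((\<rho> x)\<^sup>2) / 4) = exp (- (a * b) / 4) * (sp.\<omega> x * exp (sp.\<Theta> x))"
    proof -
      have v: "a * b / 2 * (sinh x * cosh x) = (a * b * sinh x * cosh x) / 2" by (simp add: mult.assoc)
      have nx: "real (n + 4) * x = (real n + 4) * x" by simp
      have e: "real (n + 4) * x + - ((\<rho> x)\<^sup>2) / 4 = - (a * b) / 4 + (- (sp.Y x) / 2 + sp.\<Theta> x)"
        unfolding sp.\<Theta>_def sp.Y_def sp.S_def v nx using \<rho>_square[of x] by linarith
      have "exp (real (n + 4) * x) * exp (- ((\<rho> x)\<^sup>2) / 4) = exp (real (n + 4) * x + - ((\<rho> x)\<^sup>2) / 4)"
        by (rule exp_add[symmetric])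
      also have "\<dots> = exp (- (a * b) / 4) * (sp.\<omega> x * exp (sp.\<Theta> x))"
        unfolding e by (simp only: exp_add sp.\<omega>_def)
      finally show ?thesis .
    qed
    finally show ?thesis by (simp add: C_def mult.assoc)
  qed
  have cw: "continuous_on {a..b} (\<lambda>r. r ^ 4 * wgt n r)"
  proof -
    have "continuous_on {a..b} (wgt n)" by (rule DERIV_continuous_on, rule wgt_deriv[OF r_pos n1])
    then show ?thesis by (intro continuous_intros)
  qed
  define I where "I = (\<lambda>r. integral {a..r} (\<lambda>r. r ^ 4 * wgt n r))"
  have dI: "(I has_real_derivative r ^ 4 * wgt n r) (at r)" if "a < r" "r < b" for r
  proof -
    have "(I has_real_derivative r ^ 4 * wgt n r) (at r within {a..b})"
      unfolding I_def has_real_derivative_iff_has_vector_derivative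
      using that by (intro integral_has_vector_derivative cw) auto
    then show ?thesis using that at_within_interior[of r "{a..b}"] by (simp add: interior_atLeastAtMost_real)
  qed
  have cI: "continuous_on {a..b} I"
    unfolding I_def by (intro indefinite_integral_continuous_1 integrable_continuous_real cw)
  \<comment> \<open>The integral over the symmetric interval [- x, x] in ln r, normalised by
    \<open>C\<close>; its derivative folds the two ends into a hyperbolic cosine.\<close>
  define M where "M = (\<lambda>x. (I (\<rho> x) - I (\<rho> (- x))) / C)"
  have c\<rho>: "continuous_on A \<rho>" "continuous_on A (\<lambda>x. \<rho> (- x))" for A
    unfolding \<rho>_def by (intro continuous_intros)+
  have cM: "continuous_on {0..half_width} M"
    unfolding M_def
    by (intro continuous_intros continuous_on_compose2[OF cI c\<rho>(1)] continuous_on_compose2[OF cI c\<rho>(2)])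
      (use C0 \<rho>_range in \<open>force+\<close>)
  have M0: "M 0 = 0" by (simp add: M_def)
  have dM: "(M has_real_derivative 2 * sp.\<omega> x * cosh (sp.\<Theta> x)) (at x)" if x: "0 < x" "x < half_width" for x
  proof -
    have st: "a < \<rho> (- x)" "\<rho> (- x) < b" "a < \<rho> x" "\<rho> x < b"
      using \<rho>_strict_mono[of "- half_width" "- x"] \<rho>_strict_mono[of "- x" half_width]
        \<rho>_strict_mono[of "- half_width" x] \<rho>_strict_mono[of x half_width] x by (simp_all add: \<rho>_ends)
    have m: "((\<lambda>x. \<rho> (- x)) has_real_derivative - \<rho> (- x)) (at x)"
      unfolding \<rho>_def by (auto intro!: derivative_eq_intros)
    have w: "sp.\<omega> (- x) = sp.\<omega> x" "sp.\<Theta> (- x) = - sp.\<Theta> x"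
      by (simp_all add: sp.\<omega>_def sp.Y_def sp.\<Theta>_def sp.S_def)
    have "(M has_real_derivative (\<rho> x ^ 4 * wgt n (\<rho> x) * \<rho> x - \<rho> (- x) ^ 4 * wgt n (\<rho> (- x)) * - \<rho> (- x)) / C) (at x)"
      unfolding M_def
      by (intro DERIV_cdivide DERIV_diff DERIV_chain2[OF dI[OF st(3,4)] \<rho>_deriv] DERIV_chain2[OF dI[OF st(1,2)] m])
    moreover have "(\<rho> x ^ 4 * wgt n (\<rho> x) * \<rho> x - \<rho> (- x) ^ 4 * wgt n (\<rho> (- x)) * - \<rho> (- x)) / C = 2 * sp.\<omega> x * cosh (sp.\<Theta> x)"
      using kern[of x] kern[of "- x"] C0 by (simp add: w cosh_def field_simps)
    ultimately show ?thesis by simp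
  qed
  note hyp = sp.hyperbolic_cert[OF _ P72 _ _ _ Yk cM M0 dM]
  note bal = sp.balance_cert[OF _ P72]
  have "52/20 < sp.Ymax"
  proof (rule ccontr)
    assume "\<not> ?thesis"
    then show False by (intro bal[OF large_n_certs(1)]) (use k in simp_all)
  qed
  then consider "52/20 \<le> sp.Ymax" "sp.Ymax \<le> 55/20" | "55/20 \<le> sp.Ymax" "sp.Ymax \<le> 60/20" | "60/20 \<le> sp.Ymax"
    by linarith
  then have main: "sp.\<omega> half_width * sinh (sp.\<Theta> half_width) < M half_width"
  proof cases
    case 1
    have "sp.\<kappa> \<le> 168/100"
      by (rule ccontr, rule bal[OF large_n_certs(2)]) (use 1 k in simp_all)
    then show ?thesis by (intro hyp[OF large_n_certs(3)]) (use 1 in simp_all)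
  next
    case 2
    have "sp.\<kappa> \<le> 180/100"
      by (rule ccontr, rule bal[OF large_n_certs(4)]) (use 2 k in simp_all)
    then show ?thesis by (intro hyp[OF large_n_certs(5)]) (use 2 in simp_all)
  next
    case 3
    have "sp.\<kappa> \<le> 220/100"
      by (rule ccontr, rule bal[OF large_n_certs(6)]) (use 3 k Y395 in simp_all)
    then show ?thesis by (intro hyp[OF large_n_certs(7)]) (use 3 Y395 in simp_all)
  qed
  have Mend: "C * M half_width = integral {a..b} (\<lambda>r. r ^ 4 * wgt n r)"
    using C0 by (simp add: M_def \<rho>_ends I_def)
  have be: "b ^ 5 * wgt n b = C * (sp.\<omega> half_width * exp (sp.\<Theta> half_width))"
    using kern[of half_width] by (simp add: \<rho>_ends eval_nat_numeral algebra_simps)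
  have "sp.\<omega> (- half_width) = sp.\<omega> half_width" "sp.\<Theta> (- half_width) = - sp.\<Theta> half_width"
    by (simp_all add: sp.\<omega>_def sp.Y_def sp.\<Theta>_def sp.S_def)
  then have ae: "a ^ 5 * wgt n a = C * (sp.\<omega> half_width * exp (- sp.\<Theta> half_width))"
    using kern[of "- half_width"] by (simp add: \<rho>_ends eval_nat_numeral algebra_simps)
  have "b ^ 5 * wgt n b - a ^ 5 * wgt n a = 2 * (C * (sp.\<omega> half_width * sinh (sp.\<Theta> half_width)))"
    unfolding be ae by (simp add: sinh_def field_simps)
  also have "\<dots> < 2 * (C * M half_width)" using main C0 by simp
  finally show "b ^ 5 * wgt n b - a ^ 5 * wgt n a < 2 * integral {a..b} (\<lambda>r. r ^ 4 * wgt n r)" by (simp only: Mend)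
qed

end

section \<open>Dimensions 2 to 39\<close>

text \<open>The last two conditions link the certificates: the inner and moment intervals end at the
  certified lower bound for \<open>b\<close>, and the upper bound (K + L) / E for \<open>b\<close>
  satisfies b^2 \<le> 3 (n + 3).\<close>

definition tabulated :: "int \<Rightarrow> bool" where
  "tabulated n \<longleftrightarrow> (\<exists>I J D P M d0 bs0 d1 t1 bs1 d2 t2 bs2 I' J' D' F d3 bs3 Q m d4 bs4 K L E H d5 bs5 U d6 bs6 d7 t7 bs7.
    outer_ge_cert n I J D P M d0 bs0 d1 t1 bs1 d2 t2 bs2 \<and> inner_ge_cert n I' J' D' F d3 bs3 \<and>
    moment_cert n I' J' D' Q m d4 bs4 \<and> inner_ge_cert n K L E H d5 bs5 \<and> outer_le_cert n K L E U d6 bs6 d7 t7 bs7 \<and>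
    (I' + J') * D = (I + J) * D' \<and> (K + L)\<^sup>2 \<le> 3 * (n + 3) * E\<^sup>2)"

lemma tabulatedI:
  "outer_ge_cert n I J D P M d0 bs0 d1 t1 bs1 d2 t2 bs2 \<Longrightarrow> inner_ge_cert n I' J' D' F d3 bs3 \<Longrightarrow>
    moment_cert n I' J' D' Q m d4 bs4 \<Longrightarrow> inner_ge_cert n K L E H d5 bs5 \<Longrightarrow> outer_le_cert n K L E U d6 bs6 d7 t7 bs7 \<Longrightarrow>
    (I' + J') * D = (I + J) * D' \<Longrightarrow> (K + L)\<^sup>2 \<le> 3 * (n + 3) * E\<^sup>2 \<Longrightarrow> tabulated n"
  unfolding tabulated_def by (intro exI conjI)

lemma (in annulus) tabulated:
  assumes "tabulated (int n)"
  shows "b\<^sup>2 \<le> 3 * (real n + 3)" "b ^ 5 * wgt n b - a ^ 5 * wgt n a < 2 * integral {a..b} (\<lambda>r. r ^ 4 * wgt n r)"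
proof -
  obtain I J D P M d0 bs0 d1 t1 bs1 d2 t2 bs2 I' J' D' F d3 bs3 Q m d4 bs4 K L E H d5 bs5 U d6 bs6 d7 t7 bs7 where
    c: "outer_ge_cert (int n) I J D P M d0 bs0 d1 t1 bs1 d2 t2 bs2" "inner_ge_cert (int n) I' J' D' F d3 bs3"
    "moment_cert (int n) I' J' D' Q m d4 bs4" "inner_ge_cert (int n) K L E H d5 bs5" "outer_le_cert (int n) K L E U d6 bs6 d7 t7 bs7"
    "(I' + J') * D = (I + J) * D'" "(K + L)\<^sup>2 \<le> 3 * (int n + 3) * E\<^sup>2"
    using assms unfolding tabulated_def by (elim exE conjE) (rule that)
  have D: "0 < D" "0 < D'" "0 < E"
    using c unfolding outer_ge_cert_def inner_ge_cert_def by auto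
  have "real_of_int ((I' + J') * D) = real_of_int ((I + J) * D')" by (simp only: c(6))
  then have "real_of_int (I' + J') / D' = real_of_int (I + J) / D" using D by (simp add: frac_eq_eq)
  then have d: "real_of_int (I' + J') / D' \<le> b" using outer_ge_cert[OF c(1)] by simp
  show "b ^ 5 * wgt n b - a ^ 5 * wgt n a < 2 * integral {a..b} (\<lambda>r. r ^ 4 * wgt n r)"
    by (rule moment_cert[OF c(3) d inner_ge_cert[OF c(2) d]])
  have "b \<le> real_of_int (K + L) / E"
  \<comment> \<open>In the remaining case (K + L) / E is below \<open>b\<close>. This is what the
    second inner certificate needs to bound \<open>a\<close> from below, and that bound is what the
    outer certificate needs.\<close>
  proof (cases "b \<le> real_of_int (K + L) / E")
    case False
    then show ?thesis by (intro outer_le_cert[OF c(5)] inner_ge_cert[OF c(4)]) simp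
  qed simp
  then have "b\<^sup>2 \<le> (real_of_int (K + L) / E)\<^sup>2" using a0 ab by (intro power_mono) auto
  also have "\<dots> \<le> 3 * (real n + 3)"
    using D(3) of_int_le_iff[of "(K + L)\<^sup>2" "3 * (int n + 3) * E\<^sup>2", where 'a = real] c(7)
    by (simp add: power_divide pos_divide_le_eq)
  finally show "b\<^sup>2 \<le> 3 * (real n + 3)" .
qed

text \<open>The same five entries recur for every dimension: lower bound for \<open>b\<close>, lower
  bound for \<open>a\<close> from it, degree 3 condition, lower bound for \<open>a\<close> relative
  to the proposed upper bound of \<open>b\<close>, and that upper bound. The polynomials are mere
  data; the proofs rest only on the checked signs and integer inequalities.\<close>

lemma certs_2:
  "outer_ge_cert 2 397 341 200 [3580195, 815241, -6865324, 1872470, 3843397, -2244364, -621761, 877075, -74615, -714999, 431507, 1080634, -796250, -1234236, 934494, 758804, -582219, -203508, 157692] 1005693 6 [-6, -2, 2, 5, 6] 8 1 [-8, 1] 1 0 [0, 1]"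
  "inner_ge_cert 2 379 359 200 [100, 16, -69, -16, -31] 3 [-3, -1, 1, 3]"
  "moment_cert 2 379 359 200 [-58, 21, 15, 16, -7, 13] 100 4 [-4, -1, 3, 4]"
  "inner_ge_cert 2 83 71 40 [100, 23, -66, -20, -20, -3, -14] 8 [-8, -5, -3, 4, 8]"
  "outer_le_cert 2 83 71 40 [-223, 925, -4, -1000, 416, 339, -236, -41, 46] 4 [-4, -3, 2, 4] 1 0 [-1, 0]"
  by code_simp+

lemma tabulated_2: "tabulated 2"
  by (rule tabulatedI[OF certs_2]) simp_all

lemma certs_3:
  "outer_ge_cert 3 1199 837 500 [2336051, 1863644, -4981570, -366434, 3635835, -944217, -1147766, 586162, 162466, -161869, -626, 26121, -3748, -2220, 544] 1000949 1 [-1, 0, 1] 8 1 [-8, 1] 1 0 [0, 1]"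
  "inner_ge_cert 3 2261 1811 1000 [100, 7, -66, -7, -34] 2 [-2, -1, 1, 2]"
  "moment_cert 3 2261 1811 1000 [-611, 214, 171, 118, 40, 22, 46] 1000 4 [-4, 0, 3, 4]"
  "inner_ge_cert 3 99 69 40 [100, 16, -67, -15, -20, -1, -13] 3 [-3, -2, 0, 2, 3]"
  "outer_le_cert 3 99 69 40 [-227, 856, 145, -1000, 245, 449, -219, -78, 55] 3 [-3, -2, 2, 3] 1 0 [-1, 0]"
  by code_simp+

lemma tabulated_3: "tabulated 3"
  by (rule tabulatedI[OF certs_3]) simp_all

lemma certs_4:
  "outer_ge_cert 4 277 166 100 [19892, 21473, -43558, -10926, 34637, -3691, -13454, 4460, 2747, -1516, -252, 213] 10010 2 [-2, 1, 2] 8 1 [-8, 1] 1 0 [0, 1]"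
  "inner_ge_cert 4 229 214 100 [100, -11, -56, 11, -44] 1 [-1, 0, 1]"
  "moment_cert 4 229 214 100 [-673, 199, 158, 235, -180, 261] 1000 3 [-3, 0, 2, 3]"
  "inner_ge_cert 4 57 34 20 [1000, 130, -674, -126, -204, -4, -122] 2 [-2, -1, 0, 1, 2]"
  "outer_le_cert 4 57 34 20 [-2351, 8422, 2171, -10000, 1473, 4932, -1846, -1006, 550] 2 [-2, -1, 1, 2] 1 0 [-1, 0]"
  by code_simp+

lemma tabulated_4: "tabulated 4"
  by (rule tabulatedI[OF certs_4]) simp_all

lemma certs_5:
  "outer_ge_cert 5 62 33 20 [18093, 22852, -39916, -14799, 32955, -62, -14096, 3159, 3354, -1352, -376, 217] 10012 1 [-1, 0, 1] 8 1 [-8, 1] 1 0 [0, 1]"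
  "inner_ge_cert 5 109 81 40 [100, -7, -61, 7, -39] 1 [-1, 0, 1]"
  "moment_cert 5 109 81 40 [-68, 21, 18, 18, -12, 23] 100 3 [-3, -1, 1, 3]"
  "inner_ge_cert 5 127 67 40 [10000, 1029, -6710, -1053, -2275, -62, -539, -122, -476, 208] 4 [-4, -3, -1, 1, 3, 4]"
  "outer_le_cert 5 127 67 40 [-248, 848, 274, -1000, 73, 510, -150, -110, 50] 3 [-3, -2, 1, 3] 1 0 [-1, 0]"
  by code_simp+

lemma tabulated_5: "tabulated 5"
  by (rule tabulatedI[OF certs_5]) simp_all

lemma certs_6:
  "outer_ge_cert 6 68 33 20 [17413, 24063, -38540, -17634, 32679, 2442, -14858, 2202, 3872, -1205, -483, 215] 10066 1 [-1, 0, 1] 8 1 [-8, 1] 1 0 [0, 1]"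
  "inner_ge_cert 6 64 37 20 [100, -1, -64, 1, -36] 1 [-1, 0, 1]"
  "moment_cert 6 64 37 20 [-681, 228, 184, 127, -14, 157] 1000 2 [-2, -1, 1, 2]"
  "inner_ge_cert 6 139 67 40 [1000, 94, -670, -91, -227, -24, -65, 21, -38] 2 [-2, -1, 1, 2]"
  "outer_le_cert 6 139 67 40 [-248, 841, 298, -1000, 30, 525, -128, -118, 47] 3 [-3, -2, 1, 3] 1 0 [-1, 0]"
  by code_simp+

lemma tabulated_6: "tabulated 6"
  by (rule tabulatedI[OF certs_6]) simp_all

lemma certs_7:
  "outer_ge_cert 7 92 41 25 [1629, 2450, -3591, -1918, 3065, 431, -1435, 121, 392, -94, -52, 18] 1006 1 [-1, 0, 1] 8 1 [-8, 1] 1 0 [0, 1]"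
  "inner_ge_cert 7 351 181 100 [100, 0, -65, 0, -35] 1 [-1, 0, 1]"
  "moment_cert 7 351 181 100 [-688, 233, 179, 133, 9, 134] 1000 2 [-2, -1, 1, 2]"
  "inner_ge_cert 7 151 67 40 [100, 10, -67, -9, -23, -3, -6, 2, -4] 2 [-2, -1, 1, 2]"
  "outer_le_cert 7 151 67 40 [-2555, 8362, 3332, -10000, -620, 5324, -158, -1174] 3 [-3, -2, -1, 1, 2, 3] 1 0 [-1, 0]"
  by code_simp+

lemma tabulated_7: "tabulated 7"
  by (rule tabulatedI[OF certs_7]) simp_all

lemma certs_8:
  "outer_ge_cert 8 118 49 30 [1602, 2525, -3491, -2078, 2997, 591, -1457, 37, 448, -68, -88, 14, 9] 1017 1 [-1, 0, 1] 8 1 [-8, 1] 1 0 [0, 1]"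
  "inner_ge_cert 8 109 58 30 [100, -6, -63, 6, -37] 1 [-1, 0, 1]"
  "moment_cert 8 109 58 30 [-71, 22, 18, 15, 4, 3, 9] 100 2 [-2, 0, 1, 2]"
  "inner_ge_cert 8 40 17 10 [100, 8, -67, -8, -21, 0, -12] 2 [-2, -1, 1, 2]"
  "outer_le_cert 8 40 17 10 [-23150, 80037, 31308, -100000, -2435, 60212, -11139, -20371, 6902, 3270, -1489] 2 [-2, -1, 1, 2] 1 0 [-1, 0]"
  by code_simp+

lemma tabulated_8: "tabulated 8"
  by (rule tabulatedI[OF certs_8]) simp_all

lemma certs_9:
  "outer_ge_cert 9 251 97 60 [1477, 2516, -3184, -2109, 2707, 675, -1298, -24, 371, -48, -52, 12] 1017 1 [-1, 0, 1] 8 1 [-8, 1] 1 0 [0, 1]"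
  "inner_ge_cert 9 165 67 40 [100, 2, -67, -6, -21, 4, -12] 2 [-2, -1, 1, 2]"
  "moment_cert 9 165 67 40 [-6758, 2139, 2283, 150, 1930, 1128, -1582, -1701, 4126, -1712] 10000 2 [-2, -1, 0, 1, 2]"
  "inner_ge_cert 9 173 67 40 [1000, 113, -669, -93, -231, -26, -66, 6, -34] 3 [-3, -2, 0, 2, 3]"
  "outer_le_cert 9 173 67 40 [-2533, 8370, 3320, -10000, -654, 5346, -136, -1187] 2 [-2, -1, 1, 2] 1 0 [-1, 0]"
  by code_simp+

lemma tabulated_9: "tabulated 9"
  by (rule tabulatedI[OF certs_9]) simp_all

lemma certs_10:
  "outer_ge_cert 10 265 97 60 [1453, 2535, -3130, -2172, 2668, 747, -1294, -63, 377, -37, -54, 10] 1016 1 [-1, 0, 1] 8 1 [-8, 1] 1 0 [0, 1]"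
  "inner_ge_cert 10 241 121 60 [100, -11, -60, 11, -40] 1 [-1, 0, 1]"
  "moment_cert 10 241 121 60 [-7333, 2084, 1811, 1289, 884, 802, 105, -92, 451] 10000 3 [-3, -1, 2, 3]"
  "inner_ge_cert 10 45 17 10 [100, 8, -67, -8, -21, 0, -12] 2 [-2, -1, 1, 2]"
  "outer_le_cert 10 45 17 10 [-2324, 7967, 3272, -10000, -614, 6180, -600, -2218, 265, 394] 2 [-2, 0, 1, 2] 1 0 [-1, 0]"
  by code_simp+

lemma tabulated_10: "tabulated 10"
  by (rule tabulatedI[OF certs_10]) simp_all

lemma certs_11:
  "outer_ge_cert 11 37 13 8 [14977, 26007, -32257, -23064, 27799, 8522, -14037, -980, 4641, -431, -999, 216, 112, -35] 10188 1 [-1, 0, 1] 8 1 [-8, 1] 1 0 [0, 1]"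
  "inner_ge_cert 11 181 69 40 [100, 0, -67, 0, -33] 3 [-3, -1, 1, 3]"
  "moment_cert 11 181 69 40 [-698, 209, 231, 22, 203, 107, -157, -159, 421, -178] 1000 2 [-2, -1, 0, 1, 2]"
  "inner_ge_cert 11 191 67 40 [100, 11, -67, -9, -23, -2, -7, 0, -3] 2 [-2, -1, 1, 2]"
  "outer_le_cert 11 191 67 40 [-254, 833, 349, -1000, -93, 546, -3, -125] 2 [-2, -1, 1, 2] 1 0 [-1, 0]"
  by code_simp+

lemma tabulated_11: "tabulated 11"
  by (rule tabulatedI[OF certs_11]) simp_all

lemma certs_12:
  "outer_ge_cert 12 97 32 20 [1354, 2545, -2868, -2229, 2425, 860, -1190, -160, 359, 10, -54] 1020 2 [-2, 0, 1, 2] 8 1 [-8, 1] 1 0 [0, 1]"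
  "inner_ge_cert 12 191 67 40 [100, 0, -67, -4, -21, 4, -12] 2 [-2, -1, 1, 2]"
  "moment_cert 12 191 67 40 [-6895, 1987, 2465, 172, 1981, 481, -614, -1387, 3062, -1252] 10000 3 [-3, -2, -1, 1, 2, 3]"
  "inner_ge_cert 12 50 17 10 [100, 11, -67, -8, -22, -3, -11] 2 [-2, -1, 1, 2]"
  "outer_le_cert 12 50 17 10 [-2402, 8113, 3304, -10000, -873, 5593, -32, -1307] 2 [-2, -1, 1, 2] 1 0 [-1, 0]"
  by code_simp+

lemma tabulated_12: "tabulated 12"
  by (rule tabulatedI[OF certs_12]) simp_all

lemma certs_13:
  "outer_ge_cert 13 201 65 40 [1497, 2673, -3192, -2465, 2752, 1009, -1415, -193, 486, 1, -111, 5, 13] 1024 1 [-1, 0, 1] 8 1 [-8, 1] 1 0 [0, 1]"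
  "inner_ge_cert 13 100 33 20 [1000, 7, -672, -33, -227, -1, -66, 27, -35] 2 [-2, -1, 1, 2]"
  "moment_cert 13 100 33 20 [-689, 194, 263, 28, 96, 78, 178, -300, 152] 1000 4 [-4, -2, -1, 1, 3, 4]"
  "inner_ge_cert 13 52 17 10 [100, 11, -66, -8, -23, -3, -11] 2 [-2, -1, 1, 2]"
  "outer_le_cert 13 52 17 10 [-2404, 8098, 3368, -10000, -982, 5636, 14, -1333] 8 [-8, -5, 3, 8] 1 0 [-1, 0]"
  by code_simp+

lemma tabulated_13: "tabulated 13"
  by (rule tabulatedI[OF certs_13]) simp_all

lemma certs_14:
  "outer_ge_cert 14 315 97 60 [1385, 2576, -2979, -2330, 2555, 950, -1283, -197, 398, 16, -62] 1012 2 [-2, 0, 1, 2] 8 1 [-8, 1] 1 0 [0, 1]"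
  "inner_ge_cert 14 601 223 120 [100, -5, -64, 5, -36] 1 [-1, 0, 1]"
  "moment_cert 14 601 223 120 [-7426, 2186, 1830, 1419, 897, 340, 276, 478] 10000 3 [-3, -2, 1, 2, 3]"
  "inner_ge_cert 14 54 17 10 [100, 11, -66, -8, -23, -3, -11] 2 [-2, -1, 1, 2]"
  "outer_le_cert 14 54 17 10 [-2404, 8089, 3394, -10000, -1030, 5660, 37, -1348] 2 [-2, -1, 1, 2] 1 0 [-1, 0]"
  by code_simp+

lemma tabulated_14: "tabulated 14"
  by (rule tabulatedI[OF certs_14]) simp_all

lemma certs_15:
  "outer_ge_cert 15 163 49 30 [1447, 2616, -3149, -2427, 2736, 1023, -1399, -222, 443, 20, -70] 1008 2 [-2, 0, 1, 2] 8 1 [-8, 1] 1 0 [0, 1]"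
  "inner_ge_cert 15 625 223 120 [100, -5, -64, 5, -36] 1 [-1, 0, 1]"
  "moment_cert 15 625 223 120 [-752, 218, 189, 166, 48, 4, 128] 1000 2 [-2, 0, 1, 2]"
  "inner_ge_cert 15 56 17 10 [100, 12, -66, -9, -23, -3, -11] 2 [-2, -1, 1, 2]"
  "outer_le_cert 15 56 17 10 [-2403, 8085, 3385, -10000, -1025, 5667, 39, -1353] 2 [-2, -1, 1, 2] 1 0 [-1, 0]"
  by code_simp+

lemma tabulated_15: "tabulated 15"
  by (rule tabulatedI[OF certs_15]) simp_all

lemma certs_16:
  "outer_ge_cert 16 168 49 30 [1469, 2673, -3166, -2528, 2751, 1099, -1440, -247, 509, 19, -121, 2, 15] 1014 1 [-1, 0, 1] 8 1 [-8, 1] 1 0 [0, 1]"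
  "inner_ge_cert 16 659 209 120 [100, -1, -66, 1, -34] 3 [-3, -1, 1, 3]"
  "moment_cert 16 659 209 120 [-726, 194, 259, 44, 81, 123, 194, -360, 191] 1000 2 [-2, -1, 1, 2]"
  "inner_ge_cert 16 231 69 40 [100, 11, -68, -11, -32] 3 [-3, -1, 1, 3]"
  "outer_le_cert 16 231 69 40 [-2275, 7879, 3251, -10000, -1032, 5808, 54, -1414] 3 [-3, -2, 0, 1, 3] 1 0 [-1, 0]"
  by code_simp+

lemma tabulated_16: "tabulated 16"
  by (rule tabulatedI[OF certs_16]) simp_all

lemma certs_17:
  "outer_ge_cert 17 347 97 60 [1386, 2641, -2946, -2466, 2525, 1073, -1305, -250, 457, 24, -108, 1, 13] 1018 1 [-1, 0, 1] 8 1 [-8, 1] 1 0 [0, 1]"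
  "inner_ge_cert 17 227 69 40 [100, -1, -67, 1, -33] 3 [-3, -1, 1, 3]"
  "moment_cert 17 227 69 40 [-722, 188, 263, 38, 98, 98, 190, -323, 170] 1000 2 [-2, -1, 0, 1, 2]"
  "inner_ge_cert 17 237 71 40 [100, 10, -66, -10, -34] 3 [-3, -1, 1, 3]"
  "outer_le_cert 17 237 71 40 [-1958, 7332, 2879, -10000, -671, 6833, -499, -2750, 248, 543] 6 [-6, -1, 4, 6] 1 0 [-1, 0]"
  by code_simp+

lemma tabulated_17: "tabulated 17"
  by (rule tabulatedI[OF certs_17]) simp_all

lemma certs_18:
  "outer_ge_cert 18 119 32 20 [1321, 2634, -2754, -2445, 2313, 1075, -1148, -262, 351, 30, -53, 0] 1026 2 [-2, 0, 1, 2] 8 1 [-8, 1] 1 0 [0, 1]"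
  "inner_ge_cert 18 118 33 20 [100, 0, -68, -3, -21, 1, -11, 2] 16 [-16, -9, 1, 9, 16]"
  "moment_cert 18 118 33 20 [-699, 172, 274, 18, 222, -43, 3, -52, 200, -95] 1000 12 [-12, -6, 1, 5, 12]"
  "inner_ge_cert 18 62 17 10 [100, 15, -66, -10, -22, -5, -12] 2 [-2, -1, 1, 2]"
  "outer_le_cert 18 62 17 10 [-2387, 8090, 3177, -10000, -734, 5609, -64, -1320] 2 [-2, -1, 1, 2] 1 0 [-1, 0]"
  by code_simp+

lemma tabulated_18: "tabulated 18"
  by (rule tabulatedI[OF certs_18]) simp_all

lemma certs_19:
  "outer_ge_cert 19 49 13 8 [1392, 2647, -2986, -2509, 2576, 1119, -1344, -268, 474, 21, -112, 7, 14, -2] 1012 1 [-1, 0, 1] 8 1 [-8, 1] 1 0 [0, 1]"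
  "inner_ge_cert 19 119 36 20 [100, -3, -65, 3, -35] 1 [-1, 0, 1]"
  "moment_cert 19 119 36 20 [-7461, 1901, 2542, 500, 732, 1532, 2054, -3932, 2133] 10000 2 [-2, -1, 0, 1, 2]"
  "inner_ge_cert 19 64 17 10 [1000, 165, -660, -105, -224, -60, -116] 2 [-2, -1, 0, 1, 2]"
  "outer_le_cert 19 64 17 10 [-1614, 8451, 1499, -10000, 509, 5391, -404, -1225] 1 [-1, 0, 1] 8 (-1) [-8, -1]"
  by code_simp+

lemma tabulated_19: "tabulated 19"
  by (rule tabulatedI[OF certs_19]) simp_all

lemma certs_20:
  "outer_ge_cert 20 251 65 40 [14039, 26841, -29905, -25795, 25749, 11806, -13523, -3007, 4927, 329, -1309, 39, 246, -14, -26] 10160 1 [-1, 0, 1] 8 1 [-8, 1] 1 0 [0, 1]"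
  "inner_ge_cert 20 125 33 20 [1000, 8, -673, -28, -228, 1, -66, 19, -33] 2 [-2, -1, 1, 2]"
  "moment_cert 20 125 33 20 [-715, 175, 276, 98, 90, -160, 349, -112] 1000 3 [-3, -1, 1, 3]"
  "inner_ge_cert 20 263 69 40 [100, 17, -65, -11, -23, -6, -12] 2 [-2, -1, 1, 2]"
  "outer_le_cert 20 263 69 40 [-1504, 8252, 1300, -10000, 638, 5505, -443, -1271] 4 [-4, 1, 4] 8 (-1) [-8, -1]"
  by code_simp+

lemma tabulated_20: "tabulated 20"
  by (rule tabulatedI[OF certs_20]) simp_all

lemma certs_21:
  "outer_ge_cert 21 193 49 30 [14268, 26963, -30635, -26209, 26544, 12171, -14002, -3164, 5027, 359, -1207, 41, 151, -15] 10117 1 [-1, 0, 1] 8 1 [-8, 1] 1 0 [0, 1]"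
  "inner_ge_cert 21 95 26 15 [100, -1, -67, 1, -33] 3 [-3, -1, 1, 3]"
  "moment_cert 21 95 26 15 [-736, 178, 275, 36, 118, 64, 193, -277, 149] 1000 2 [-2, -1, 1, 2]"
  "inner_ge_cert 21 269 69 40 [100, 17, -65, -11, -23, -6, -12] 2 [-2, -1, 1, 2]"
  "outer_le_cert 21 269 69 40 [-150, 824, 133, -1000, 59, 551, -43, -127] 4 [-4, 1, 4] 8 (-1) [-8, -1]"
  by code_simp+

lemma tabulated_21: "tabulated 21"
  by (rule tabulatedI[OF certs_21]) simp_all

lemma certs_22:
  "outer_ge_cert 22 395 97 60 [1371, 2695, -2883, -2597, 2453, 1206, -1254, -317, 403, 40, -65] 1022 2 [-2, -1, 0, 1, 2] 8 1 [-8, 1] 1 0 [0, 1]"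
  "inner_ge_cert 22 261 67 40 [100, -1, -67, -2, -21, 3, -12] 2 [-2, -1, 1, 2]"
  "moment_cert 22 261 67 40 [-717, 168, 282, 11, 170, 46, 132, -224, 133] 1000 4 [-4, -1, 2, 4]"
  "inner_ge_cert 22 137 36 20 [100, 14, -66, -14, -34] 2 [-2, -1, 0, 2]"
  "outer_le_cert 22 137 36 20 [-1924, 7334, 2544, -10000, -532, 6137, -90, -1549] 3 [-3, -2, 0, 1, 3] 1 0 [-1, 0]"
  by code_simp+

lemma tabulated_22: "tabulated 22"
  by (rule tabulatedI[OF certs_22]) simp_all

lemma certs_23:
  "outer_ge_cert 23 202 49 30 [1424, 2718, -3044, -2672, 2633, 1272, -1395, -353, 508, 55, -126, -4, 16] 1012 1 [-1, 0, 1] 8 1 [-8, 1] 1 0 [0, 1]"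
  "inner_ge_cert 23 799 205 120 [100, 0, -68, 0, -32] 3 [-3, -1, 1, 3]"
  "moment_cert 23 799 205 120 [-731, 170, 279, 16, 166, 59, 138, -244, 148] 1000 2 [-2, -1, 1, 2]"
  "inner_ge_cert 23 35 9 5 [100, 13, -66, -13, -34] 2 [-2, -1, 0, 2]"
  "outer_le_cert 23 35 9 5 [-1924, 7328, 2564, -10000, -569, 6154, -73, -1560] 3 [-3, -2, 0, 1, 3] 1 0 [-1, 0]"
  by code_simp+

lemma tabulated_23: "tabulated 23"
  by (rule tabulatedI[OF certs_23]) simp_all

lemma certs_24:
  "outer_ge_cert 24 413 97 60 [1352, 2690, -2846, -2607, 2424, 1233, -1266, -345, 455, 56, -111, -4, 14] 1018 1 [-1, 0, 1] 8 1 [-8, 1] 1 0 [0, 1]"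
  "inner_ge_cert 24 273 67 40 [100, -1, -67, -2, -21, 3, -12] 2 [-2, -1, 1, 2]"
  "moment_cert 24 273 67 40 [-7205, 1626, 2874, 99, 1748, 365, 1330, -2086, 1253] 10000 2 [-2, -1, 1, 2]"
  "inner_ge_cert 24 289 71 40 [100, 16, -68, -16, -32] 3 [-3, -1, 1, 3]"
  "outer_le_cert 24 289 71 40 [-1305, 7880, 900, -10000, 929, 5733, -532, -1365] 6 [-6, 1, 6] 8 (-1) [-8, -1]"
  by code_simp+

lemma tabulated_24: "tabulated 24"
  by (rule tabulatedI[OF certs_24]) simp_all

lemma certs_25:
  "outer_ge_cert 25 211 49 30 [1396, 2695, -2998, -2650, 2594, 1270, -1375, -359, 502, 58, -125, -4, 16] 1008 1 [-1, 0, 1] 8 1 [-8, 1] 1 0 [0, 1]"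
  "inner_ge_cert 25 167 41 24 [100, 0, -68, 0, -32] 3 [-3, -1, 1, 3]"
  "moment_cert 25 167 41 24 [-74, 17, 27, 11, 9, -16, 38, -12] 100 3 [-3, -1, 1, 3]"
  "inner_ge_cert 25 291 75 40 [100, 13, -63, -13, -37] 1 [-1, 0, 1]"
  "outer_le_cert 25 291 75 40 [-1546, 6649, 2017, -10000, 114, 7465, -969, -3254, 382, 684] 3 [-3, 0, 2, 3] 1 0 [-1, 0]"
  by code_simp+

lemma tabulated_25: "tabulated 25"
  by (rule tabulatedI[OF certs_25]) simp_all

lemma certs_26:
  "outer_ge_cert 26 359 81 50 [133354, 266351, -283413, -258400, 242277, 122730, -126684, -34429, 45393, 5342, -10939, -160, 1377, -70] 101097 1 [-1, 0, 1] 8 1 [-8, 1] 1 0 [0, 1]"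
  "inner_ge_cert 26 283 69 40 [100, -1, -67, 1, -33] 3 [-3, -1, 1, 3]"
  "moment_cert 26 283 69 40 [-739, 165, 280, 17, 172, 59, 140, -240, 147] 1000 2 [-2, -1, 1, 2]"
  "inner_ge_cert 26 297 75 40 [100, 13, -63, -13, -37] 1 [-1, 0, 1]"
  "outer_le_cert 26 297 75 40 [-155, 665, 199, -1000, 15, 746, -99, -325, 39, 68] 3 [-3, 0, 2, 3] 1 0 [-1, 0]"
  by code_simp+

lemma tabulated_26: "tabulated 26"
  by (rule tabulatedI[OF certs_26]) simp_all

lemma certs_27:
  "outer_ge_cert 27 219 49 30 [1412, 2743, -3004, -2738, 2588, 1345, -1375, -398, 505, 71, -127, -6, 17] 1013 1 [-1, 0, 1] 8 1 [-8, 1] 1 0 [0, 1]"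
  "inner_ge_cert 27 433 103 60 [100, -1, -68, 1, -32] 3 [-3, -1, 1, 3]"
  "moment_cert 27 433 103 60 [-7365, 1611, 2823, 147, 1765, 513, 1377, -2269, 1400] 10000 3 [-3, -1, 1, 3]"
  "inner_ge_cert 27 153 36 20 [100, 16, -67, -16, -33] 2 [-2, -1, 0, 2]"
  "outer_le_cert 27 153 36 20 [-1212, 7694, 761, -10000, 996, 5858, -551, -1416] 2 [-2, 0, 1, 2] 8 (-1) [-8, -1]"
  by code_simp+

lemma tabulated_27: "tabulated 27"
  by (rule tabulatedI[OF certs_27]) simp_all

lemma certs_28:
  "outer_ge_cert 28 149 32 20 [12643, 26539, -26219, -25462, 21958, 12106, -11287, -3488, 3990, 603, -953, -45, 119, -2] 10201 1 [-1, 0, 1] 8 1 [-8, 1] 1 0 [0, 1]"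
  "inner_ge_cert 28 148 33 20 [1000, -4, -679, -17, -216, 2, -105, 19] 12 [-12, -7, 1, 7, 12]"
  "moment_cert 28 148 33 20 [-716, 150, 300, 4, 185, 15, 129, -168, 103] 1000 2 [-2, -1, 1, 2]"
  "inner_ge_cert 28 39 9 5 [100, 17, -67, -17, -33] 2 [-2, -1, 0, 2]"
  "outer_le_cert 28 39 9 5 [-121, 770, 73, -1000, 104, 585, -57, -142] 8 [-8, 1, 8] 8 (-1) [-8, -1]"
  by code_simp+

lemma tabulated_28: "tabulated 28"
  by (rule tabulatedI[OF certs_28]) simp_all

lemma certs_29:
  "outer_ge_cert 29 227 49 30 [14096, 27565, -29885, -27697, 25683, 13788, -13619, -4170, 4979, 764, -1227, -64, 157, -2] 10147 1 [-1, 0, 1] 8 1 [-8, 1] 1 0 [0, 1]"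
  "inner_ge_cert 29 151 33 20 [1000, 5, -673, -23, -229, 2, -66, 16, -32] 2 [-2, -1, 1, 2]"
  "moment_cert 29 151 33 20 [-722, 149, 322, 26, 68, -33, 331, -141] 1000 2 [-2, -1, 0, 1, 2]"
  "inner_ge_cert 29 159 36 20 [100, 17, -67, -17, -33] 2 [-2, -1, 0, 2]"
  "outer_le_cert 29 159 36 20 [-121, 770, 69, -1000, 110, 585, -59, -141] 6 [-6, 1, 6] 8 (-1) [-8, -1]"
  by code_simp+

lemma tabulated_29: "tabulated 29"
  by (rule tabulatedI[OF certs_29]) simp_all

lemma certs_30:
  "outer_ge_cert 30 617 131 80 [13925, 27156, -29930, -27176, 25890, 13454, -13775, -4023, 5046, 715, -1245, -52, 160, -3] 10057 1 [-1, 0, 1] 8 1 [-8, 1] 1 0 [0, 1]"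
  "inner_ge_cert 30 154 33 20 [1000, 14, -674, -27, -229, 0, -65, 13, -32] 2 [-2, -1, 1, 2]"
  "moment_cert 30 154 33 20 [-735, 167, 266, 98, 217, -264, 252] 1000 2 [-2, 0, 1, 2]"
  "inner_ge_cert 30 323 73 40 [100, 17, -67, -17, -33] 2 [-2, -1, 0, 2]"
  "outer_le_cert 30 323 73 40 [-1129, 7530, 567, -10000, 1160, 5969, -605, -1464] 2 [-2, 0, 1, 2] 8 (-1) [-8, -1]"
  by code_simp+

lemma tabulated_30: "tabulated 30"
  by (rule tabulatedI[OF certs_30]) simp_all

lemma certs_31:
  "outer_ge_cert 31 391 81 50 [1367, 2763, -2842, -2760, 2399, 1362, -1233, -392, 402, 55, -66] 1022 2 [-2, -1, 0, 2] 8 1 [-8, 1] 1 0 [0, 1]"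
  "inner_ge_cert 31 1559 329 200 [1000, -3, -674, -18, -229, 4, -66, 17, -31] 3 [-3, -2, 0, 2, 3]"
  "moment_cert 31 1559 329 200 [-716, 143, 308, -14, 200, 44, 93, -172, 115] 1000 3 [-3, -1, 1, 3]"
  "inner_ge_cert 31 327 75 40 [100, 16, -65, -16, -35] 1 [-1, 0, 1]"
  "outer_le_cert 31 327 75 40 [-976, 7160, 438, -10000, 1107, 6298, -571, -1616] 2 [-2, -1, 1, 2] 8 (-1) [-8, -1]"
  by code_simp+

lemma tabulated_31: "tabulated 31"
  by (rule tabulatedI[OF certs_31]) simp_all

lemma certs_32:
  "outer_ge_cert 32 477 97 60 [1348, 2752, -2795, -2743, 2358, 1370, -1235, -423, 450, 82, -113, -8, 15] 1024 1 [-1, 0, 1] 8 1 [-8, 1] 1 0 [0, 1]"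
  "inner_ge_cert 32 949 199 120 [100, -1, -68, -2, -21, 3, -11] 4 [-4, -2, 1, 4]"
  "moment_cert 32 949 199 120 [-7201, 1403, 3013, 105, 2297, -483, 484, -421, 1408, -602] 10000 3 [-3, -1, 1, 2, 3]"
  "inner_ge_cert 32 331 77 40 [100, 15, -62, -15, -38] 1 [-1, 0, 1]"
  "outer_le_cert 32 331 77 40 [-75, 688, -16, -1000, 262, 649, -267, -179, 95] 2 [-2, -1, 1, 2] 8 (-1) [-8, -1]"
  by code_simp+

lemma tabulated_32: "tabulated 32"
  by (rule tabulatedI[OF certs_32]) simp_all

lemma certs_33:
  "outer_ge_cert 33 809 163 100 [1362, 2722, -2895, -2726, 2481, 1364, -1315, -420, 484, 81, -122, -8, 16] 1010 1 [-1, 0, 1] 8 1 [-8, 1] 1 0 [0, 1]"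
  "inner_ge_cert 33 801 171 100 [100, -1, -68, 1, -32] 3 [-3, -1, 1, 3]"
  "moment_cert 33 801 171 100 [-74, 15, 29, 1, 19, 3, 14, -19, 12] 100 8 [-8, -1, 8]"
  "inner_ge_cert 33 169 38 20 [100, 17, -64, -17, -36] 1 [-1, 0, 1]"
  "outer_le_cert 33 169 38 20 [-910, 7018, 261, -10000, 1273, 6407, -628, -1665] 6 [-6, -3, 2, 6] 8 (-1) [-8, -1]"
  by code_simp+

lemma tabulated_33: "tabulated 33"
  by (rule tabulatedI[OF certs_33]) simp_all

lemma certs_34:
  "outer_ge_cert 34 493 97 60 [13061, 26929, -27435, -26604, 23220, 13178, -12126, -4044, 4377, 789, -1069, -85, 136, 2] 10132 1 [-1, 0, 1] 8 1 [-8, 1] 1 0 [0, 1]"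
  "inner_ge_cert 34 49 10 6 [100, 0, -67, -2, -22, 2, -11] 2 [-2, -1, 1, 2]"
  "moment_cert 34 49 10 6 [-7290, 1417, 3216, 254, 766, -280, 3307, -1388] 10000 4 [-4, -2, 1, 3, 4]"
  "inner_ge_cert 34 86 19 10 [100, 18, -64, -18, -36] 1 [-1, 0, 1]"
  "outer_le_cert 34 86 19 10 [-913, 7033, 196, -10000, 1378, 6393, -665, -1660] 2 [-2, -1, 1, 2] 8 (-1) [-8, -1]"
  by code_simp+

lemma tabulated_34: "tabulated 34"
  by (rule tabulatedI[OF certs_34]) simp_all

lemma certs_35:
  "outer_ge_cert 35 333 65 40 [13558, 27472, -28452, -27645, 24186, 13989, -12793, -4418, 4808, 906, -1350, -110, 272, 5, -30] 10159 1 [-1, 0, 1] 8 1 [-8, 1] 1 0 [0, 1]"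
  "inner_ge_cert 35 331 67 40 [100, -1, -67, -2, -21, 3, -12] 2 [-2, -1, 1, 2]"
  "moment_cert 35 331 67 40 [-73, 14, 31, -1, 20, 5, 10, -18, 12] 100 3 [-3, -1, 1, 3]"
  "inner_ge_cert 35 351 75 40 [100, 20, -65, -20, -35] 1 [-1, 0, 1]"
  "outer_le_cert 35 351 75 40 [-99, 725, 13, -1000, 161, 617, -76, -155] 2 [-2, 0, 1, 2] 8 (-1) [-8, -1]"
  by code_simp+

lemma tabulated_35: "tabulated 35"
  by (rule tabulatedI[OF certs_35]) simp_all

lemma certs_36:
  "outer_ge_cert 36 845 163 100 [1362, 2740, -2883, -2765, 2464, 1402, -1306, -442, 482, 88, -122, -9, 16] 1011 1 [-1, 0, 1] 8 1 [-8, 1] 1 0 [0, 1]"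
  "inner_ge_cert 36 839 169 100 [100, -1, -66, -2, -22, 3, -12] 2 [-2, -1, 1, 2]"
  "moment_cert 36 839 169 100 [-738, 142, 304, 8, 189, 15, 141, -164, 104] 1000 1 [-1, 0, 1]"
  "inner_ge_cert 36 89 19 10 [100, 20, -64, -20, -36] 1 [-1, 0, 1]"
  "outer_le_cert 36 89 19 10 [-92, 710, -1, -1000, 171, 628, -79, -160] 2 [-2, 0, 1, 2] 8 (-1) [-8, -1]"
  by code_simp+

lemma tabulated_36: "tabulated 36"
  by (rule tabulatedI[OF certs_36]) simp_all

lemma certs_37:
  "outer_ge_cert 37 1097 209 128 [13632, 27345, -28984, -27669, 24827, 14089, -13158, -4477, 4831, 920, -1200, -110, 155, 5] 10083 1 [-1, 0, 1] 8 1 [-8, 1] 1 0 [0, 1]"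
  "inner_ge_cert 37 1085 221 128 [100, -1, -67, 1, -33] 3 [-3, -1, 1, 3]"
  "moment_cert 37 1085 221 128 [-7486, 1442, 2933, 127, 1920, 324, 1394, -1889, 1239] 10000 3 [-3, -1, 1, 3]"
  "inner_ge_cert 37 181 38 20 [100, 21, -64, -21, -36] 1 [-1, 0, 1]"
  "outer_le_cert 37 181 38 20 [-923, 7120, -83, -10000, 1834, 6266, -834, -1598] 2 [-2, 0, 1, 2] 8 (-1) [-8, -1]"
  by code_simp+

lemma tabulated_37: "tabulated 37"
  by (rule tabulatedI[OF certs_37]) simp_all

lemma certs_38:
  "outer_ge_cert 38 1111 209 128 [13732, 27579, -29046, -28072, 24820, 14420, -13153, -4650, 4836, 984, -1204, -126, 156, 7] 10114 1 [-1, 0, 1] 8 1 [-8, 1] 1 0 [0, 1]"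
  "inner_ge_cert 38 277 53 32 [100, 1, -68, -3, -21, 2, -11] 2 [-2, -1, 0, 1, 2]"
  "moment_cert 38 277 53 32 [-730, 135, 331, 25, 89, -43, 311, -116] 1000 3 [-3, -1, 1, 3]"
  "inner_ge_cert 38 183 38 20 [100, 21, -64, -21, -36] 1 [-1, 0, 1]"
  "outer_le_cert 38 183 38 20 [-919, 7106, -43, -10000, 1767, 6279, -811, -1603] 2 [-2, 0, 1, 2] 8 (-1) [-8, -1]"
  by code_simp+

lemma tabulated_38: "tabulated 38"
  by (rule tabulatedI[OF certs_38]) simp_all

lemma certs_39:
  "outer_ge_cert 39 439 81 50 [1352, 2787, -2790, -2829, 2344, 1456, -1230, -472, 452, 99, -114, -11, 15] 1024 1 [-1, 0, 1] 8 1 [-8, 1] 1 0 [0, 1]"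
  "inner_ge_cert 39 175 33 20 [1000, -5, -679, -18, -213, 23, -108] 16 [-16, -9, 1, 11, 16]"
  "moment_cert 39 175 33 20 [-7215, 1284, 3100, 60, 2310, -432, 582, -438, 1223, -473] 10000 3 [-3, -1, 1, 2, 3]"
  "inner_ge_cert 39 371 77 40 [100, 21, -63, -21, -37] 1 [-1, 0, 1]"
  "outer_le_cert 39 371 77 40 [-86, 697, -18, -1000, 189, 639, -86, -165] 2 [-2, -1, 1, 2] 8 (-1) [-8, -1]"
  by code_simp+

lemma tabulated_39: "tabulated 39"
  by (rule tabulatedI[OF certs_39]) simp_all

lemma tabulated_small: "list_all tabulated [2..39]"
  by (simp add: tabulated_2 tabulated_3 tabulated_4 tabulated_5 tabulated_6 tabulated_7 tabulated_8 tabulated_9 tabulated_10 tabulated_11 tabulated_12 tabulated_13 tabulated_14 tabulated_15 tabulated_16 tabulated_17 tabulated_18 tabulated_19 tabulated_20 tabulated_21 tabulated_22 tabulated_23 tabulated_24 tabulated_25 tabulated_26 tabulated_27 tabulated_28 tabulated_29 tabulated_30 tabulated_31 tabulated_32 tabulated_33 tabulated_34 tabulated_35 tabulated_36 tabulated_37 tabulated_38 tabulated_39)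

theorem theorem1p5:
  fixes n :: nat and rm rp :: real and \<phi> :: "real \<Rightarrow> real" and \<Lambda> :: "nat \<Rightarrow> nat \<Rightarrow> real"
  assumes "n \<ge> 2"
    and "annular_profile n rm rp \<phi>"
    and "\<And>l. lists_linearized_eigenvalues n l rm rp (\<Lambda> l)"
  shows "\<Lambda> 0 1 > 1 \<and> \<Lambda> 0 2 = 1 \<and>
         \<Lambda> 1 1 = 1 \<and> \<Lambda> 1 2 = 1/2 \<and>
         \<Lambda> 2 1 > 0 \<and> \<Lambda> 2 2 < 0 \<and>
         \<Lambda> 3 1 > 0 \<and> \<Lambda> 3 2 < 0 \<and>
         (\<forall>l\<ge>4. \<forall>k\<ge>1. \<Lambda> l k < 0) \<and>
         (\<forall>l. \<forall>k\<ge>3. \<Lambda> l k < 0)"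
proof -
  obtain \<phi>' where ann: "annulus n rm rp \<phi> \<phi>'" using annular_profile_annulus[OF assms(1,2)] .
  have "rp\<^sup>2 \<le> 3 * (real n + 3) \<and> rp ^ 5 * wgt n rp - rm ^ 5 * wgt n rm < 2 * integral {rm..rp} (\<lambda>r. r ^ 4 * wgt n r)"
  proof (cases "n < 40")
    case True
    then have "int n \<in> {2..39}" using assms(1) unfolding atLeastAtMost_iff by linarith
    then have "tabulated (int n)" using tabulated_small unfolding list_all_iff set_upto by blast
    then show ?thesis using annulus.tabulated[OF ann] by blast
  next
    case False
    then have "40 \<le> n" by simp
    then show ?thesis using annulus.large_n[OF ann] by blast
  qed
  then show ?thesis using eigenvalues_conclusion[OF ann assms(3)] by blast
qed

end
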